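(* Let $r,d,D,m$ be positive integers. There exists $N_0=N_0(d,D,m,r)$ such that the following holds. Let $H$ be an $r$-uniform semialgebraic hypergraph of description complexity $(d,D,m)$ on $N\geq N_0$ vertices. Then $H$ contains a clique or an independent set of size $n$, where $n$ is the least positive integer with $N\leq \mathrm{tw}_{3D^3}(n)$.
   Context: The tower function is defined by $\mathrm{tw}_1(x)=x$ and $\mathrm{tw}_k(x)=2^{\mathrm{tw}_{k-1}(x)}$ for $k\geq 2$. For an ordered set $A$ and integer $k\ge 0$, $A^{(k)}=\{(a_1,\dots,a_k)\in A^k: a_1<\dots<a_k\}$. Semialgebraic hypergraph of description complexity $(d,D,m)$: let $V\subset\mathbb{R}^d$ be a finite set with a total ordering, let $f_1,\dots,f_m:(\mathbb{R}^d)^r\to\mathbb{R}$ be polynomials of (total) degree at most $D$, and let $\Gamma:\{\texttt{false},\texttt{true}\}^m\to\{\texttt{false},\texttt{true}\}$ be a Boolean formula. The $r$-uniform hypergraph $H$ on vertex set $V$ in which $x\in V^{(r)}$ is an edge if and only if $\Gamma(f_1(x)\le 0,\dots,f_m(x)\le 0)=\texttt{true}$, and any hypergraph isomorphic to it, is called semialgebraic of description complexity $(d,D,m)$. A clique is a vertex set all of whose $r$-element subsets are edges; an independent set is a vertex set containing no edge. *)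

theory Defs
  imports Complex_Main
begin

text \<open>Tower function: tw 1 x = x, tw (k+1) x = 2^(tw k x). (tw 0 is set to x; never used.)\<close>
fun tw :: "nat \<Rightarrow> nat \<Rightarrow> nat" where
  "tw 0 x = x"
| "tw (Suc 0) x = x"
| "tw (Suc (Suc k)) x = 2 ^ tw (Suc k) x"

definition monomial_exps :: "nat \<Rightarrow> nat \<Rightarrow> (nat \<Rightarrow> nat) set" where
  "monomial_exps k D = {\<alpha>. (\<forall>i\<ge>k. \<alpha> i = 0) \<and> (\<Sum>i<k. \<alpha> i) \<le> D}"

definition is_poly :: "nat \<Rightarrow> nat \<Rightarrow> ((nat \<Rightarrow> real) \<Rightarrow> real) \<Rightarrow> bool" where
  "is_poly k D p \<longleftrightarrow> (\<exists>c :: (nat \<Rightarrow> nat) \<Rightarrow> real.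
      \<forall>x. p x = (\<Sum>\<alpha>\<in>monomial_exps k D. c \<alpha> * (\<Prod>i<k. x i ^ \<alpha> i)))"

definition in_Rd :: "nat \<Rightarrow> (nat \<Rightarrow> real) \<Rightarrow> bool" where
  "in_Rd d v \<longleftrightarrow> (\<forall>i\<ge>d. v i = 0)"

definition flat :: "nat \<Rightarrow> nat \<Rightarrow> (nat \<Rightarrow> real) list \<Rightarrow> nat \<Rightarrow> real" where
  "flat d r xs = (\<lambda>k. if k < r * d then (xs ! (k div d)) (k mod d) else 0)"

text \<open>Increasing r-tuples of elements of S with respect to the order given by an
  injective rank function \<sigma> (u < v iff \<sigma> u < \<sigma> v): this is S^{(r)}.\<close>
definition incr_tuples :: "nat \<Rightarrow> ((nat \<Rightarrow> real) \<Rightarrow> nat) \<Rightarrow> (nat \<Rightarrow> real) set \<Rightarrow> (nat \<Rightarrow> real) list set" where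
  "incr_tuples r \<sigma> S = {xs. length xs = r \<and> set xs \<subseteq> S \<and> sorted_wrt (\<lambda>u v. \<sigma> u < \<sigma> v) xs}"

definition sa_edge :: "nat \<Rightarrow> nat \<Rightarrow> ((nat \<Rightarrow> real) \<Rightarrow> real) list \<Rightarrow> (bool list \<Rightarrow> bool)
    \<Rightarrow> (nat \<Rightarrow> real) list \<Rightarrow> bool" where
  "sa_edge d r fs \<Gamma> xs \<longleftrightarrow> \<Gamma> (map (\<lambda>f. f (flat d r xs) \<le> 0) fs)"

end

theory Submission
  imports Defs "HOL-Library.FuncSet" "HOL-Library.Infinite_Set"
begin

text \<open>A polynomial of degree at most \<open>D\<close> in \<open>r\<close> vertices is a sum of real functions \<open>G J\<close>, where \<open>J\<close> ranges
  over the sets of at most \<open>D\<close> of the \<open>r\<close> vertex positions and \<open>G J\<close> only depends on the vertices at the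
  positions in \<open>J\<close>; nothing else about polynomials matters. By Ramsey's theorem for \<open>(2 * j + 1)\<close>-tuples,
  where \<open>j = card J\<close>, one may assume that the mixed differences of \<open>G J\<close> over interleaved boxes have
  constant sign and that in each coordinate their size grows, or decays, geometrically. Summing the
  mixed differences over the quadrant in the direction of decay gives a function which differs from
  \<open>\<plusminus>G J\<close> by functions of fewer variables and which, after thinning out the vertices, changes by a large
  factor whenever one variable moves. Doing this for \<open>j = D, ..., 1\<close> turns the polynomial
  into a sum of such lacunary functions. Ramsey's theorem for \<open>2 * D\<close>-tuples makes the comparisons of their
  absolute values uniform. Two lacunary functions of different sets of variables cannot stay
  comparable when a variable of only one of them moves, so the same term always
  dominates, and its sign is the sign of the polynomial. The number of Ramsey steps, hence the
  height of the tower, depends on \<open>D\<close> only. For \<open>D = 1\<close> only one exponential may be lost: there the end-homogeneous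
  subset needed for triples is found with polynomially many types, and all other steps
  only lose a power.\<close>

section \<open>Mixed differences\<close>

text \<open>The sign of a polynomial is a predicate on \<open>r\<close>-tuples, so applying Ramsey's
  theorem to it directly would give a tower whose height grows with \<open>r\<close>. Every
  predicate made uniform below reads at most \<open>2 * D + 1\<close> vertices. Mixed differences
  are the right data because summands of fewer variables cancel in them; the error of the quadrant
  sum consists of such summands and is handed down to smaller index sets, which is why the rounds
  run downwards. The heights add up as follows. A round with \<open>j\<close> variables costs
  \<open>2 * j + 1\<close> exponentials for Ramsey and one for thinning, so at most
  \<open>2 * D + 2\<close>. The final comparisons cost \<open>2 * D\<close> and one more for room to
  move vertices, and replacing \<open>n\<close> by \<open>n - 1\<close> costs one. The total
  \<open>2 * D * D + 4 * D + 2\<close> is at most \<open>3 * D ^ 3 - 1\<close> as soon as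
  \<open>2 \<le> D\<close>. For \<open>D = 1\<close> it is 8 against the 2 that are available, hence
  the separate linear case.\<close>

definition depends :: "nat set \<Rightarrow> ((nat \<Rightarrow> nat) \<Rightarrow> 'b) \<Rightarrow> bool" where
  "depends J g \<longleftrightarrow> (\<forall>x y. (\<forall>i\<in>J. x i = y i) \<longrightarrow> g x = g y)"

definition incr :: "nat set \<Rightarrow> nat \<Rightarrow> (nat \<Rightarrow> nat) \<Rightarrow> bool" where
  "incr J n x \<longleftrightarrow> (\<forall>i\<in>J. x i < n) \<and> (\<forall>i\<in>J. \<forall>k\<in>J. i < k \<longrightarrow> x i < x k)"

lemma dependsD: "depends J g \<Longrightarrow> (\<And>i. i \<in> J \<Longrightarrow> x i = y i) \<Longrightarrow> g x = g y"
  unfolding depends_def by blast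

lemma incr_subset: "incr J n x \<Longrightarrow> B \<subseteq> J \<Longrightarrow> incr B n x"
  unfolding incr_def by blast

text \<open>A discrete analogue of the integral of the top mixed derivative over a box: summands
  that ignore some coordinate of \<open>J\<close> cancel, so only the part of \<open>g\<close> that
  involves all of \<open>J\<close> is seen.\<close>

definition mix :: "nat set \<Rightarrow> ((nat \<Rightarrow> nat) \<Rightarrow> real) \<Rightarrow> (nat \<Rightarrow> nat) \<Rightarrow> (nat \<Rightarrow> nat) \<Rightarrow> real" where
  "mix J g a b = (\<Sum>B\<in>Pow J. (-1) ^ card (J - B) * g (\<lambda>i. if i \<in> B then b i else a i))"

lemma mix_cong:
  assumes "depends J g" "\<And>i. i \<in> J \<Longrightarrow> a i = a' i" "\<And>i. i \<in> J \<Longrightarrow> b i = b' i"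
  shows "mix J g a b = mix J g a' b'"
  unfolding mix_def
  by (intro sum.cong refl arg_cong2[where f="(*)"] dependsD[OF assms(1)]) (use assms in auto)

text \<open>Pair each corner of the box with the one that differs from it in coordinate
  \<open>i\<close> only; \<open>M v\<close> is the mixed difference in the remaining coordinates
  with coordinate \<open>i\<close> frozen at \<open>v\<close>.\<close>

lemma mix_coord:
  assumes "finite J" "i \<in> J"
  obtains M :: "nat \<Rightarrow> real" where "\<And>p q. mix J g (a(i:=p)) (b(i:=q)) = M q - M p"
proof -
  define J' where "J' = J - {i}"
  have J: "J = insert i J'" "i \<notin> J'" "finite J'" using assms by (auto simp: J'_def)
  define M where "M v = (\<Sum>B\<in>Pow J'. (-1) ^ card (J' - B) * g ((\<lambda>k. if k \<in> B then b k else a k)(i:=v)))" for v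
  have "mix J g (a(i:=p)) (b(i:=q)) = M q - M p" for p q
  proof -
    let ?F = "\<lambda>B. (-1) ^ card (J - B) * g (\<lambda>k. if k \<in> B then (b(i:=q)) k else (a(i:=p)) k)"
    have "Pow J = Pow J' \<union> insert i ` Pow J'" unfolding J(1) by (rule Pow_insert)
    moreover have "Pow J' \<inter> insert i ` Pow J' = {}" using J by auto
    ultimately have "sum ?F (Pow J) = sum ?F (Pow J') + sum ?F (insert i ` Pow J')"
      using J(3) by (simp add: sum.union_disjoint)
    moreover have "inj_on (insert i) (Pow J')" using J(2)
      by (intro inj_onI) (metis PowD insert_ident subsetD)
    then have "sum ?F (insert i ` Pow J') = sum (?F \<circ> insert i) (Pow J')"
      by (rule sum.reindex)
    also have "\<dots> = M q" unfolding M_def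
    proof (rule sum.cong[OF refl])
      fix B assume B: "B \<in> Pow J'"
      have "J - insert i B = J' - B" using J by auto
      moreover have "(\<lambda>k. if k \<in> insert i B then (b(i:=q)) k else (a(i:=p)) k)
        = (\<lambda>k. if k \<in> B then b k else a k)(i:=q)" by (auto simp: fun_eq_iff)
      ultimately show "(?F \<circ> insert i) B = (-1) ^ card (J' - B) * g ((\<lambda>k. if k \<in> B then b k else a k)(i:=q))"
        by simp
    qed
    moreover have "sum ?F (Pow J') = - M p" unfolding M_def sum_negf[symmetric]
    proof (rule sum.cong[OF refl])
      fix B assume B: "B \<in> Pow J'"
      have "J - B = insert i (J' - B)" "i \<notin> J' - B" using J B by auto
      then have "card (J - B) = Suc (card (J' - B))" using J(3) by simp
      moreover have "(\<lambda>k. if k \<in> B then (b(i:=q)) k else (a(i:=p)) k)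
        = (\<lambda>k. if k \<in> B then b k else a k)(i:=p)" using B J(2) by (auto simp: fun_eq_iff)
      ultimately show "?F B = - ((-1) ^ card (J' - B) * g ((\<lambda>k. if k \<in> B then b k else a k)(i:=p)))"
        by simp
    qed
    ultimately show ?thesis unfolding mix_def by simp
  qed
  then show ?thesis using that by blast
qed

lemma mix_line:
  assumes "finite J" "i \<in> J" "p \<le> q"
  shows "mix J g (a(i:=p)) (b(i:=q)) = (\<Sum>t=p..<q. mix J g (a(i:=t)) (b(i:=Suc t)))"
proof -
  obtain M where M: "\<And>p q. mix J g (a(i:=p)) (b(i:=q)) = M q - M p"
    using mix_coord[OF assms(1,2)] by metis
  show ?thesis unfolding M using assms(3) by (simp add: sum_Suc_diff')
qed

lemma sum_PiE_insert:
  fixes F :: "('a \<Rightarrow> 'b) \<Rightarrow> 'c::comm_monoid_add"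
  assumes "i \<notin> A"
  shows "(\<Sum>s\<in>PiE (insert i A) S. F s) = (\<Sum>s\<in>PiE A S. \<Sum>t\<in>S i. F (s(i:=t)))"
proof -
  have "(\<Sum>s\<in>PiE (insert i A) S. F s) = sum (F \<circ> (\<lambda>(y, g). g(i := y))) (S i \<times> PiE A S)"
    unfolding PiE_insert_eq by (rule sum.reindex[OF inj_combinator[OF assms]])
  also have "\<dots> = (\<Sum>(t,s)\<in>S i \<times> PiE A S. F (s(i:=t)))"
    by (rule sum.cong[OF refl]) (simp add: case_prod_beta)
  also have "\<dots> = (\<Sum>t\<in>S i. \<Sum>s\<in>PiE A S. F (s(i:=t)))" by (simp add: sum.cartesian_product)
  also have "\<dots> = (\<Sum>s\<in>PiE A S. \<Sum>t\<in>S i. F (s(i:=t)))" by (rule sum.swap)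
  finally show ?thesis .
qed

text \<open>Subdivide one coordinate after the other; along a single coordinate the mixed difference
  telescopes by \<open>mix_line\<close>.\<close>

lemma mix_box:
  assumes J: "finite J" "depends J g" and ab: "\<And>i. i \<in> J \<Longrightarrow> a i \<le> b i"
  shows "mix J g a b = (\<Sum>s\<in>PiE J (\<lambda>i. {a i..<b i}). mix J g s (\<lambda>i. Suc (s i)))"
proof -
  \<comment> \<open>On the set \<open>A\<close> of coordinates already subdivided, \<open>ov\<close>
    takes the ends of the unit cell; elsewhere it keeps those of the original box.\<close>
  define ov where "ov A s c = (\<lambda>i. if i \<in> A then s i else c i)" for A and s c :: "nat \<Rightarrow> nat"
  have "A \<subseteq> J \<Longrightarrow> mix J g a b = (\<Sum>s\<in>PiE A (\<lambda>i. {a i..<b i}). mix J g (ov A s a) (ov A (\<lambda>i. Suc (s i)) b))" for A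
  proof -
    assume "A \<subseteq> J"
    then have "finite A" using J(1) finite_subset by blast
    then show ?thesis using \<open>A \<subseteq> J\<close>
    proof (induction A rule: finite_induct)
      case empty
      then show ?case by (simp add: ov_def)
    next
      case (insert i A)
      have "(\<Sum>s\<in>PiE A (\<lambda>i. {a i..<b i}). mix J g (ov A s a) (ov A (\<lambda>i. Suc (s i)) b))
        = (\<Sum>s\<in>PiE A (\<lambda>i. {a i..<b i}). \<Sum>t=a i..<b i. mix J g (ov (insert i A) (s(i:=t)) a) (ov (insert i A) (\<lambda>k. Suc ((s(i:=t)) k)) b))"
      proof (rule sum.cong[OF refl])
        fix s
        have "ov A s a = (ov A s a)(i:=a i)" "ov A (\<lambda>i. Suc (s i)) b = (ov A (\<lambda>i. Suc (s i)) b)(i:=b i)"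
          using insert by (auto simp: ov_def)
        then have "mix J g (ov A s a) (ov A (\<lambda>i. Suc (s i)) b)
          = (\<Sum>t=a i..<b i. mix J g ((ov A s a)(i:=t)) ((ov A (\<lambda>i. Suc (s i)) b)(i:=Suc t)))"
          using mix_line[OF J(1), of i "a i" "b i" g "ov A s a" "ov A (\<lambda>i. Suc (s i)) b"] insert ab by auto
        also have "\<dots> = (\<Sum>t=a i..<b i. mix J g (ov (insert i A) (s(i:=t)) a) (ov (insert i A) (\<lambda>k. Suc ((s(i:=t)) k)) b))"
          using insert by (intro sum.cong refl arg_cong2[where f="mix J g"]) (auto simp: ov_def fun_eq_iff)
        finally show "mix J g (ov A s a) (ov A (\<lambda>i. Suc (s i)) b) = \<dots>" .
      qed
      then show ?case using insert by (simp add: sum_PiE_insert)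
    qed
  qed
  from this[of J] have "mix J g a b = (\<Sum>s\<in>PiE J (\<lambda>i. {a i..<b i}). mix J g (ov J s a) (ov J (\<lambda>i. Suc (s i)) b))" by simp
  also have "\<dots> = (\<Sum>s\<in>PiE J (\<lambda>i. {a i..<b i}). mix J g s (\<lambda>i. Suc (s i)))"
    by (intro sum.cong refl mix_cong[OF J(2)]) (auto simp: ov_def)
  finally show ?thesis .
qed

section \<open>Quadrant sums\<close>

text \<open>The class of remainders. \<open>H\<close> is indexed by sets so that its members can
  later be added to the terms of the smaller index sets; the predicate \<open>P\<close> restricts
  the identity to increasing tuples, where it holds.\<close>

definition lower :: "nat set \<Rightarrow> ((nat \<Rightarrow> nat) \<Rightarrow> bool) \<Rightarrow> ((nat \<Rightarrow> nat) \<Rightarrow> real) \<Rightarrow> bool" where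
  "lower J P h \<longleftrightarrow> (\<exists>H. (\<forall>B. depends B (H B)) \<and> (\<forall>x. P x \<longrightarrow> h x = (\<Sum>B\<in>Pow J - {J}. H B x)))"

lemma lower_depends:
  assumes "finite J" "B \<subset> J" "depends B h"
  shows "lower J P h"
proof -
  let ?H = "\<lambda>B'. if B' = B then h else (\<lambda>_. 0)"
  have "B \<in> Pow J - {J}" "finite (Pow J - {J})" using assms by auto
  then have "h x = (\<Sum>B'\<in>Pow J - {J}. ?H B' x)" for x
    by (simp add: sum.remove[of "Pow J - {J}" B])
  moreover have "depends B' (?H B')" for B' using assms(3) by (auto simp: depends_def)
  ultimately show ?thesis unfolding lower_def by (intro exI[of _ ?H]) simp
qed

lemma lower_cong:
  assumes "lower J P h" "\<And>x. P x \<Longrightarrow> h' x = h x"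
  shows "lower J P h'"
  using assms unfolding lower_def by auto

lemma lower_zero: "lower J P (\<lambda>_. 0)"
  unfolding lower_def by (rule exI[of _ "\<lambda>_ _. 0"]) (auto simp: depends_def)

lemma lower_add:
  assumes "lower J P h" "lower J P k"
  shows "lower J P (\<lambda>x. h x + k x)"
proof -
  obtain H K where
    H: "\<And>B. depends B (H B)" "\<And>x. P x \<Longrightarrow> h x = (\<Sum>B\<in>Pow J - {J}. H B x)" and
    K: "\<And>B. depends B (K B)" "\<And>x. P x \<Longrightarrow> k x = (\<Sum>B\<in>Pow J - {J}. K B x)"
    using assms unfolding lower_def by metis
  have "depends B (\<lambda>x. H B x + K B x)" for B
    using H(1)[of B] K(1)[of B] unfolding depends_def by metis
  then show ?thesis unfolding lower_def
    by (intro exI[of _ "\<lambda>B x. H B x + K B x"]) (simp add: H(2) K(2) sum.distrib)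
qed

lemma lower_cmult:
  assumes "lower J P h"
  shows "lower J P (\<lambda>x. c * h x)"
proof -
  obtain H where
    H: "\<And>B. depends B (H B)" "\<And>x. P x \<Longrightarrow> h x = (\<Sum>B\<in>Pow J - {J}. H B x)"
    using assms unfolding lower_def by metis
  have "depends B (\<lambda>x. c * H B x)" for B
    using H(1)[of B] unfolding depends_def by metis
  then show ?thesis unfolding lower_def
    by (intro exI[of _ "\<lambda>B x. c * H B x"]) (simp add: H(2) sum_distrib_left)
qed

lemma lower_sum:
  assumes "finite A" "\<And>a. a \<in> A \<Longrightarrow> lower J P (h a)"
  shows "lower J P (\<lambda>x. \<Sum>a\<in>A. h a x)"
  using assms by (induction A rule: finite_induct) (auto intro: lower_zero lower_add)

text \<open>The positions of unit cells on the decaying side of \<open>t\<close>: those to the left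
  of \<open>t\<close> if differences grow upwards, otherwise those between \<open>t\<close> and
  \<open>n - 1\<close>.\<close>

definition side :: "nat \<Rightarrow> bool \<Rightarrow> nat \<Rightarrow> nat set" where
  "side n up t = (if up then {..<t} else {t..<n - 1})"

text \<open>Apart from the bound \<open>n\<close>, this is the condition that the unit cells at
  \<open>s\<close> form an \<open>interleaved\<close> box, so that uniform signs and growth apply to
  them.\<close>

definition separated :: "nat set \<Rightarrow> (nat \<Rightarrow> nat) \<Rightarrow> bool" where
  "separated J s \<longleftrightarrow> (\<forall>i\<in>J. \<forall>k\<in>J. i < k \<longrightarrow> Suc (s i) < s k)"

abbreviation cell :: "nat set \<Rightarrow> ((nat \<Rightarrow> nat) \<Rightarrow> real) \<Rightarrow> (nat \<Rightarrow> nat) \<Rightarrow> real" where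
  "cell J g s \<equiv> mix J g s (\<lambda>i. Suc (s i))"

abbreviation sides :: "nat set \<Rightarrow> nat \<Rightarrow> (nat \<Rightarrow> bool) \<Rightarrow> (nat \<Rightarrow> nat) \<Rightarrow> (nat \<Rightarrow> nat) set" where
  "sides J n up x \<equiv> PiE J (\<lambda>i. side n (up i) (x i))"

definition quadrant :: "nat set \<Rightarrow> nat \<Rightarrow> (nat \<Rightarrow> bool) \<Rightarrow> (nat \<Rightarrow> nat) \<Rightarrow> (nat \<Rightarrow> nat) set" where
  "quadrant J n up x = {s \<in> sides J n up x. separated J s}"

abbreviation quadrant_sum :: "nat set \<Rightarrow> nat \<Rightarrow> (nat \<Rightarrow> bool) \<Rightarrow> ((nat \<Rightarrow> nat) \<Rightarrow> real) \<Rightarrow> (nat \<Rightarrow> nat) \<Rightarrow> real" where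
  "quadrant_sum J n up g x \<equiv> \<Sum>s\<in>quadrant J n up x. cell J g s"

text \<open>If the cells of \<open>i < k\<close> touch or come in the wrong order, then for
  \<open>x i < x k\<close> the two membership conditions are not independent. Depending on the
  directions, one implies the other, or they exclude each other, or their conjunction is a
  difference of two conditions on one coordinate. So no summand has to read both \<open>x i\<close>
  and \<open>x k\<close>.\<close>

lemma lower_unseparated:
  assumes J: "finite J" and s: "s \<in> PiE J (\<lambda>_. {..<n - 1})" "\<not> separated J s"
  shows "lower J (incr J n) (\<lambda>x. of_bool (\<forall>l\<in>J. s l \<in> side n (up l) (x l)))"
proof -
  obtain i k where ik: "i \<in> J" "k \<in> J" "i < k" "s k \<le> Suc (s i)"
    using s(2) unfolding separated_def by (meson not_less)
  define u where "u x = (of_bool (s i < x i) :: real)" for x :: "nat \<Rightarrow> nat"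
  define v where "v x = (of_bool (x k \<le> s k) :: real)" for x :: "nat \<Rightarrow> nat"
  \<comment> \<open>\<open>\<alpha>\<close> is the part that reads only \<open>x i\<close> and
    \<open>\<beta>\<close> the part that reads only \<open>x k\<close>. The four cases follow from
    \<open>s k \<le> Suc (s i)\<close> and \<open>x i < x k\<close>.\<close>
  define \<alpha> where "\<alpha> x = (if up i then (if up k then u x else 0) else (if up k then 1 - u x else 0))" for x
  define \<beta> where "\<beta> x = (if up i then 0 else (if up k then - v x else v x))" for x
  define rest where "rest x = (of_bool (\<forall>l\<in>J - {i,k}. s l \<in> side n (up l) (x l)) :: real)" for x
  have lt: "s i < n - 1" "s k < n - 1" using s(1) ik by auto
  have key: "of_bool (\<forall>l\<in>J. s l \<in> side n (up l) (x l)) = \<alpha> x * rest x + \<beta> x * rest x"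
    if "incr J n x" for x
  proof -
    have xx: "x i < x k" using that ik by (auto simp: incr_def)
    have "of_bool (\<forall>l\<in>J. s l \<in> side n (up l) (x l))
      = of_bool (s i \<in> side n (up i) (x i)) * of_bool (s k \<in> side n (up k) (x k)) * rest x"
      unfolding rest_def of_bool_conj[symmetric] using ik by (intro arg_cong[where f=of_bool]) auto
    also have "of_bool (s i \<in> side n (up i) (x i)) * of_bool (s k \<in> side n (up k) (x k)) = \<alpha> x + \<beta> x"
      using xx ik(4) lt by (auto simp: \<alpha>_def \<beta>_def u_def v_def side_def)
    finally show ?thesis by (simp add: algebra_simps)
  qed
  have dep: "depends (J - {k}) (\<lambda>x. \<alpha> x * rest x)" "depends (J - {i}) (\<lambda>x. \<beta> x * rest x)"
    unfolding depends_def \<alpha>_def \<beta>_def rest_def u_def v_def using ik by auto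
  have "lower J (incr J n) (\<lambda>x. \<alpha> x * rest x + \<beta> x * rest x)"
    by (intro lower_add lower_depends[OF J _ dep(1)] lower_depends[OF J _ dep(2)]) (use ik in auto)
  then show ?thesis by (rule lower_cong) (use key in auto)
qed

text \<open>The quadrant sum has the same mixed differences as \<open>g\<close> on separated cells; the cells that
  are not separated only contribute functions of fewer variables.\<close>

lemma quadrant_decomposition:
  fixes g :: "(nat \<Rightarrow> nat) \<Rightarrow> real"
  assumes J: "finite J" and g: "depends J g"
  shows "lower J (incr J n) (\<lambda>x. g x - (-1) ^ card {i\<in>J. \<not> up i} * quadrant_sum J n up g x)"
proof -
  define \<epsilon> :: real where "\<epsilon> = (-1) ^ card {i\<in>J. \<not> up i}"
  have \<epsilon>2: "\<epsilon> * \<epsilon> = 1" by (simp add: \<epsilon>_def flip: power_add mult_2)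
  \<comment> \<open>Each side of this box joins \<open>x i\<close> to a fixed end of the range, 0 or
    \<open>n - 1\<close>; its cells are those of the quadrant of \<open>x\<close>, separated or
    not.\<close>
  define a where "a x = (\<lambda>i. if up i then 0 else x i)" for x :: "nat \<Rightarrow> nat"
  define b where "b x = (\<lambda>i. if up i then x i else n - 1)" for x :: "nat \<Rightarrow> nat"
  \<comment> \<open>\<open>B0\<close> selects the corner \<open>x\<close> of the box, which has sign
    \<open>\<epsilon>\<close>. Every other corner has some coordinate at a fixed end and therefore
    belongs to the remainder.\<close>
  define B0 where "B0 = {i\<in>J. up i}"
  define T where "T B x = (-1) ^ card (J - B) * g (\<lambda>i. if i \<in> B then b x i else a x i)" for B x
  have B0: "B0 \<in> Pow J" "finite (Pow J)" using J by (auto simp: B0_def)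
  have TB0: "T B0 x = \<epsilon> * g x" for x
  proof -
    have "J - B0 = {i\<in>J. \<not> up i}" by (auto simp: B0_def)
    moreover have "g (\<lambda>i. if i \<in> B0 then b x i else a x i) = g x"
      by (rule dependsD[OF g]) (auto simp: B0_def a_def b_def)
    ultimately show ?thesis by (simp add: T_def \<epsilon>_def)
  qed
  have mixeq: "mix J g (a x) (b x) = \<epsilon> * g x + (\<Sum>B\<in>Pow J - {B0}. T B x)" for x
    unfolding mix_def T_def[symmetric] using sum.remove[OF B0(2,1), of "\<lambda>B. T B x"] TB0 by simp
  have low1: "lower J (incr J n) (\<lambda>x. \<Sum>B\<in>Pow J - {B0}. T B x)"
  proof (rule lower_sum)
    fix B assume B: "B \<in> Pow J - {B0}"
    define C where "C = {i\<in>J. i \<in> B \<longleftrightarrow> up i}"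
    have "C \<subset> J" using B unfolding C_def B0_def by blast
    moreover have "depends C (T B)"
      unfolding depends_def
    proof (intro allI impI)
      fix x y :: "nat \<Rightarrow> nat" assume "\<forall>i\<in>C. x i = y i"
      then have "g (\<lambda>i. if i \<in> B then b x i else a x i) = g (\<lambda>i. if i \<in> B then b y i else a y i)"
        by (intro dependsD[OF g]) (auto simp: a_def b_def C_def)
      then show "T B x = T B y" by (simp add: T_def)
    qed
    ultimately show "lower J (incr J n) (T B)" by (rule lower_depends[OF J])
  qed (use J in auto)
  \<comment> \<open>For \<open>lower_sum\<close> the index set must not depend on \<open>x\<close>.
    The dependence is moved into an indicator, to which \<open>lower_unseparated\<close>
    applies.\<close>
  define F where "F = {s \<in> PiE J (\<lambda>_. {..<n - 1}). \<not> separated J s}"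
  have finF: "finite F" unfolding F_def using J by (simp add: finite_PiE)
  define bad where "bad x = (\<Sum>s\<in>F. cell J g s * of_bool (\<forall>l\<in>J. s l \<in> side n (up l) (x l)))" for x
  have low2: "lower J (incr J n) bad"
    unfolding bad_def
    by (intro lower_sum finF lower_cmult lower_unseparated[OF J]) (auto simp: F_def)
  have split: "mix J g (a x) (b x) = quadrant_sum J n up g x + bad x" if x: "incr J n x" for x
  proof -
    have xn: "x i \<le> n - 1" if "i \<in> J" for i using x that by (fastforce simp: incr_def)
    have side: "{a x i..<b x i} = side n (up i) (x i)" for i by (auto simp: a_def b_def side_def)
    have sub: "side n (up i) (x i) \<subseteq> {..<n - 1}" if "i \<in> J" for i
      using xn[OF that] by (auto simp: side_def)
    let ?X = "sides J n up x"
    have fin: "finite ?X" using J by (intro finite_PiE) (auto simp: side_def)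
    have "mix J g (a x) (b x) = sum (cell J g) ?X"
      using mix_box[OF J g, of "a x" "b x"] xn by (simp add: side) (auto simp: a_def b_def)
    also have "\<dots> = sum (cell J g) {s\<in>?X. separated J s} + sum (cell J g) {s\<in>?X. \<not> separated J s}"
      using fin by (subst sum.union_disjoint[symmetric]) (auto intro!: sum.cong)
    also have "{s\<in>?X. \<not> separated J s} = {s\<in>F. \<forall>l\<in>J. s l \<in> side n (up l) (x l)}"
      unfolding F_def using sub by (auto simp: PiE_iff)
    also have "sum (cell J g) {s\<in>F. \<forall>l\<in>J. s l \<in> side n (up l) (x l)} = bad x"
      unfolding bad_def sum.inter_filter[OF finF] by (rule sum.cong[OF refl]) simp
    finally show ?thesis by (simp add: quadrant_def)
  qed
  have "lower J (incr J n) (\<lambda>x. \<epsilon> * (bad x + (-1) * (\<Sum>B\<in>Pow J - {B0}. T B x)))"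
    by (intro lower_cmult lower_add low1 low2)
  then show ?thesis
  proof (rule lower_cong)
    fix x assume x: "incr J n x"
    have e: "\<epsilon> * g x + (\<Sum>B\<in>Pow J - {B0}. T B x) = quadrant_sum J n up g x + bad x"
      using mixeq split[OF x] by simp
    have "\<epsilon> * (\<epsilon> * g x - quadrant_sum J n up g x) = \<epsilon> * (bad x - (\<Sum>B\<in>Pow J - {B0}. T B x))"
      using e by (intro arg_cong[where f="(*) \<epsilon>"]) linarith
    moreover have "\<epsilon> * (\<epsilon> * g x - quadrant_sum J n up g x) = g x - \<epsilon> * quadrant_sum J n up g x"
      using \<epsilon>2 by (simp add: algebra_simps flip: mult.assoc)
    ultimately show "g x - (-1) ^ card {i\<in>J. \<not> up i} * quadrant_sum J n up g x
      = \<epsilon> * (bad x + (-1) * (\<Sum>B\<in>Pow J - {B0}. T B x))" by (simp add: \<epsilon>_def)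
  qed
qed

section \<open>Growth along lines and domination of a quadrant sum by its corner cell\<close>

definition interleaved :: "nat set \<Rightarrow> nat \<Rightarrow> (nat \<Rightarrow> nat) \<Rightarrow> (nat \<Rightarrow> nat) \<Rightarrow> bool" where
  "interleaved J n a b \<longleftrightarrow> (\<forall>i\<in>J. a i < b i \<and> b i < n \<and> (\<forall>k\<in>J. i < k \<longrightarrow> b i < a k))"

text \<open>Distance 3 is the least that keeps the cells \<open>[x i, x i + 1]\<close> and
  \<open>[x k - 1, x k]\<close> separated; these are the corner cells at \<open>i\<close> and
  \<open>k\<close> when \<open>i\<close> points down and \<open>k\<close> points up.\<close>

definition gapped :: "nat set \<Rightarrow> nat \<Rightarrow> (nat \<Rightarrow> nat) \<Rightarrow> bool" where
  "gapped J n x \<longleftrightarrow> (\<forall>i\<in>J. 0 < x i \<and> Suc (x i) < n \<and> (\<forall>k\<in>J. i < k \<longrightarrow> x i + 3 \<le> x k))"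

text \<open>Each value is at least the sum of all previous ones, so the partial sums double at every
  step.\<close>

lemma power_le_of_dominated_sums:
  fixes v :: "nat \<Rightarrow> real"
  assumes "0 \<le> v 0" "\<And>m. m \<le> M \<Longrightarrow> (\<Sum>q<m. v q) \<le> v m" "0 < m" "m \<le> M"
  shows "2 ^ (m - 1) * v 0 \<le> v m"
proof -
  have "k \<le> M \<Longrightarrow> 2 ^ k * v 0 \<le> (\<Sum>q<Suc k. v q)" for k
  proof (induction k)
    case (Suc k)
    then have "(\<Sum>q<Suc k. v q) \<le> v (Suc k)" using assms(2) by blast
    then show ?case using Suc by simp
  qed simp
  from this[of "m - 1"] have "2 ^ (m - 1) * v 0 \<le> (\<Sum>q<m. v q)" using assms(3,4) by simp
  also have "\<dots> \<le> v m" using assms(2,4) by blast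
  finally show ?thesis .
qed

lemma abs_sum_same_sgn:
  fixes h :: "'a \<Rightarrow> real"
  assumes "\<And>s. s \<in> A \<Longrightarrow> sgn (h s) = sg"
  shows "sum h A = sg * (\<Sum>s\<in>A. \<bar>h s\<bar>)" "\<bar>sum h A\<bar> = (\<Sum>s\<in>A. \<bar>h s\<bar>)"
proof -
  have "h s = sg * \<bar>h s\<bar>" if "s \<in> A" for s using assms[OF that] by (metis mult_sgn_abs)
  then show 1: "sum h A = sg * (\<Sum>s\<in>A. \<bar>h s\<bar>)" by (simp add: sum_distrib_left)
  have "\<bar>sg\<bar> * \<bar>h s\<bar> = \<bar>h s\<bar>" if "s \<in> A" for s
    using assms[OF that] by (auto simp: abs_sgn_eq split: if_splits)
  then have "(\<Sum>s\<in>A. \<bar>sg\<bar> * \<bar>h s\<bar>) = (\<Sum>s\<in>A. \<bar>h s\<bar>)" by (rule sum.cong[OF refl])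
  moreover have "0 \<le> (\<Sum>s\<in>A. \<bar>h s\<bar>)" by (simp add: sum_nonneg)
  ultimately show "\<bar>sum h A\<bar> = (\<Sum>s\<in>A. \<bar>h s\<bar>)"
    unfolding 1 by (simp add: abs_mult flip: sum_distrib_left)
qed

abbreviation mix_grows where
  "mix_grows J g i a b c \<equiv> \<bar>mix J g a b\<bar> \<le> \<bar>mix J g (a(i:=b i)) (b(i:=c))\<bar>"

abbreviation mix_decays where
  "mix_decays J g i a b c \<equiv> \<bar>mix J g (a(i:=b i)) (b(i:=c))\<bar> \<le> \<bar>mix J g a b\<bar>"

text \<open>What Ramsey's theorem provides for one term: the sign is a condition on
  \<open>2 * card J\<close> points, and the comparison of two boxes that share the end
  \<open>b i\<close> is a condition on one point more.\<close>

definition oriented :: "nat set \<Rightarrow> nat \<Rightarrow> ((nat \<Rightarrow> nat) \<Rightarrow> real) \<Rightarrow> (nat \<Rightarrow> bool) \<Rightarrow> real \<Rightarrow> bool" where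
  "oriented J n g up sg \<longleftrightarrow>
    (\<forall>a b. interleaved J n a b \<longrightarrow> sgn (mix J g a b) = sg) \<and>
    (\<forall>i a b c. i \<in> J \<and> interleaved J n a (b(i:=c)) \<and> a i < b i \<and> b i < c \<longrightarrow>
      (if up i then mix_grows J g i a b c
       else mix_decays J g i a b c))"

context
  fixes J :: "nat set" and n :: nat and g :: "(nat \<Rightarrow> nat) \<Rightarrow> real" and up :: "nat \<Rightarrow> bool" and sg :: real
  assumes J: "finite J" and dep: "depends J g" and oriented: "oriented J n g up sg"
begin

private lemma sg: "interleaved J n a b \<Longrightarrow> sgn (mix J g a b) = sg"
  using oriented unfolding oriented_def by blast

private lemma up:
  "\<lbrakk>i \<in> J; up i; interleaved J n a (b(i:=c)); a i < b i; b i < c\<rbrakk>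
    \<Longrightarrow> mix_grows J g i a b c"
  using oriented unfolding oriented_def by presburger

private lemma down:
  "\<lbrakk>i \<in> J; \<not> up i; interleaved J n a (b(i:=c)); a i < b i; b i < c\<rbrakk>
    \<Longrightarrow> mix_decays J g i a b c"
  using oriented unfolding oriented_def by presburger

private abbreviation "valid s \<equiv> interleaved J n s (\<lambda>i. Suc (s i))"
private abbreviation "u s \<equiv> \<bar>cell J g s\<bar>"

private lemma valid_between:
  assumes "valid (s(i:=p))" "valid (s(i:=t))" "p \<le> q" "q \<le> t"
  shows "valid (s(i:=q))"
  unfolding interleaved_def
proof (intro ballI conjI impI)
  fix k l assume "k \<in> J" "l \<in> J" "k < l"
  then show "Suc ((s(i:=q)) k) < (s(i:=q)) l"
    using assms unfolding interleaved_def by (cases "k = i"; cases "l = i") force+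
next
  fix k assume "k \<in> J"
  then show "Suc ((s(i:=q)) k) < n"
    using assms unfolding interleaved_def by (cases "k = i") force+
qed simp

private lemma valid_line:
  assumes "valid (s(i:=p))" "valid (s(i:=t))" "p < t"
  shows "interleaved J n (s(i:=p)) ((\<lambda>k. Suc (s k))(i:=Suc t))"
  unfolding interleaved_def
proof (intro ballI conjI impI)
  fix k l assume "k \<in> J" "l \<in> J" "k < l"
  then show "((\<lambda>k. Suc (s k))(i:=Suc t)) k < (s(i:=p)) l"
    using assms unfolding interleaved_def by (cases "k = i"; cases "l = i") force+
next
  fix k assume "k \<in> J"
  then show "((\<lambda>k. Suc (s k))(i:=Suc t)) k < n"
    using assms unfolding interleaved_def by (cases "k = i") force+
next
  fix k assume "k \<in> J"
  then show "(s(i:=p)) k < ((\<lambda>k. Suc (s k))(i:=Suc t)) k"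
    using assms by simp
qed

private lemma cell_upd: "mix J g (s(i:=q)) ((\<lambda>k. Suc (s k))(i:=Suc q)) = cell J g (s(i:=q))"
  by (rule arg_cong2[where f="mix J g"]) (auto simp: fun_eq_iff)

private lemma sum_cells_line:
  assumes "i \<in> J" "p \<le> r" "\<And>q. p \<le> q \<Longrightarrow> q < r \<Longrightarrow> valid (s(i:=q))"
  shows "(\<Sum>q=p..<r. u (s(i:=q))) = \<bar>mix J g (s(i:=p)) ((\<lambda>k. Suc (s k))(i:=r))\<bar>"
proof -
  have "mix J g (s(i:=p)) ((\<lambda>k. Suc (s k))(i:=r)) = (\<Sum>q=p..<r. cell J g (s(i:=q)))"
    using mix_line[OF J assms(1,2)] by (simp add: cell_upd)
  then show ?thesis using abs_sum_same_sgn(2)[of "{p..<r}" "\<lambda>q. cell J g (s(i:=q))" sg] assms(3) sg by simp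
qed

text \<open>Cells of equal sign add up in absolute value to the box that they fill. This box is
  adjacent to the cell at \<open>t\<close>, so one comparison of boxes bounds the whole sum.\<close>

private lemma up_line:
  assumes i: "i \<in> J" "up i" and v: "valid (s(i:=p))" "valid (s(i:=t))" "p \<le> t"
  shows "(\<Sum>q=p..<t. u (s(i:=q))) \<le> u (s(i:=t))"
proof (cases "p = t")
  case False
  have "(\<Sum>q=p..<t. u (s(i:=q))) = \<bar>mix J g (s(i:=p)) ((\<lambda>k. Suc (s k))(i:=t))\<bar>"
    by (intro sum_cells_line i v valid_between[OF v(1,2)]) simp_all
  also have "\<dots> \<le> \<bar>mix J g (s(i:=t)) ((\<lambda>k. Suc (s k))(i:=Suc t))\<bar>"
    using up[OF i, of "s(i:=p)" "(\<lambda>k. Suc (s k))(i:=t)" "Suc t"] valid_line[OF v(1,2)] v(3) False by simp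
  finally show ?thesis by (simp add: cell_upd)
qed simp

private lemma down_line:
  assumes i: "i \<in> J" "\<not> up i" and v: "valid (s(i:=t))" "valid (s(i:=p))" "t \<le> p"
  shows "(\<Sum>q=Suc t..<Suc p. u (s(i:=q))) \<le> u (s(i:=t))"
proof (cases "p = t")
  case False
  have "(\<Sum>q=Suc t..<Suc p. u (s(i:=q))) = \<bar>mix J g (s(i:=Suc t)) ((\<lambda>k. Suc (s k))(i:=Suc p))\<bar>"
    by (intro sum_cells_line i valid_between[OF v(1,2)]) (use v(3) False in simp_all)
  also have "\<dots> \<le> \<bar>mix J g (s(i:=t)) ((\<lambda>k. Suc (s k))(i:=Suc t))\<bar>"
    using down[OF i, of "s(i:=t)" "(\<lambda>k. Suc (s k))(i:=Suc t)" "Suc p"] valid_line[OF v(1,2)] v(3) False by simp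
  finally show ?thesis by (simp add: cell_upd)
qed simp

private lemma up_growth:
  assumes i: "i \<in> J" "up i" and v: "valid (s(i:=p))" "valid (s(i:=t))" "p < t"
  shows "2 ^ (t - p - 1) * u (s(i:=p)) \<le> u (s(i:=t))"
proof -
  have "(\<Sum>q<m. u (s(i:=p+q))) \<le> u (s(i:=p+m))" if "m \<le> t - p" for m
  proof -
    have "(\<Sum>q<m. u (s(i:=p+q))) = (\<Sum>q=p..<p+m. u (s(i:=q)))"
      by (rule sum.reindex_bij_witness[of _ "\<lambda>q. q - p" "\<lambda>q. p + q"]) auto
    also have "\<dots> \<le> u (s(i:=p+m))"
      using that v(3) by (intro up_line[OF i v(1)] valid_between[OF v(1,2)]) auto
    finally show ?thesis .
  qed
  from power_le_of_dominated_sums[of "\<lambda>q. u (s(i:=p+q))" "t - p" "t - p", OF _ this] v(3)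
  show ?thesis by simp
qed

private lemma down_growth:
  assumes i: "i \<in> J" "\<not> up i" and v: "valid (s(i:=t))" "valid (s(i:=p))" "t < p"
  shows "2 ^ (p - t - 1) * u (s(i:=p)) \<le> u (s(i:=t))"
proof -
  have "(\<Sum>q<m. u (s(i:=p-q))) \<le> u (s(i:=p-m))" if "m \<le> p - t" for m
  proof -
    have "(\<Sum>q<m. u (s(i:=p-q))) = (\<Sum>q=Suc (p-m)..<Suc p. u (s(i:=q)))"
      using that by (intro sum.reindex_bij_witness[of _ "\<lambda>q. p - q" "\<lambda>q. p - q"]) auto
    also have "\<dots> \<le> u (s(i:=p-m))"
      using that v(3) by (intro down_line[OF i _ v(2)] valid_between[OF v(1,2)]) auto
    finally show ?thesis .
  qed
  from power_le_of_dominated_sums[of "\<lambda>q. u (s(i:=p-q))" "p - t" "p - t", OF _ this] v(3)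
  show ?thesis by simp
qed

text \<open>The cell of the quadrant next to \<open>x\<close>; up to a factor
  \<open>2 ^ card J\<close> it carries the whole quadrant sum.\<close>

private definition corner :: "(nat \<Rightarrow> nat) \<Rightarrow> nat \<Rightarrow> nat" where
  "corner x i = (if up i then x i - 1 else x i)"

private lemma valid_corner:
  assumes "gapped J n x"
  shows "valid (corner x)"
  unfolding interleaved_def
proof (intro ballI conjI impI)
  fix k l assume "k \<in> J" "l \<in> J" "k < l"
  then show "Suc (corner x k) < corner x l" using assms unfolding gapped_def corner_def by force
next
  fix k assume "k \<in> J"
  then show "Suc (corner x k) < n" using assms unfolding gapped_def corner_def by force
qed simp

private lemma valid_quadrant:
  assumes "gapped J n x" "s \<in> quadrant J n up x"
  shows "valid s"
  unfolding interleaved_def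
proof (intro ballI conjI impI)
  fix k l assume "k \<in> J" "l \<in> J" "k < l"
  then show "Suc (s k) < s l" using assms unfolding quadrant_def separated_def by auto
next
  fix k assume k: "k \<in> J"
  then have "s k \<in> side n (up k) (x k)" using assms(2) by (auto simp: quadrant_def)
  moreover have "Suc (x k) < n" using assms(1) k by (auto simp: gapped_def)
  ultimately show "Suc (s k) < n" by (auto simp: side_def split: if_splits)
qed simp

private lemma finite_quadrant: "finite (quadrant J n up x)"
proof -
  have "finite (sides J n up x)" using J by (intro finite_PiE) (auto simp: side_def)
  then show ?thesis by (simp add: quadrant_def)
qed

text \<open>The stages of pushing the cells of the quadrant into its corner, one coordinate at a
  time.\<close>

private definition pinned :: "(nat \<Rightarrow> nat) \<Rightarrow> nat set \<Rightarrow> (nat \<Rightarrow> nat) set" where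
  "pinned x A = {s \<in> quadrant J n up x. \<forall>i\<in>A. s i = corner x i}"

private lemma pinned_side: "s \<in> pinned x A \<Longrightarrow> k \<in> J \<Longrightarrow> s k \<in> side n (up k) (x k)"
  unfolding pinned_def quadrant_def by (drule CollectD) (auto intro: PiE_mem)

text \<open>The order of pinning matters, since a moved cell has to stay separated. The smallest
  unpinned coordinate that points down can move down to \<open>x i\<close>, because every earlier
  coordinate lies at or below its own \<open>x k\<close>. If all unpinned coordinates point up, the
  largest of them can move up, because everything after it is already pinned.\<close>

private lemma pin_next:
  assumes x: "gapped J n x" and A: "A \<subset> J"
  obtains i where "i \<in> J - A" "\<And>s. s \<in> pinned x A \<Longrightarrow> s(i := corner x i) \<in> pinned x (insert i A)"
proof -
  have fin: "finite (J - A)" using J by simp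
  have *: "s(i := corner x i) \<in> pinned x (insert i A)"
    if s: "s \<in> pinned x A" and i: "i \<in> J - A"
      and sep: "\<And>k. k \<in> J \<Longrightarrow> k < i \<Longrightarrow> Suc (s k) < corner x i"
        "\<And>k. k \<in> J \<Longrightarrow> i < k \<Longrightarrow> Suc (corner x i) < s k" for s i
  proof -
    have q: "s \<in> sides J n up x" "separated J s" "\<forall>k\<in>A. s k = corner x k"
      using s by (auto simp: pinned_def quadrant_def)
    have xi: "0 < x i" "Suc (x i) < n" using x i by (auto simp: gapped_def)
    then have "corner x i \<in> side n (up i) (x i)" by (auto simp: corner_def side_def)
    then have "s(i := corner x i) \<in> sides J n up x"
      using q(1) i by (auto simp: PiE_iff extensional_def)
    moreover have "separated J (s(i := corner x i))"
      using q(2) sep unfolding separated_def by auto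
    ultimately show ?thesis using q(3) by (auto simp: pinned_def quadrant_def)
  qed
  show ?thesis
  proof (cases "\<exists>k\<in>J - A. \<not> up k")
    case True
    define i where "i = Min {k\<in>J - A. \<not> up k}"
    have "i \<in> {k\<in>J - A. \<not> up k}" unfolding i_def using True J by (intro Min_in) auto
    then have i: "i \<in> J - A" "\<not> up i" by auto
    have min: "i \<le> k" if "k \<in> J - A" "\<not> up k" for k
      unfolding i_def using that J by (intro Min_le) auto
    show ?thesis
    proof (rule that[OF i(1) *[OF _ i(1)]])
      fix s k assume s: "s \<in> pinned x A" and k: "k \<in> J" "k < i"
      have "s k \<le> x k"
      proof (cases "up k")
        case True
        have "s k \<in> side n (up k) (x k)" using pinned_side[OF s k(1)] .
        then show ?thesis using True by (simp add: side_def)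
      next
        case False
        then have "k \<in> A" using min[of k] k by force
        then show ?thesis using s False by (simp add: pinned_def corner_def)
      qed
      moreover have "x k + 3 \<le> x i" using x k i by (auto simp: gapped_def)
      ultimately show "Suc (s k) < corner x i" using i by (simp add: corner_def)
    next
      fix s k assume s: "s \<in> pinned x A" and k: "k \<in> J" "i < k"
      have "Suc (s i) < s k" using s k i by (auto simp: pinned_def quadrant_def separated_def)
      moreover have "s i \<in> side n (up i) (x i)" using pinned_side[OF s] i by blast
      ultimately show "Suc (corner x i) < s k" using i by (simp add: corner_def side_def)
    qed auto
  next
    case False
    define i where "i = Max (J - A)"
    have i: "i \<in> J - A" unfolding i_def using A fin by (intro Max_in) auto
    then have upi: "up i" using False by blast
    have max: "k \<le> i" if "k \<in> J - A" for k unfolding i_def using that fin by (rule Max_ge[rotated])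
    show ?thesis
    proof (rule that[OF i *[OF _ i]])
      fix s k assume s: "s \<in> pinned x A" and k: "k \<in> J" "k < i"
      have "Suc (s k) < s i" using s k i by (auto simp: pinned_def quadrant_def separated_def)
      moreover have "s i \<in> side n (up i) (x i)" using pinned_side[OF s] i by blast
      ultimately show "Suc (s k) < corner x i" using upi by (simp add: corner_def side_def)
    next
      fix s k assume s: "s \<in> pinned x A" and k: "k \<in> J" "i < k"
      have "k \<in> A" using max[of k] k by force
      then have "s k = corner x k" using s by (simp add: pinned_def)
      moreover have "x i + 3 \<le> x k" "0 < x i" using x k i by (auto simp: gapped_def)
      ultimately show "Suc (corner x i) < s k" using upi by (cases "up k") (auto simp: corner_def)
    qed auto
  qed
qed

text \<open>Cells that are pushed onto the same \<open>t\<close> lie on one line through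
  \<open>t\<close>, on the side where \<open>up_line\<close> or \<open>down_line\<close> bounds
  their sum by \<open>u t\<close>. Together with \<open>t\<close> itself this gives the factor
  2.\<close>

private lemma sum_pinned_insert:
  assumes x: "gapped J n x" and i: "i \<in> J"
    and pin: "\<And>s. s \<in> pinned x A \<Longrightarrow> s(i := corner x i) \<in> pinned x (insert i A)"
  shows "sum u (pinned x A) \<le> 2 * sum u (pinned x (insert i A))"
proof -
  let ?c = "corner x i"
  have fin: "finite (pinned x B)" for B using finite_quadrant by (simp add: pinned_def)
  have "sum u (pinned x A) = (\<Sum>t\<in>pinned x (insert i A). sum u {s \<in> pinned x A. s(i := ?c) = t})"
    using pin by (intro sum.group[symmetric] fin) auto
  also have "\<dots> \<le> (\<Sum>t\<in>pinned x (insert i A). 2 * u t)"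
  proof (rule sum_mono)
    fix t assume t: "t \<in> pinned x (insert i A)"
    define F where "F = {s \<in> pinned x A. s(i := ?c) = t}"
    have F: "s = t(i := s i)" if "s \<in> F" for s
    proof -
      have "s(i := ?c) = t" using that by (simp add: F_def)
      then show ?thesis by (metis fun_upd_triv fun_upd_upd)
    qed
    have tc: "t(i := ?c) = t" using t by (intro fun_upd_idem) (simp add: pinned_def)
    have vt: "valid t" using t valid_quadrant[OF x] by (auto simp: pinned_def)
    have vF: "valid s" if "s \<in> F" for s using that valid_quadrant[OF x] by (auto simp: pinned_def F_def)
    have finF: "finite F" unfolding F_def using fin by simp
    have inj: "inj_on (\<lambda>s. s i) F" by (rule inj_onI) (metis F)
    have eq: "sum u F = (\<Sum>q\<in>(\<lambda>s. s i) ` F. u (t(i:=q)))"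
      unfolding sum.reindex[OF inj] o_def
    proof (rule sum.cong[OF refl])
      fix s assume "s \<in> F"
      from F[OF this] show "u s = u (t(i := s i))" by (rule arg_cong)
    qed
    have side: "s i \<in> side n (up i) (x i)" if "s \<in> F" for s
      using pinned_side[OF _ i] that by (auto simp: F_def)
    show "sum u F \<le> 2 * u t"
    proof (cases "F = {}")
      case False
      let ?Q = "(\<lambda>s. s i) ` F"
      have Q: "finite ?Q" "?Q \<noteq> {}" using finF False by auto
      show ?thesis
      proof (cases "up i")
        case True
        obtain s where s: "s \<in> F" "s i = Min ?Q" using Min_in[OF Q] by auto
        \<comment> \<open>The fibre may have gaps, so the sum is extended to the whole interval from
          its far end \<open>p\<close> to the corner. The cell at \<open>p\<close> is valid because
          it lies in the quadrant, and then so are all cells in between.\<close>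
        define p where "p = Min ?Q"
        have vp: "valid (t(i:=p))" using vF[OF s(1)] F[OF s(1)] s(2) unfolding p_def by metis
        have sub: "?Q \<subseteq> {p..<Suc ?c}"
        proof
          fix q assume q: "q \<in> ?Q"
          then have "q \<in> side n (up i) (x i)" using side by auto
          then have "q \<le> ?c" using True by (auto simp: side_def corner_def)
          then show "q \<in> {p..<Suc ?c}" using Min_le[OF Q(1) q] by (simp add: p_def)
        qed
        then have pc: "p \<le> ?c" using Min_in[OF Q] by (auto simp: p_def)
        have "sum u F \<le> (\<Sum>q=p..<Suc ?c. u (t(i:=q)))"
          unfolding eq by (intro sum_mono2 sub) auto
        also have "\<dots> = (\<Sum>q=p..<?c. u (t(i:=q))) + u t"
          using pc by (simp add: tc del: fun_upd_apply)
        also have "\<dots> \<le> 2 * u t" using up_line[OF i True vp _ pc] vt by (simp add: tc del: fun_upd_apply)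
        finally show ?thesis .
      next
        case down: False
        obtain s where s: "s \<in> F" "s i = Max ?Q" using Max_in[OF Q] by auto
        define p where "p = Max ?Q"
        have vp: "valid (t(i:=p))" using vF[OF s(1)] F[OF s(1)] s(2) unfolding p_def by metis
        have sub: "?Q \<subseteq> {?c..<Suc p}"
        proof
          fix q assume q: "q \<in> ?Q"
          then have "q \<in> side n (up i) (x i)" using side by auto
          then have "?c \<le> q" using down by (auto simp: side_def corner_def)
          then show "q \<in> {?c..<Suc p}" using Max_ge[OF Q(1) q] by (simp add: p_def)
        qed
        then have pc: "?c \<le> p" using Max_in[OF Q] by (auto simp: p_def)
        have "sum u F \<le> (\<Sum>q=?c..<Suc p. u (t(i:=q)))"
          unfolding eq by (intro sum_mono2 sub) auto
        also have "\<dots> = u t + (\<Sum>q=Suc ?c..<Suc p. u (t(i:=q)))"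
          using pc by (subst sum.atLeast_Suc_lessThan) (simp_all add: tc del: fun_upd_apply)
        also have "\<dots> \<le> 2 * u t" using down_line[OF i down _ vp pc] vt by (simp add: tc del: fun_upd_apply)
        finally show ?thesis .
      qed
    qed simp
  qed
  finally show ?thesis by (simp add: sum_distrib_left)
qed

private lemma sum_pinned:
  assumes x: "gapped J n x" and A: "A \<subseteq> J"
  shows "sum u (pinned x A) \<le> 2 ^ card (J - A) * sum u (pinned x J)"
  using A
proof (induction "card (J - A)" arbitrary: A)
  case 0
  then have "A = J" using J by auto
  then show ?case by simp
next
  case (Suc k)
  then have "A \<subset> J" by auto
  then obtain i where i: "i \<in> J - A" "\<And>s. s \<in> pinned x A \<Longrightarrow> s(i := corner x i) \<in> pinned x (insert i A)"
    using pin_next[OF x] by metis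
  have "J - A = insert i (J - insert i A)" using i by auto
  then have c: "card (J - A) = Suc (card (J - insert i A))" using J by (metis Diff_iff card_insert_disjoint finite_Diff insertI1)
  have "sum u (pinned x A) \<le> 2 * sum u (pinned x (insert i A))"
    using sum_pinned_insert[OF x] i by blast
  also have "sum u (pinned x (insert i A)) \<le> 2 ^ card (J - insert i A) * sum u (pinned x J)"
  proof (rule Suc.hyps(1))
    show "k = card (J - insert i A)" using Suc.hyps(2) c by simp
    show "insert i A \<subseteq> J" using Suc.prems i(1) by blast
  qed
  finally show ?case by (simp add: c)
qed

private definition \<theta> :: "(nat \<Rightarrow> nat) \<Rightarrow> real" where
  "\<theta> x = quadrant_sum J n up g x"

text \<open>There is no cancellation, so the corner cell is a lower bound. Pinning all coordinates
  loses a factor 2 for each of them and leaves only the corner cell.\<close>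

private lemma theta_bounds:
  assumes x: "gapped J n x"
  shows "u (corner x) \<le> \<bar>\<theta> x\<bar>" "\<bar>\<theta> x\<bar> \<le> 2 ^ card J * u (corner x)" "sgn (\<theta> x) = sg"
proof -
  \<comment> \<open>Members of \<open>PiE\<close> are \<open>undefined\<close> outside
    \<open>J\<close>, hence the restriction; the mixed difference does not notice it.\<close>
  let ?s = "restrict (corner x) J"
  have us: "u ?s = u (corner x)" by (intro arg_cong[where f=abs] mix_cong[OF dep]) auto
  have th: "\<theta> x = sg * sum u (quadrant J n up x)" "\<bar>\<theta> x\<bar> = sum u (quadrant J n up x)"
    unfolding \<theta>_def using abs_sum_same_sgn[of "quadrant J n up x" "cell J g" sg] sg valid_quadrant[OF x] by auto
  have sub: "pinned x J \<subseteq> {?s}"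
    unfolding pinned_def quadrant_def by (auto simp: PiE_iff extensional_def fun_eq_iff)
  have "\<bar>\<theta> x\<bar> = sum u (pinned x {})" unfolding th(2) by (simp add: pinned_def)
  also have "\<dots> \<le> 2 ^ card J * sum u (pinned x J)" using sum_pinned[OF x, of "{}"] by simp
  also have "sum u (pinned x J) \<le> sum u {?s}" using sub by (intro sum_mono2) auto
  finally show "\<bar>\<theta> x\<bar> \<le> 2 ^ card J * u (corner x)" using us by simp
  have v: "valid (corner x)" by (rule valid_corner[OF x])
  have "?s \<in> quadrant J n up x"
  proof -
    have "corner x k \<in> side n (up k) (x k)" if "k \<in> J" for k
    proof -
      have "0 < x k" "x k < n - 1" using x that unfolding gapped_def by force+
      then show ?thesis by (auto simp: corner_def side_def)
    qed
    then show ?thesis using v by (auto simp: quadrant_def separated_def interleaved_def)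
  qed
  then have "u ?s \<le> sum u (quadrant J n up x)" by (rule member_le_sum) (simp_all only: abs_ge_zero finite_quadrant)
  then show lb: "u (corner x) \<le> \<bar>\<theta> x\<bar>" using th(2) us by simp
  have sgc: "sgn (cell J g (corner x)) = sg" using v sg by blast
  show "sgn (\<theta> x) = sg"
  proof (cases "sg = 0")
    case True
    then show ?thesis using th(1) by simp
  next
    case False
    then have "0 < u (corner x)" using sgc by auto
    then have "0 < sum u (quadrant J n up x)" using lb th(2) by simp
    then have "sgn (\<theta> x) = sgn sg" unfolding th(1) by (simp add: sgn_mult)
    then show ?thesis using sgc by (metis sgn_sgn)
  qed
qed

lemma sgn_quadrant_sum:
  assumes "gapped J n x"
  shows "sgn (quadrant_sum J n up g x) = sg"
  using theta_bounds(3)[OF assms] by (simp add: \<theta>_def)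

text \<open>The corner cells of \<open>x\<close> and \<open>x'\<close> lie on one line at distance
  at least \<open>L\<close>, so they differ at least by the factor \<open>2 ^ (L - 1)\<close>.
  Passing between quadrant sums and corner cells costs \<open>2 ^ card J\<close> once.\<close>

lemma quadrant_sum_growth:
  assumes x: "gapped J n x" "gapped J n x'" and i: "i \<in> J" "\<And>k. k \<in> J - {i} \<Longrightarrow> x k = x' k"
    and L: "0 < L" "x i + L \<le> x' i"
  shows "up i \<Longrightarrow> 2 ^ (L - 1) * \<bar>quadrant_sum J n up g x\<bar>
      \<le> 2 ^ card J * \<bar>quadrant_sum J n up g x'\<bar>" (is "_ \<Longrightarrow> ?up")
    and "\<not> up i \<Longrightarrow> 2 ^ (L - 1) * \<bar>quadrant_sum J n up g x'\<bar>
      \<le> 2 ^ card J * \<bar>quadrant_sum J n up g x\<bar>" (is "_ \<Longrightarrow> ?down")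
proof -
  define s where "s = corner x"
  have s1: "s(i := corner x i) = corner x" by (auto simp: s_def)
  have eq: "k \<in> J \<Longrightarrow> (s(i := corner x' i)) k = corner x' k" for k
    using i(2)[of k] by (auto simp: s_def corner_def)
  have v1: "valid (s(i := corner x i))" using valid_corner[OF x(1)] s1 by simp
  have v2: "valid (s(i := corner x' i))"
    using valid_corner[OF x(2)] eq unfolding interleaved_def by simp
  have u2: "u (s(i := corner x' i)) = u (corner x')"
    using eq by (intro arg_cong[where f=abs] mix_cong[OF dep]) auto
  have xi: "0 < x i" using x(1) i by (auto simp: gapped_def)
  have lt: "corner x i < corner x' i" "L - 1 \<le> corner x' i - corner x i - 1"
    using L xi by (auto simp: corner_def)
  have pow: "2 ^ (L - 1) * w \<le> 2 ^ (corner x' i - corner x i - 1) * w" if "0 \<le> w" for w :: real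
    using lt(2) that by (intro mult_right_mono power_increasing) auto
  show ?up if "up i"
  proof -
    have "2 ^ (L - 1) * u (corner x) \<le> u (corner x')"
      using up_growth[OF i(1) that v1 v2 lt(1)] pow[of "u (corner x)"] u2 s1 by simp
    then have "2 ^ card J * (2 ^ (L - 1) * u (corner x)) \<le> 2 ^ card J * \<bar>\<theta> x'\<bar>"
      using theta_bounds(1)[OF x(2)] by (intro mult_left_mono) auto
    moreover have "2 ^ (L - 1) * \<bar>\<theta> x\<bar> \<le> 2 ^ (L - 1) * (2 ^ card J * u (corner x))"
      using theta_bounds(2)[OF x(1)] by (intro mult_left_mono) auto
    ultimately show ?thesis
      unfolding \<theta>_def[symmetric] by (metis (no_types, lifting) mult.left_commute order_trans)
  qed
  show ?down if "\<not> up i"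
  proof -
    have "2 ^ (L - 1) * u (corner x') \<le> u (corner x)"
      using down_growth[OF i(1) that v1 v2 lt(1)] pow[of "u (corner x')"] u2 s1 by simp
    then have "2 ^ card J * (2 ^ (L - 1) * u (corner x')) \<le> 2 ^ card J * \<bar>\<theta> x\<bar>"
      using theta_bounds(1)[OF x(1)] by (intro mult_left_mono) auto
    moreover have "2 ^ (L - 1) * \<bar>\<theta> x'\<bar> \<le> 2 ^ (L - 1) * (2 ^ card J * u (corner x'))"
      using theta_bounds(2)[OF x(2)] by (intro mult_left_mono) auto
    ultimately show ?thesis
      unfolding \<theta>_def[symmetric] by (metis (no_types, lifting) mult.left_commute order_trans)
  qed
qed

end

section \<open>Lacunary functions\<close>

definition grows :: "real \<Rightarrow> nat set \<Rightarrow> nat \<Rightarrow> nat \<Rightarrow> ((nat \<Rightarrow> nat) \<Rightarrow> real) \<Rightarrow> bool" where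
  "grows K J n i h \<longleftrightarrow>
    (\<forall>x x'. incr J n x \<longrightarrow> incr J n x' \<longrightarrow> (\<forall>k\<in>J - {i}. x k = x' k) \<longrightarrow> x i < x' i \<longrightarrow> K * \<bar>h x\<bar> \<le> \<bar>h x'\<bar>)"

definition decays :: "real \<Rightarrow> nat set \<Rightarrow> nat \<Rightarrow> nat \<Rightarrow> ((nat \<Rightarrow> nat) \<Rightarrow> real) \<Rightarrow> bool" where
  "decays K J n i h \<longleftrightarrow>
    (\<forall>x x'. incr J n x \<longrightarrow> incr J n x' \<longrightarrow> (\<forall>k\<in>J - {i}. x k = x' k) \<longrightarrow> x i < x' i \<longrightarrow> K * \<bar>h x'\<bar> \<le> \<bar>h x\<bar>)"

text \<open>The direction of growth may depend on the variable but not on the tuple. A function that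
  is 0 on all increasing tuples is lacunary for every \<open>K\<close>, so vanishing terms are not
  exceptional.\<close>

definition lacunary :: "real \<Rightarrow> nat set \<Rightarrow> nat \<Rightarrow> ((nat \<Rightarrow> nat) \<Rightarrow> real) \<Rightarrow> bool" where
  "lacunary K J n h \<longleftrightarrow>
    (\<exists>sg. \<forall>x. incr J n x \<longrightarrow> sgn (h x) = sg) \<and> (\<forall>i\<in>J. grows K J n i h \<or> decays K J n i h)"

lemma depends_quadrant: "depends J (\<lambda>x. \<Sum>s\<in>quadrant J n up x. c s :: real)"
  unfolding depends_def
proof (intro allI impI)
  fix x y :: "nat \<Rightarrow> nat" assume "\<forall>i\<in>J. x i = y i"
  then have "sides J n up x = sides J n up y"
    by (intro PiE_cong) auto
  then show "(\<Sum>s\<in>quadrant J n up x. c s) = (\<Sum>s\<in>quadrant J n up y. c s)"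
    by (simp add: quadrant_def)
qed

text \<open>Vertices at distance \<open>L\<close> turn the growth of quadrant sums into the factor
  \<open>K\<close>; the first condition on \<open>L\<close> pays for the loss
  \<open>2 ^ card J\<close>. The shift in \<open>L * Suc (y i)\<close> keeps positions positive, and
  the other two conditions give the rest of \<open>gapped\<close>.\<close>

lemma lacunary_part:
  assumes J: "finite J" and g: "depends J g" and hom: "\<exists>up sg. oriented J n g up sg"
    and L: "K * 2 ^ card J \<le> 2 ^ (L - 1)" "3 \<le> L" "L * n' < n - 1"
  obtains h H where "depends J h" "lacunary K J n' h" "\<And>B. depends B (H B)"
    "\<And>y. incr J n' y \<Longrightarrow> g (\<lambda>i. L * Suc (y i)) = h y + (\<Sum>B\<in>Pow J - {J}. H B y)"
proof -
  obtain up sg where ori: "oriented J n g up sg" using hom by blast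
  define S where "S x = quadrant_sum J n up g x" for x
  define \<epsilon> :: real where "\<epsilon> = (-1) ^ card {i\<in>J. \<not> up i}"
  have \<epsilon>: "\<bar>\<epsilon>\<bar> = 1" by (simp add: \<epsilon>_def power_abs)
  define E where "E y = (\<lambda>i. L * Suc (y i))" for y :: "nat \<Rightarrow> nat"
  obtain H where H: "\<And>B. depends B (H B)"
    "\<And>x. incr J n x \<Longrightarrow> g x - \<epsilon> * S x = (\<Sum>B\<in>Pow J - {J}. H B x)"
  proof -
    have "lower J (incr J n) (\<lambda>x. g x - \<epsilon> * S x)"
      using quadrant_decomposition[OF J g, of n up] by (simp add: S_def \<epsilon>_def)
    then show ?thesis using that unfolding lower_def by blast
  qed
  have E: "gapped J n (E y)" "incr J n (E y)" if "incr J n' y" for y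
  proof -
    have b: "Suc (E y i) < n" if "i \<in> J" for i
    proof -
      have "L * Suc (y i) \<le> L * n'" using \<open>incr J n' y\<close> that by (intro mult_le_mono2) (auto simp: incr_def)
      then show ?thesis using L(3) by (simp add: E_def)
    qed
    have c: "E y i + 3 \<le> E y k" if "i \<in> J" "k \<in> J" "i < k" for i k
    proof -
      have "Suc (y i) \<le> y k" using \<open>incr J n' y\<close> that by (auto simp: incr_def Suc_le_eq)
      then have "L * Suc (Suc (y i)) \<le> L * Suc (y k)" by (intro mult_le_mono2) simp
      then show ?thesis using L(2) by (simp add: E_def)
    qed
    show "gapped J n (E y)" using b c L(2) unfolding gapped_def by (auto simp: E_def)
    show "incr J n (E y)"
      unfolding incr_def
    proof (intro conjI ballI impI)
      fix i k assume "i \<in> J" "k \<in> J" "i < k"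
      then show "E y i < E y k" using c[of i k] by simp
    qed (use b in \<open>auto intro: Suc_lessD\<close>)
  qed
  define h where "h y = \<epsilon> * S (E y)" for y
  have "depends J (\<lambda>y. \<epsilon> * S (E y))"
  proof -
    have "S (E y) = S (E z)" if "\<forall>i\<in>J. y i = z i" for y z
      unfolding S_def by (rule dependsD[OF depends_quadrant]) (use that in \<open>auto simp: E_def\<close>)
    then show ?thesis unfolding depends_def by metis
  qed
  then have "depends J h" by (simp add: h_def[abs_def])
  moreover have "lacunary K J n' h"
    unfolding lacunary_def
  proof (intro conjI ballI)
    have "sgn (h y) = sgn \<epsilon> * sg" if "incr J n' y" for y
      using sgn_quadrant_sum[OF J g ori E(1)[OF that]] unfolding h_def S_def by (simp add: sgn_mult)
    then show "\<exists>sg. \<forall>x. incr J n' x \<longrightarrow> sgn (h x) = sg" by blast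
    fix i assume i: "i \<in> J"
    have abs: "\<bar>h y\<bar> = \<bar>S (E y)\<bar>" for y unfolding h_def by (simp add: abs_mult \<epsilon>)
    have scale: "K * v \<le> w" if "2 ^ (L - 1) * v \<le> 2 ^ card J * w" "0 \<le> v" for v w :: real
    proof -
      have "2 ^ card J * (K * v) \<le> 2 ^ (L - 1) * v"
        using mult_right_mono[OF L(1) that(2)] by (simp add: mult.commute mult.left_commute)
      with that(1) have "2 ^ card J * (K * v) \<le> 2 ^ card J * w" by linarith
      then show ?thesis by simp
    qed
    have prem: "x i < x' i \<Longrightarrow> E x i + L \<le> E x' i" "\<forall>k\<in>J - {i}. x k = x' k \<Longrightarrow> k \<in> J - {i} \<Longrightarrow> E x k = E x' k" for x x' k
    proof -
      assume "x i < x' i"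
      then have "L * Suc (Suc (x i)) \<le> L * Suc (x' i)" by (intro mult_le_mono2) simp
      then show "E x i + L \<le> E x' i" by (simp add: E_def)
    qed (simp add: E_def)
    show "grows K J n' i h \<or> decays K J n' i h"
    proof (cases "up i")
      case True
      have "grows K J n' i h"
        unfolding grows_def abs S_def
        by (intro allI impI scale quadrant_sum_growth(1)[OF J g ori E(1) E(1) i] prem True) (use L in auto)
      then show ?thesis ..
    next
      case False
      have "decays K J n' i h"
        unfolding decays_def abs S_def
        by (intro allI impI scale quadrant_sum_growth(2)[OF J g ori E(1) E(1) i] prem False) (use L in auto)
      then show ?thesis ..
    qed
  qed
  moreover have "depends B (\<lambda>y. H B (E y))" for B
    using H(1)[of B] unfolding depends_def E_def by simp
  moreover have "g (\<lambda>i. L * Suc (y i)) = h y + (\<Sum>B\<in>Pow J - {J}. H B (E y))" if "incr J n' y" for y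
    using H(2)[OF E(2)[OF that]] by (simp add: h_def E_def)
  ultimately show ?thesis using that[of h "\<lambda>B y. H B (E y)"] by blast
qed

lemma lacunary_thin:
  assumes "lacunary K J n h" "\<And>y. incr J n' y \<Longrightarrow> incr J n (\<lambda>i. E (y i))" "strict_mono (E :: nat \<Rightarrow> nat)"
  shows "lacunary K J n' (\<lambda>y. h (\<lambda>i. E (y i)))"
proof -
  have *: "E a < E b \<longleftrightarrow> a < b" for a b using assms(3) by (rule strict_mono_less)
  from assms(1) obtain sg where sg: "\<And>x. incr J n x \<Longrightarrow> sgn (h x) = sg" unfolding lacunary_def by blast
  show ?thesis unfolding lacunary_def
  proof (intro conjI ballI)
    show "\<exists>sg. \<forall>x. incr J n' x \<longrightarrow> sgn (h (\<lambda>i. E (x i))) = sg" using sg assms(2) by blast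
    fix i assume "i \<in> J"
    then have "grows K J n i h \<or> decays K J n i h" using assms(1) by (simp add: lacunary_def)
    then show "grows K J n' i (\<lambda>y. h (\<lambda>i. E (y i))) \<or> decays K J n' i (\<lambda>y. h (\<lambda>i. E (y i)))"
      unfolding grows_def decays_def
      by (rule disj_forward; intro allI impI; elim allE impE) (simp_all add: assms(2) *)
  qed
qed

lemma depends_add: "depends J f \<Longrightarrow> depends J g \<Longrightarrow> depends J (\<lambda>x. f x + g x)"
  unfolding depends_def by (intro allI impI arg_cong2[where f="(+)"]) blast+

text \<open>The remainders of the terms with \<open>j\<close> variables are distributed among proper
  subsets, all of which belong to \<open>F\<close>. A set with at least \<open>j\<close> elements is
  a proper subset of none of the treated sets, so its term receives nothing and stays
  lacunary.\<close>

lemma lacunary_round: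
  fixes F :: "nat set set" and G :: "nat set \<Rightarrow> (nat \<Rightarrow> nat) \<Rightarrow> real"
  assumes F: "finite F" "\<And>J. J \<in> F \<Longrightarrow> finite J" "\<And>J B. J \<in> F \<Longrightarrow> B \<subseteq> J \<Longrightarrow> B \<in> F"
    and dep: "\<And>J. J \<in> F \<Longrightarrow> depends J (G J)"
    and lac: "\<And>J. J \<in> F \<Longrightarrow> j < card J \<Longrightarrow> lacunary K J n (G J)"
    and hom: "\<And>J. J \<in> F \<Longrightarrow> card J = j \<Longrightarrow> \<exists>up sg. oriented J n (G J) up sg"
    and L: "K * 2 ^ j \<le> 2 ^ (L - 1)" "3 \<le> L" "L * n' < n - 1"
  obtains G' where "\<And>J. J \<in> F \<Longrightarrow> depends J (G' J)"
    "\<And>J. J \<in> F \<Longrightarrow> j \<le> card J \<Longrightarrow> lacunary K J n' (G' J)"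
    "\<And>y. incr (\<Union>F) n' y \<Longrightarrow> (\<Sum>J\<in>F. G J (\<lambda>i. L * Suc (y i))) = (\<Sum>J\<in>F. G' J y)"
proof -
  define Fj where "Fj = {J\<in>F. card J = j}"
  have "\<exists>h H. depends J h \<and> lacunary K J n' h \<and> (\<forall>B. depends B (H B)) \<and>
    (\<forall>y. incr J n' y \<longrightarrow> G J (\<lambda>i. L * Suc (y i)) = h y + (\<Sum>B\<in>Pow J - {J}. H B y))" if J: "J \<in> Fj" for J
  proof -
    have J': "J \<in> F" "card J = j" using J by (auto simp: Fj_def)
    obtain h H where "depends J h" "lacunary K J n' h" "\<And>B. depends B (H B)"
      "\<And>y. incr J n' y \<Longrightarrow> G J (\<lambda>i. L * Suc (y i)) = h y + (\<Sum>B\<in>Pow J - {J}. H B y)"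
      using lacunary_part[OF F(2) dep hom _ L(2,3)] L(1) J' by metis
    then show ?thesis by blast
  qed
  then obtain h H where hH: "\<And>J. J \<in> Fj \<Longrightarrow> depends J (h J)" "\<And>J. J \<in> Fj \<Longrightarrow> lacunary K J n' (h J)"
    "\<And>J B. J \<in> Fj \<Longrightarrow> depends B (H J B)"
    "\<And>J y. J \<in> Fj \<Longrightarrow> incr J n' y \<Longrightarrow> G J (\<lambda>i. L * Suc (y i)) = h J y + (\<Sum>B\<in>Pow J - {J}. H J B y)"
    by metis
  \<comment> \<open>Terms outside \<open>Fj\<close> are only thinned out, to live on the same
    vertices.\<close>
  define A where "A J y = (if J \<in> Fj then h J y else G J (\<lambda>i. L * Suc (y i)))" for J y
  define G' where "G' B y = A B y + (\<Sum>J\<in>Fj. if B \<subset> J then H J B y else 0)" for B y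
  have finj: "finite Fj" using F(1) by (simp add: Fj_def)
  show ?thesis
  proof
    fix J assume J: "J \<in> F"
    have "depends J (A J)"
      using hH(1)[of J] dep[OF J] unfolding A_def depends_def by (cases "J \<in> Fj") auto
    moreover have "depends J (\<lambda>y. \<Sum>J'\<in>Fj. if J \<subset> J' then H J' J y else 0)"
      using hH(3) unfolding depends_def by (auto intro!: sum.cong)
    ultimately have "depends J (\<lambda>y. A J y + (\<Sum>J'\<in>Fj. if J \<subset> J' then H J' J y else 0))"
      by (rule depends_add)
    then show "depends J (G' J)" by (simp add: G'_def[abs_def])
    assume c: "j \<le> card J"
    have "\<not> J \<subset> J'" if "J' \<in> Fj" for J'
      using c that F(2)[of J'] psubset_card_mono[of J' J] by (auto simp: Fj_def)
    then have G': "G' J = A J" by (auto simp: G'_def fun_eq_iff)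
    show "lacunary K J n' (G' J)"
    proof (cases "J \<in> Fj")
      case True
      then show ?thesis using hH(2) G' by (simp add: A_def[abs_def])
    next
      case False
      then have jJ: "j < card J" using c J by (auto simp: Fj_def)
      have "lacunary K J n' (\<lambda>y. G J (\<lambda>i. L * Suc (y i)))"
      proof (rule lacunary_thin[where E="\<lambda>t. L * Suc t", OF lac[OF J jJ]])
        fix y assume y: "incr J n' y"
        have "L * Suc (y i) < n" if "i \<in> J" for i
        proof -
          have "L * Suc (y i) \<le> L * n'" using y that by (intro mult_le_mono2) (auto simp: incr_def)
          then show ?thesis using L(3) by simp
        qed
        then show "incr J n (\<lambda>i. L * Suc (y i))" using y L(2) by (auto simp: incr_def)
      qed (use L(2) in \<open>auto simp: strict_mono_def\<close>)
      then show ?thesis using False G' by (simp add: A_def[abs_def])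
    qed
  next
    fix y assume y: "incr (\<Union>F) n' y"
    have "(\<Sum>J\<in>F. G' J y) = (\<Sum>J\<in>F. A J y) + (\<Sum>B\<in>F. \<Sum>J\<in>Fj. if B \<subset> J then H J B y else 0)"
      by (simp add: G'_def sum.distrib)
    also have "(\<Sum>B\<in>F. \<Sum>J\<in>Fj. if B \<subset> J then H J B y else 0) = (\<Sum>J\<in>Fj. \<Sum>B\<in>F. if B \<subset> J then H J B y else 0)"
      by (rule sum.swap)
    also have "\<dots> = (\<Sum>J\<in>Fj. \<Sum>B\<in>Pow J - {J}. H J B y)"
    proof (rule sum.cong[OF refl])
      fix J assume "J \<in> Fj"
      then have J: "J \<in> F" by (simp add: Fj_def)
      have "{B\<in>F. B \<subset> J} = Pow J - {J}" using F(3)[OF J] by blast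
      then show "(\<Sum>B\<in>F. if B \<subset> J then H J B y else 0) = (\<Sum>B\<in>Pow J - {J}. H J B y)"
        by (simp flip: sum.inter_filter[OF F(1)])
    qed
    also have "\<dots> = (\<Sum>J\<in>F. if J \<in> Fj then (\<Sum>B\<in>Pow J - {J}. H J B y) else 0)"
      using F(1) by (subst sum.inter_filter[symmetric]) (auto simp: Fj_def intro!: sum.cong)
    finally have "(\<Sum>J\<in>F. G' J y) = (\<Sum>J\<in>F. A J y + (if J \<in> Fj then (\<Sum>B\<in>Pow J - {J}. H J B y) else 0))"
      by (simp add: sum.distrib)
    also have "\<dots> = (\<Sum>J\<in>F. G J (\<lambda>i. L * Suc (y i)))"
    proof (rule sum.cong[OF refl])
      fix J assume J: "J \<in> F"
      have "incr J n' y" using incr_subset[OF y] J by blast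
      then show "A J y + (if J \<in> Fj then (\<Sum>B\<in>Pow J - {J}. H J B y) else 0) = G J (\<lambda>i. L * Suc (y i))"
        using hH(4)[of J y] by (simp add: A_def)
    qed
    finally show "(\<Sum>J\<in>F. G J (\<lambda>i. L * Suc (y i))) = (\<Sum>J\<in>F. G' J y)" by simp
  qed
qed

section \<open>Domination of a lacunary sum by one term\<close>

lemma sgn_sum_dominated:
  fixes a :: "'a \<Rightarrow> real"
  assumes "finite F" "J \<in> F" "real (card F) \<le> K" "\<And>B. B \<in> F - {J} \<Longrightarrow> K * \<bar>a B\<bar> \<le> \<bar>a J\<bar>"
  shows "sgn (\<Sum>B\<in>F. a B) = sgn (a J)"
proof -
  define R where "R = (\<Sum>B\<in>F - {J}. a B)"
  have K: "0 < real (card F)" using assms by (auto simp: card_gt_0_iff)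
  have "K * \<bar>R\<bar> \<le> (\<Sum>B\<in>F - {J}. K * \<bar>a B\<bar>)"
    unfolding R_def sum_distrib_left[symmetric] using K assms(3) by (intro mult_left_mono sum_abs) auto
  also have "\<dots> \<le> (\<Sum>B\<in>F - {J}. \<bar>a J\<bar>)" by (rule sum_mono) (rule assms(4))
  also have "\<dots> = (real (card F) - 1) * \<bar>a J\<bar>" using assms(1,2) K by (simp add: of_nat_diff)
  finally have *: "K * \<bar>R\<bar> \<le> (real (card F) - 1) * \<bar>a J\<bar>" .
  have "(\<Sum>B\<in>F. a B) = a J + R" unfolding R_def by (rule sum.remove[OF assms(1,2)])
  \<comment> \<open>The other terms total at most \<open>(card F - 1) / K\<close> times the
    dominating one; if that one is 0, they all vanish.\<close>
  moreover have "\<bar>R\<bar> < \<bar>a J\<bar> \<or> (R = 0 \<and> a J = 0)"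
  proof (cases "a J = 0")
    case True
    then show ?thesis using * K assms(3) by (auto simp: mult_le_0_iff)
  next
    case False
    have "(real (card F) - 1) * \<bar>a J\<bar> < K * \<bar>a J\<bar>" using False assms(3) by (intro mult_strict_right_mono) auto
    then have "K * \<bar>R\<bar> < K * \<bar>a J\<bar>" using * by linarith
    then show ?thesis using K assms(3) by simp
  qed
  ultimately show ?thesis by (auto simp: sgn_real_def)
qed

text \<open>A term \<open>J\<close> that is largest at one tuple is largest at all tuples by
  \<open>hom\<close>. For another term \<open>B\<close>, move the vertex at a position
  \<open>i\<close> that only one of the two sets contains: either \<open>B\<close> grows by
  \<open>K\<close> while \<open>J\<close> stays, or \<open>J\<close> shrinks by \<open>K\<close>
  while \<open>B\<close> stays. Since \<open>J\<close> is still at least as large after the move, it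
  was larger by the factor \<open>K\<close> before.\<close>

lemma sgn_sum_lacunary:
  fixes F :: "nat set set" and G :: "nat set \<Rightarrow> (nat \<Rightarrow> nat) \<Rightarrow> real"
  assumes F: "finite F" "F \<noteq> {}"
    and dep: "\<And>J. J \<in> F \<Longrightarrow> depends J (G J)"
    and lac: "\<And>J. J \<in> F \<Longrightarrow> J \<noteq> {} \<Longrightarrow> lacunary K J n (G J)"
    and hom: "\<And>J J' x x'. \<lbrakk>J \<in> F; J' \<in> F; incr (J \<union> J') n x; incr (J \<union> J') n x'; \<bar>G J x\<bar> \<le> \<bar>G J' x\<bar>\<rbrakk>
      \<Longrightarrow> \<bar>G J x'\<bar> \<le> \<bar>G J' x'\<bar>"
    and K: "real (card F) \<le> K" and n': "3 * n' \<le> n"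
  shows "\<exists>sg. \<forall>y. incr (\<Union>F) n' y \<longrightarrow> sgn (\<Sum>J\<in>F. G J (\<lambda>i. 3 * y i + 1)) = sg"
proof (cases "\<exists>y. incr (\<Union>F) n' y")
  case True
  \<comment> \<open>The middle of each block of three is used, so that every vertex can move in both
    directions inside its block without meeting another one.\<close>
  define E where "E y = (\<lambda>i. 3 * y i + 1)" for y :: "nat \<Rightarrow> nat"
  have E: "incr (\<Union>F) n ((E y)(i := t))"
    if "incr (\<Union>F) n' y" "t = 3 * y i \<or> t = 3 * y i + 1 \<or> t = 3 * y i + 2" for y i t
    unfolding incr_def
  proof (intro conjI ballI impI)
    fix k assume "k \<in> \<Union>F"
    then have "y k < n'" using that(1) by (auto simp: incr_def)
    then show "((E y)(i := t)) k < n" using that(2) n' by (auto simp: E_def)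
  next
    fix k l assume "k \<in> \<Union>F" "l \<in> \<Union>F" "k < l"
    then have "y k < y l" using that(1) unfolding incr_def by blast
    then show "((E y)(i := t)) k < ((E y)(i := t)) l" using that(2) \<open>k < l\<close> by (auto simp: E_def)
  qed
  obtain y0 where y0: "incr (\<Union>F) n' y0" using True by blast
  obtain J where J: "J \<in> F" "\<And>B. B \<in> F \<Longrightarrow> \<bar>G B (E y0)\<bar> \<le> \<bar>G J (E y0)\<bar>"
  proof -
    let ?A = "(\<lambda>J. \<bar>G J (E y0)\<bar>) ` F"
    have "Max ?A \<in> ?A" using F by (intro Max_in) auto
    then obtain J where "J \<in> F" "Max ?A = \<bar>G J (E y0)\<bar>" by blast
    then show ?thesis using that[of J] F(1) by (metis Max_ge finite_imageI imageI)
  qed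
  have E0: "incr (\<Union>F) n (E y)" if "incr (\<Union>F) n' y" for y
  proof -
    have "(E y)(0 := E y 0) = E y" by simp
    then show ?thesis using E[OF that, of "E y 0" 0] by (simp only:) (simp add: E_def)
  qed
  have max: "\<bar>G B x\<bar> \<le> \<bar>G J x\<bar>" if "B \<in> F" "incr (\<Union>F) n x" for B x
    by (rule hom[OF that(1) J(1) _ _ J(2)[OF that(1)]])
      (use that J(1) E0[OF y0] in \<open>auto intro: incr_subset\<close>)
  obtain sg where sg: "\<And>x. incr J n x \<Longrightarrow> sgn (G J x) = sg"
  proof (cases "J = {}")
    case True
    have "G J x = G J (\<lambda>_. 0)" for x by (rule dependsD[OF dep[OF J(1)]]) (simp add: True)
    then show ?thesis using that by metis
  next
    case False
    then show ?thesis using lac[OF J(1)] that unfolding lacunary_def by blast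
  qed
  have "sgn (\<Sum>B\<in>F. G B (E y)) = sg" if y: "incr (\<Union>F) n' y" for y
  proof -
    have "K * \<bar>G B (E y)\<bar> \<le> \<bar>G J (E y)\<bar>" if B: "B \<in> F - {J}" for B
    proof -
      obtain i where i: "i \<in> B - J \<or> i \<in> J - B" using B by blast
      let ?m = "(E y)(i := 3 * y i)" and ?p = "(E y)(i := 3 * y i + 2)"
      have inc: "incr C n (E y)" "incr C n ?m" "incr C n ?p" if "C \<in> F" for C
        using that E[OF y, of _ i] E0[OF y] by (blast intro: incr_subset)+
      \<comment> \<open>Of the two neighbours of \<open>E y\<close>, one enlarges and the other
        reduces the size of \<open>G C\<close> by the factor \<open>K\<close>; which is which
        depends on \<open>C\<close>.\<close>
      have nb: "K * \<bar>G C (E y)\<bar> \<le> \<bar>G C ?p\<bar> \<and> K * \<bar>G C ?m\<bar> \<le> \<bar>G C (E y)\<bar> \<or>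
          K * \<bar>G C (E y)\<bar> \<le> \<bar>G C ?m\<bar> \<and> K * \<bar>G C ?p\<bar> \<le> \<bar>G C (E y)\<bar>" if C: "C \<in> F" "i \<in> C" for C
      proof -
        have "lacunary K C n (G C)" using lac C by blast
        then have "grows K C n i (G C) \<or> decays K C n i (G C)" using C(2) by (simp add: lacunary_def)
        moreover have "K * \<bar>G C (E y)\<bar> \<le> \<bar>G C ?p\<bar>" "K * \<bar>G C ?m\<bar> \<le> \<bar>G C (E y)\<bar>" if g: "grows K C n i (G C)"
          by (rule g[unfolded grows_def, rule_format]; use inc[OF C(1)] in \<open>simp add: E_def\<close>)+
        moreover have "K * \<bar>G C (E y)\<bar> \<le> \<bar>G C ?m\<bar>" "K * \<bar>G C ?p\<bar> \<le> \<bar>G C (E y)\<bar>" if g: "decays K C n i (G C)"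
          by (rule g[unfolded decays_def, rule_format]; use inc[OF C(1)] in \<open>simp add: E_def\<close>)+
        ultimately show ?thesis by blast
      qed
      have mp: "\<bar>G B ?m\<bar> \<le> \<bar>G J ?m\<bar>" "\<bar>G B ?p\<bar> \<le> \<bar>G J ?p\<bar>" "\<bar>G B (E y)\<bar> \<le> \<bar>G J (E y)\<bar>"
        using max[of B] B E[OF y, of _ i] E0[OF y] by auto
      have same: "G C ?m = G C (E y)" "G C ?p = G C (E y)" if "C \<in> F" "i \<notin> C" for C
        using that by (auto intro!: dependsD[OF dep])
      have K0: "0 \<le> K" using K by linarith
      show ?thesis
      proof (cases "i \<in> B")
        case True
        then have "i \<notin> J" using i by auto
        then have "G J ?m = G J (E y)" "G J ?p = G J (E y)" using same J(1) by auto
        then show ?thesis using nb[of B] True B mp by auto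
      next
        case False
        then have iJ: "i \<in> J" using i by auto
        have "G B ?m = G B (E y)" "G B ?p = G B (E y)" using same B False by auto
        then have "K * \<bar>G B (E y)\<bar> \<le> K * \<bar>G J ?m\<bar>" "K * \<bar>G B (E y)\<bar> \<le> K * \<bar>G J ?p\<bar>"
          using mp K0 by (auto intro!: mult_left_mono)
        then show ?thesis using nb[of J] J(1) iJ by auto
      qed
    qed
    then have "sgn (\<Sum>B\<in>F. G B (E y)) = sgn (G J (E y))"
      by (rule sgn_sum_dominated[OF F(1) J(1) K])
    also have "\<dots> = sg" using sg incr_subset[OF E0[OF y]] J(1) by blast
    finally show ?thesis .
  qed
  then show ?thesis unfolding E_def by blast
qed blast

section \<open>Hypergraph Ramsey numbers\<close>

primrec itexp :: "nat \<Rightarrow> nat \<Rightarrow> nat" where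
  "itexp 0 n = n"
| "itexp (Suc k) n = 2 ^ itexp k n"

lemma le_itexp: "n \<le> itexp k n"
  by (induction k) (auto intro: order_trans[OF _ less_imp_le[OF less_exp]])

lemma itexp_mono: "m \<le> n \<Longrightarrow> itexp k m \<le> itexp k n"
  by (induction k) (auto intro: power_increasing)

lemma itexp_add: "itexp (k + l) n = itexp k (itexp l n)"
  by (induction k) auto

lemma itexp_le_add: "itexp k n \<le> itexp (k + l) n"
  by (simp add: itexp_add itexp_mono le_itexp)

lemma itexp_pos: "0 < k \<Longrightarrow> 0 < itexp k n"
  by (cases k) auto

lemma cmult_power_le_div_power:
  fixes b c p :: nat
  assumes "0 < b"
  obtains n0 where "\<And>n. n0 \<le> n \<Longrightarrow> c * n ^ p \<le> (n div b) ^ Suc p"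
proof
  fix n assume n: "c * (2 * b) ^ Suc p + b \<le> n"
  have "n = b * (n div b) + n mod b" by simp
  moreover have "n mod b < b" using assms by simp
  moreover have "1 \<le> n div b" using n assms by (simp add: div_greater_zero_iff Suc_le_eq)
  then have "b \<le> b * (n div b)" by simp
  ultimately have "n \<le> 2 * b * (n div b)" by linarith
  then have "n ^ Suc p \<le> (2 * b * (n div b)) ^ Suc p" by (rule power_mono) simp
  moreover have "c * (2 * b) ^ Suc p * n ^ p \<le> n * n ^ p" using n by (intro mult_right_mono) auto
  ultimately have "(2 * b) ^ Suc p * (c * n ^ p) \<le> (2 * b) ^ Suc p * (n div b) ^ Suc p"
    by (simp only: power_mult_distrib[symmetric] power_Suc[of n p] mult.assoc mult.left_commute)
  moreover have "0 < (2 * b) ^ Suc p" using assms by simp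
  ultimately show "c * n ^ p \<le> (n div b) ^ Suc p" using mult_le_cancel1 by blast
qed

lemma cmult_power_le_exp:
  fixes c p :: nat
  obtains n0 where "\<And>n. n0 \<le> n \<Longrightarrow> c * n ^ p \<le> 2 ^ n"
proof -
  obtain n0 where n0: "\<And>n. n0 \<le> n \<Longrightarrow> c * n ^ p \<le> (n div Suc p) ^ Suc p"
    using cmult_power_le_div_power[of "Suc p" c p] by blast
  have "c * n ^ p \<le> 2 ^ n" if "n0 \<le> n" for n
  proof -
    have "(n div Suc p) ^ Suc p \<le> (2 ^ (n div Suc p)) ^ Suc p"
      by (rule power_mono[OF less_imp_le[OF less_exp]]) simp
    also have "\<dots> = 2 ^ (n div Suc p * Suc p)" by (simp only: power_mult)
    also have "\<dots> \<le> 2 ^ n" by (intro power_increasing) (auto simp only: div_times_less_eq_dividend)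
    finally show ?thesis using n0[OF that] by linarith
  qed
  then show ?thesis using that by blast
qed

text \<open>Dividing the argument by a constant outweighs every fixed power and factor. Hence the
  Ramsey recursion may lose polynomial factors at every level without extra height.\<close>

lemma itexp_div_power:
  assumes "0 < k"
  shows "\<exists>b n0. 0 < b \<and> (\<forall>n\<ge>n0. a * itexp k (n div b) ^ a \<le> itexp k n)"
  using assms
proof (induction k arbitrary: a rule: nat_induct_non_zero)
  case 1
  let ?b = "2 * a + 1"
  have "a * itexp 1 (n div ?b) ^ a \<le> itexp 1 n" if "2 * a \<le> n" for n
  proof -
    have "n div ?b * ?b \<le> n" by (rule div_times_less_eq_dividend)
    then have "2 * (n div ?b * a) \<le> n" by (simp only: distrib_left mult_1_right)
    then have le: "a + n div ?b * a \<le> n" using that by linarith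
    have "a * itexp 1 (n div ?b) ^ a \<le> 2 ^ a * 2 ^ (n div ?b * a)"
      by (simp add: power_mult less_imp_le)
    also have "\<dots> = 2 ^ (a + n div ?b * a)" by (simp only: power_add)
    also have "\<dots> \<le> 2 ^ n" using le by (intro power_increasing) auto
    finally show ?thesis by simp
  qed
  then show ?case by (intro exI[of _ ?b] exI[of _ "2 * a"]) auto
next
  case (Suc k)
  \<comment> \<open>One level up, the power \<open>a\<close> becomes a factor and the factor
    \<open>a\<close> at most a summand of the exponent; \<open>2 * a + 1\<close> covers
    both.\<close>
  obtain b n0 where b: "0 < b" "\<And>n. n0 \<le> n \<Longrightarrow> (2 * a + 1) * itexp k (n div b) ^ (2 * a + 1) \<le> itexp k n"
    using Suc.IH[of "2 * a + 1"] by blast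
  have "a * itexp (Suc k) (n div b) ^ a \<le> itexp (Suc k) n" if "n0 \<le> n" for n
  proof -
    let ?E = "itexp k (n div b)"
    have E: "1 \<le> ?E" using itexp_pos[OF \<open>0 < k\<close>] by (simp add: Suc_le_eq)
    then have "a * 1 \<le> a * ?E" by (rule mult_le_mono2)
    moreover have "?E * (2 * a + 1) = a * ?E + ?E * a + ?E" by (simp add: algebra_simps)
    ultimately have "a + ?E * a \<le> ?E * (2 * a + 1)" by linarith
    also have "\<dots> \<le> ?E ^ (2 * a + 1) * (2 * a + 1)" using E by (intro mult_right_mono) auto
    finally have le: "a + ?E * a \<le> itexp k n" using b(2)[OF that] by (simp add: mult.commute)
    have "a * itexp (Suc k) (n div b) ^ a \<le> 2 ^ a * 2 ^ (?E * a)"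
      by (simp add: power_mult less_imp_le)
    also have "\<dots> = 2 ^ (a + ?E * a)" by (simp only: power_add)
    also have "\<dots> \<le> 2 ^ itexp k n" using le by (intro power_increasing) auto
    finally show ?thesis by simp
  qed
  with b(1) show ?case by blast
qed

section \<open>Ramsey's theorem for colourings of sets\<close>

lemma pigeonhole_fiber:
  assumes "finite R" "card (f ` R) \<le> Q"
  obtains R' where "R' \<subseteq> R" "card R \<le> Q * card R'" "\<And>y y'. y \<in> R' \<Longrightarrow> y' \<in> R' \<Longrightarrow> f y = f y'"
proof (cases "R = {}")
  case False
  let ?h = "\<lambda>c. card {y\<in>R. f y = c}"
  have A: "finite (?h ` f ` R)" "?h ` f ` R \<noteq> {}" using assms False by auto
  have "Max (?h ` f ` R) \<in> ?h ` f ` R" by (rule Max_in[OF A])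
  then obtain c where c: "Max (?h ` f ` R) = ?h c" "c \<in> f ` R" by (rule imageE)
  have le: "?h c' \<le> ?h c" if "c' \<in> f ` R" for c'
    unfolding c(1)[symmetric] by (rule Max_ge[OF A(1)]) (rule imageI[OF that])
  have "card R = (\<Sum>y\<in>R. 1)" by simp
  also have "\<dots> = (\<Sum>c\<in>f ` R. \<Sum>y\<in>{y\<in>R. f y = c}. 1)" by (rule sum.image_gen[OF assms(1)])
  also have "\<dots> = (\<Sum>c\<in>f ` R. ?h c)" by simp
  also have "\<dots> \<le> (\<Sum>c'\<in>f ` R. ?h c)" by (rule sum_mono[OF le])
  also have "\<dots> \<le> Q * ?h c" using assms(2) by simp
  finally show ?thesis by (intro that[of "{y\<in>R. f y = c}"]) simp_all
next
  case True
  then show ?thesis by (intro that[of "{}"]) simp_all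
qed

text \<open>The stepping-down argument of Erdos and Rado: repeatedly take the least remaining vertex and
  keep a largest class of the vertices above it.\<close>

lemma end_homogeneous_subset:
  fixes P :: "nat set \<Rightarrow> nat \<Rightarrow> nat \<Rightarrow> 't" and X :: "nat set"
  assumes X: "finite X" "(2 * Q) ^ M \<le> card X" "0 < Q"
    and step: "\<And>W w R. \<lbrakk>W \<subseteq> X; w \<in> X; R \<subseteq> X; card W < M; \<And>v. v \<in> W \<Longrightarrow> v < w; \<And>y. y \<in> R \<Longrightarrow> w < y\<rbrakk>
      \<Longrightarrow> \<exists>R'\<subseteq>R. card R \<le> Q * card R' \<and> (\<forall>B\<subseteq>W. \<forall>y\<in>R'. \<forall>y'\<in>R'. P B w y = P B w y')"
  obtains W where "W \<subseteq> X" "card W = M"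
    "\<And>w B y y'. \<lbrakk>w \<in> W; B \<subseteq> W \<inter> {..<w}; y \<in> W; y' \<in> W; w < y; w < y'\<rbrakk> \<Longrightarrow> P B w y = P B w y'"
proof -
  \<comment> \<open>\<open>W\<close> is the part chosen so far and \<open>R\<close> the reservoir
    above it. The types agree on all of \<open>W \<union> R\<close>, so later choices from
    \<open>R\<close> cannot spoil them.\<close>
  have "\<exists>W R. W \<subseteq> X \<and> R \<subseteq> X \<and> card W = t \<and> (\<forall>v\<in>W. \<forall>y\<in>R. v < y) \<and> (2 * Q) ^ (M - t) \<le> card R \<and>
    (\<forall>w\<in>W. \<forall>B\<subseteq>W \<inter> {..<w}. \<forall>y\<in>W \<union> R. \<forall>y'\<in>W \<union> R. w < y \<longrightarrow> w < y' \<longrightarrow> P B w y = P B w y')"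
    if "t \<le> M" for t
    using that
  proof (induction t)
    case 0
    then show ?case using X by (intro exI[of _ "{}"] exI[of _ X]) auto
  next
    case (Suc t)
    then obtain W R where WR: "W \<subseteq> X" "R \<subseteq> X" "card W = t" "\<And>v y. v \<in> W \<Longrightarrow> y \<in> R \<Longrightarrow> v < y"
      "(2 * Q) ^ (M - t) \<le> card R" and
      hom: "\<And>w B y y'. \<lbrakk>w \<in> W; B \<subseteq> W \<inter> {..<w}; y \<in> W \<union> R; y' \<in> W \<union> R; w < y; w < y'\<rbrakk> \<Longrightarrow> P B w y = P B w y'"
      by (metis Suc_leD)
    define c where "c = (2 * Q) ^ (M - Suc t)"
    have c: "0 < c" using X(3) by (simp add: c_def)
    \<comment> \<open>Of the factor \<open>2 * Q\<close>, the part \<open>Q\<close> pays for the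
      number of classes and the 2 for the removed vertex \<open>w\<close> and for rounding.\<close>
    have cR: "2 * (Q * c) \<le> card R"
    proof -
      have "M - t = Suc (M - Suc t)" using Suc.prems by simp
      then show ?thesis using WR(5) by (simp add: c_def mult.assoc)
    qed
    have finR: "finite R" using WR(2) X(1) finite_subset by blast
    have "R \<noteq> {}" using cR c X(3) by auto
    define w where "w = Min R"
    have w: "w \<in> R" unfolding w_def using finR \<open>R \<noteq> {}\<close> by (rule Min_in)
    have wlt: "w < y" if "y \<in> R - {w}" for y
      using that Min_le[OF finR, of y] unfolding w_def by force
    obtain R' where R': "R' \<subseteq> R - {w}" "card (R - {w}) \<le> Q * card R'"
      "\<And>B y y'. B \<subseteq> W \<Longrightarrow> y \<in> R' \<Longrightarrow> y' \<in> R' \<Longrightarrow> P B w y = P B w y'"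
      using step[of W w "R - {w}"] WR w wlt Suc.prems by (metis Diff_subset Suc_le_eq subset_eq)
    have cR': "c \<le> card R'"
    proof (rule ccontr)
      assume "\<not> c \<le> card R'"
      then have "Q * Suc (card R') \<le> Q * c" by (intro mult_le_mono2) simp
      moreover have "card R - 1 \<le> Q * card R'" using R'(2) w finR by simp
      moreover have "Q \<le> Q * c" using c by simp
      ultimately show False using cR X(3) by (simp only: mult_Suc_right)
    qed
    have "w \<notin> W" using WR(4) w by blast
    then have cW: "card (insert w W) = Suc t" using WR(1,3) X(1) finite_subset by (metis card_insert_disjoint)
    have hom': "P B v y = P B v y'"
      if v: "v \<in> insert w W" "B \<subseteq> insert w W \<inter> {..<v}" "y \<in> insert w W \<union> R'" "y' \<in> insert w W \<union> R'" "v < y" "v < y'"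
      for v B y y'
    proof (cases "v = w")
      case True
      have "y \<in> R'" "y' \<in> R'" using v True WR(4) w by force+
      moreover have "B \<subseteq> W" using v(2) True by auto
      ultimately show ?thesis using R'(3) True by blast
    next
      case False
      then have "v \<in> W" using v(1) by blast
      moreover have "B \<subseteq> W \<inter> {..<v}" using v(2) WR(4)[OF \<open>v \<in> W\<close> w] by auto
      moreover have "y \<in> W \<union> R" "y' \<in> W \<union> R" using v(3,4) R'(1) w by auto
      ultimately show ?thesis using hom v(5,6) by blast
    qed
    have sep: "v < y" if "v \<in> insert w W" "y \<in> R'" for v y
      using that wlt[of y] R'(1) WR(4) by auto
    show ?case
    proof (rule exI[of _ "insert w W"], rule exI[of _ R'], intro conjI ballI allI impI)
      show "insert w W \<subseteq> X" "R' \<subseteq> X" using WR(1,2) w R'(1) by auto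
      show "(2 * Q) ^ (M - Suc t) \<le> card R'" using cR' by (simp only: c_def)
    qed (fact cW | erule (1) sep | erule (5) hom')+
  qed
  from this[of M] show ?thesis using that by (metis (no_types, lifting) UnCI order_refl)
qed

abbreviation monochromatic :: "nat \<Rightarrow> nat set \<Rightarrow> (nat set \<Rightarrow> 'c) \<Rightarrow> bool" where
  "monochromatic k H col \<equiv> \<forall>A B. A \<subseteq> H \<longrightarrow> B \<subseteq> H \<longrightarrow> card A = k \<longrightarrow> card B = k \<longrightarrow> col A = col B"

text \<open>For singletons one exponential is spent where \<open>c * n ^ p\<close> vertices would
  do; this surplus yields \<open>n ^ p\<close> instead of \<open>n\<close>. The power absorbs the
  division by \<open>b\<close> in the induction, and later the vertices used for padding.\<close>

lemma ramsey_itexp: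
  assumes "0 < k"
  shows "\<exists>n0. \<forall>n\<ge>n0. \<forall>X (col :: nat set \<Rightarrow> 'c) C. finite X \<and> itexp k n \<le> card X \<and>
      finite C \<and> card C \<le> c \<and> (\<forall>A. col A \<in> C) \<longrightarrow>
    (\<exists>H\<subseteq>X. card H = n ^ p \<and> monochromatic k H col)"
  using assms
proof (induction k arbitrary: p rule: nat_induct_non_zero)
  case 1
  obtain n0 where n0: "\<And>n. n0 \<le> n \<Longrightarrow> c * n ^ p \<le> 2 ^ n" using cmult_power_le_exp by blast
  show ?case
  proof (rule exI[of _ n0], intro allI impI, elim conjE)
    fix n and X :: "nat set" and col :: "nat set \<Rightarrow> 'c" and C
    assume n: "n0 \<le> n" and X: "finite X" "itexp 1 n \<le> card X" and C: "finite C" "card C \<le> c" "\<forall>A. col A \<in> C"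
    have "card ((\<lambda>y. col {y}) ` X) \<le> card C" using C by (intro card_mono) auto
    then obtain R where R: "R \<subseteq> X" "card X \<le> c * card R" "\<And>y y'. y \<in> R \<Longrightarrow> y' \<in> R \<Longrightarrow> col {y} = col {y'}"
      using pigeonhole_fiber[OF X(1), of "\<lambda>y. col {y}" c] C(2) by (metis (no_types, lifting) le_trans)
    have "C \<noteq> {}" using C(3) by auto
    then have "0 < c" using C(1,2) by (metis card_gt_0_iff gr_zeroI le_zero_eq)
    have "c * n ^ p \<le> c * card R"
      using n0[OF n] X(2) R(2) by (simp only: One_nat_def itexp.simps)
    then have "n ^ p \<le> card R" using \<open>0 < c\<close> by simp
    then obtain H where H: "H \<subseteq> R" "card H = n ^ p" by (metis obtain_subset_with_card_n)
    have colH: "col A = col B" if "A \<subseteq> H" "B \<subseteq> H" "card A = 1" "card B = 1" for A B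
      using that H(1) R(3) by (metis card_1_singletonE insert_subset subset_iff)
    show "\<exists>H\<subseteq>X. card H = n ^ p \<and> monochromatic 1 H col"
      by (rule exI[of _ H], intro conjI allI impI)
        (fact subset_trans[OF H(1) R(1)], fact H(2), rule colH)
  qed
next
  case (Suc k)
  \<comment> \<open>From the estimate of the exponent that the end-homogeneous set costs:
    \<open>(1 + c) * (2 * M) ^ k = a * M ^ k\<close>.\<close>
  define a :: nat where "a = (1 + c) * 2 ^ k"
  have ka: "k \<le> a" unfolding a_def by (rule order_trans[OF less_imp_le[OF less_exp]]) simp
  obtain b n1 where b: "0 < b" "\<And>n. n1 \<le> n \<Longrightarrow> a * itexp k (n div b) ^ a \<le> itexp k n"
    using itexp_div_power[OF \<open>0 < k\<close>] by blast
  obtain n2 where n2: "\<And>n. n2 \<le> n \<Longrightarrow> 1 * n ^ p \<le> (n div b) ^ Suc p"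
    using cmult_power_le_div_power[OF b(1)] by blast
  obtain n3 where n3: "\<And>n X (col :: nat set \<Rightarrow> 'c) C. \<lbrakk>n3 \<le> n; finite X; itexp k n \<le> card X; finite C; card C \<le> c; \<forall>A. col A \<in> C\<rbrakk>
    \<Longrightarrow> \<exists>H\<subseteq>X. card H = n ^ Suc p \<and> monochromatic k H col"
    using Suc.IH[of "Suc p"] by metis
  show ?case
  proof (rule exI[of _ "n1 + n2 + b * n3"], intro allI impI, elim conjE)
    fix n and X :: "nat set" and col :: "nat set \<Rightarrow> 'c" and C
    assume n: "n1 + n2 + b * n3 \<le> n" and X: "finite X" "itexp (Suc k) n \<le> card X"
      and C: "finite C" "card C \<le> c" "\<forall>A. col A \<in> C"
    define M where "M = itexp k (n div b)"
    have M: "1 \<le> M" unfolding M_def using itexp_pos[OF \<open>0 < k\<close>] by (simp add: Suc_le_eq)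
    define Q :: nat where "Q = 2 ^ (c * (M + 1) ^ (k - 1))"
    \<comment> \<open>The type of \<open>y\<close> over the chosen vertices consists of the colours
      of \<open>Suc k\<close>-sets with the two largest elements \<open>w\<close> and
      \<open>y\<close>. For \<open>B\<close> of any other size, \<open>col {}\<close> makes the type
      trivially constant.\<close>
    define P where "P B w y = (if card B = k - 1 then col (insert y (insert w B)) else col {})" for B w y
    have step: "\<exists>R'\<subseteq>R. card R \<le> Q * card R' \<and> (\<forall>B\<subseteq>W. \<forall>y\<in>R'. \<forall>y'\<in>R'. P B w y = P B w y')"
      if W: "W \<subseteq> X" and R: "R \<subseteq> X" and cW: "card W < M + 1" for W w R
    proof -
      define BB where "BB = {B. B \<subseteq> W \<and> card B = k - 1}"
      have finW: "finite W" using W X(1) finite_subset by blast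
      have finB: "finite BB" unfolding BB_def using finW by simp
      have "card BB = card W choose (k - 1)" unfolding BB_def by (rule n_subsets[OF finW])
      also have "\<dots> \<le> (M + 1) ^ (k - 1)"
      proof (cases "k - 1 \<le> card W")
        case True
        have "card W choose (k - 1) \<le> card W ^ (k - 1)" by (rule binomial_le_pow[OF True])
        also have "\<dots> \<le> (M + 1) ^ (k - 1)" using cW by (intro power_mono) auto
        finally show ?thesis .
      qed (simp add: binomial_eq_0)
      finally have cB: "card BB \<le> (M + 1) ^ (k - 1)" .
      let ?f = "\<lambda>y. restrict (\<lambda>B. col (insert y (insert w B))) BB"
      have "card (?f ` R) \<le> card (BB \<rightarrow>\<^sub>E C)"
        using C finB by (intro card_mono finite_PiE) auto
      also have "\<dots> = card C ^ card BB" by (rule card_funcsetE[OF finB])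
      also have "\<dots> \<le> (2 ^ c) ^ card BB"
        by (rule power_mono[OF order_trans[OF C(2) less_imp_le[OF less_exp]]]) simp
      also have "\<dots> \<le> (2 ^ c) ^ ((M + 1) ^ (k - 1))"
        using cB by (intro power_increasing) auto
      also have "\<dots> = Q" by (simp add: Q_def power_mult)
      finally have "card (?f ` R) \<le> Q" .
      then obtain R' where R': "R' \<subseteq> R" "card R \<le> Q * card R'" "\<And>y y'. y \<in> R' \<Longrightarrow> y' \<in> R' \<Longrightarrow> ?f y = ?f y'"
        using pigeonhole_fiber[of R ?f Q] R X(1) finite_subset by blast
      have "P B w y = P B w y'" if "B \<subseteq> W" "y \<in> R'" "y' \<in> R'" for B y y'
      proof (cases "card B = k - 1")
        case True
        then have "B \<in> BB" using that by (simp add: BB_def)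
        then have "?f y B = col (insert y (insert w B))" "?f y' B = col (insert y' (insert w B))" by simp_all
        then show ?thesis using R'(3)[OF that(2,3)] True by (simp add: P_def)
      qed (simp add: P_def)
      then show ?thesis using R'(1,2) by blast
    qed
    have big: "(2 * Q) ^ (M + 1) \<le> card X"
    proof -
      have "(M + 1) * (c * (M + 1) ^ (k - 1) + 1) \<le> (1 + c) * (M + 1) ^ k"
      proof -
        have "(M + 1) ^ k = (M + 1) * (M + 1) ^ (k - 1)" using \<open>0 < k\<close> by (cases k) auto
        moreover have "1 \<le> (M + 1) ^ (k - 1)" by simp
        then have "c * (M + 1) ^ (k - 1) + 1 \<le> (1 + c) * (M + 1) ^ (k - 1)" by simp
        then have "(M + 1) * (c * (M + 1) ^ (k - 1) + 1) \<le> (M + 1) * ((1 + c) * (M + 1) ^ (k - 1))"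
          by (rule mult_le_mono2)
        ultimately show ?thesis by (metis mult.left_commute)
      qed
      also have "\<dots> \<le> (1 + c) * (2 * M) ^ k" using M by (intro mult_le_mono2 power_mono) auto
      also have "\<dots> = a * M ^ k" unfolding a_def power_mult_distrib by (rule mult.assoc[symmetric])
      also have "\<dots> \<le> a * M ^ a" using M ka by (intro mult_le_mono2 power_increasing) auto
      also have "\<dots> \<le> itexp k n" using b(2)[of n] n by (simp add: M_def)
      finally have le: "(M + 1) * (c * (M + 1) ^ (k - 1) + 1) \<le> itexp k n" .
      have "2 * Q = 2 ^ (c * (M + 1) ^ (k - 1) + 1)" by (simp add: Q_def)
      then have "(2 * Q) ^ (M + 1) = 2 ^ ((M + 1) * (c * (M + 1) ^ (k - 1) + 1))"
        by (metis mult.commute power_mult)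
      also have "\<dots> \<le> 2 ^ itexp k n" using le by (rule power_increasing) simp
      finally show ?thesis using X(2) by simp
    qed
    have "0 < Q" by (simp add: Q_def)
    obtain W where W: "W \<subseteq> X" "card W = M + 1"
      and hom: "\<And>w B y y'. \<lbrakk>w \<in> W; B \<subseteq> W \<inter> {..<w}; y \<in> W; y' \<in> W; w < y; w < y'\<rbrakk> \<Longrightarrow> P B w y = P B w y'"
    proof (rule end_homogeneous_subset[OF X(1) big \<open>0 < Q\<close>, of P])
      fix W w R assume "W \<subseteq> X" "R \<subseteq> X" "card W < M + 1"
      then show "\<exists>R'\<subseteq>R. card R \<le> Q * card R' \<and> (\<forall>B\<subseteq>W. \<forall>y\<in>R'. \<forall>y'\<in>R'. P B w y = P B w y')"
        by (rule step)
    qed (rule that)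
    have finW: "finite W" using W X(1) finite_subset by blast
    \<comment> \<open>In \<open>W\<close> the colour of a \<open>Suc k\<close>-set does not depend
      on its last element, so \<open>z\<close> can serve as the last element of all of them. This
      leaves a colouring of \<open>k\<close>-sets.\<close>
    define z where "z = Max W"
    have z: "z \<in> W" unfolding z_def using finW W(2) by (intro Max_in) auto
    have zmax: "y < z" if "y \<in> W - {z}" for y
      using that Max_ge[OF finW, of y] by (force simp: z_def)
    have "card (W - {z}) = M" using z finW W(2) by simp
    moreover have "n3 \<le> n div b" using n b(1) by (simp add: less_eq_div_iff_mult_less_eq mult.commute)
    ultimately obtain H where H: "H \<subseteq> W - {z}" "card H = (n div b) ^ Suc p"
      "\<And>A B. \<lbrakk>A \<subseteq> H; B \<subseteq> H; card A = k; card B = k\<rbrakk> \<Longrightarrow> col (insert z A) = col (insert z B)"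
      using n3[of "n div b" "W - {z}" C "\<lambda>A. col (insert z A)"] finW C by (auto simp: M_def)
    have "n ^ p \<le> card H" using n2[of n] n H(2) by simp
    then obtain H' where H': "H' \<subseteq> H" "card H' = n ^ p" by (metis obtain_subset_with_card_n)
    have red: "\<exists>A'\<subseteq>H. card A' = k \<and> col A = col (insert z A')" if A: "A \<subseteq> H'" "card A = Suc k" for A
    proof -
      have finA: "finite A" using A(2) by (simp add: card_ge_0_finite)
      define y where "y = Max A"
      have y: "y \<in> A" unfolding y_def using finA A(2) by (intro Max_in) auto
      define A' where "A' = A - {y}"
      have cA': "card A' = k" "finite A'" using y A(2) finA by (auto simp: A'_def)
      define w where "w = Max A'"
      have w: "w \<in> A'" unfolding w_def using cA' \<open>0 < k\<close> by (intro Max_in) auto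
      define B where "B = A' - {w}"
      have cB: "card B = k - 1" using w cA' by (simp add: B_def)
      have AW: "A \<subseteq> W - {z}" using A(1) H'(1) H(1) by blast
      have "B \<subseteq> W \<inter> {..<w}"
        using AW Max_ge[OF cA'(2)] by (force simp: B_def A'_def w_def)
      moreover have "w < y" using w Max_ge[OF finA, of w] by (force simp: A'_def y_def)
      moreover have "w \<in> W" "y \<in> W" "w < z" using w y AW zmax by (auto simp: A'_def)
      ultimately have "P B w y = P B w z" using hom z by blast
      moreover have "insert w B = A'" "insert y A' = A" using w y by (auto simp: B_def A'_def)
      ultimately have "col A = col (insert z A')" using cB by (simp add: P_def)
      moreover have "A' \<subseteq> H" using A(1) H'(1) by (auto simp: A'_def)
      ultimately show ?thesis using cA' by blast
    qed
    have colH: "col A = col B" if "A \<subseteq> H'" "B \<subseteq> H'" "card A = Suc k" "card B = Suc k" for A B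
      using red[of A] red[of B] H(3) that by metis
    have H'X: "H' \<subseteq> X" using H'(1) H(1) W(1) by blast
    show "\<exists>H\<subseteq>X. card H = n ^ p \<and> monochromatic (Suc k) H col"
      by (rule exI[of _ H'], intro conjI allI impI) (fact H'X, fact H'(2), rule colH)
  qed
qed

section \<open>Ramsey's theorem for families of predicates\<close>

lemma initial_embedding_unique:
  fixes w w' :: "nat \<Rightarrow> nat"
  assumes "incr M n w" "incr M n' w'" "w ` M \<subseteq> A" "w' ` M \<subseteq> A"
    "\<And>a i. a \<in> A - w ` M \<Longrightarrow> i \<in> M \<Longrightarrow> w i < a" "\<And>a i. a \<in> A - w' ` M \<Longrightarrow> i \<in> M \<Longrightarrow> w' i < a"
    and "m \<in> M"
  shows "w m = w' m"
  using assms(7)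
proof (induction m rule: less_induct)
  case (less m)
  \<comment> \<open>At the first disagreement the smaller value \<open>u m\<close> is an element of
    \<open>A\<close> below \<open>v m\<close>, hence a value \<open>v m'\<close> with
    \<open>m' < m\<close>. There \<open>u\<close> and \<open>v\<close> agree, against the
    injectivity of \<open>u\<close>.\<close>
  have key: False
    if uv: "incr M k u" "incr M l v" "u ` M \<subseteq> A" "\<And>a i. a \<in> A - v ` M \<Longrightarrow> i \<in> M \<Longrightarrow> v i < a"
      "u m < v m" "\<And>m'. m' < m \<Longrightarrow> m' \<in> M \<Longrightarrow> u m' = v m'" for u v :: "nat \<Rightarrow> nat" and k l
  proof -
    have "u m \<in> v ` M" using uv(3) uv(4)[of "u m" m] uv(5) less.prems by force
    then obtain m' where m': "m' \<in> M" "u m = v m'" by blast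
    have "m' < m" using uv(2,5) m' less.prems unfolding incr_def by (metis linorder_neqE_nat order_less_asym order_less_irrefl)
    then show False using uv(1) uv(6)[OF _ m'(1)] m' less.prems unfolding incr_def by (metis order_less_irrefl)
  qed
  show ?case
  proof (rule linorder_cases[of "w m" "w' m"])
    assume "w m < w' m"
    have False by (rule key[OF assms(1,2,3)]) (use assms(6) \<open>w m < w' m\<close> less.IH in simp_all)
    then show ?thesis ..
  next
    assume "w' m < w m"
    have False by (rule key[OF assms(2,1,4)]) (use assms(5) \<open>w' m < w m\<close> less.IH in simp_all)
    then show ?thesis ..
  qed
qed

definition small_predicates :: "nat \<Rightarrow> nat \<Rightarrow> 'p set \<Rightarrow> ('p \<Rightarrow> nat set) \<Rightarrow> ('p \<Rightarrow> (nat \<Rightarrow> nat) \<Rightarrow> bool) \<Rightarrow> bool" where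
  "small_predicates k c I M \<Phi> \<longleftrightarrow> finite I \<and> card I \<le> c \<and>
    (\<forall>p\<in>I. finite (M p) \<and> card (M p) \<le> k \<and> depends (M p) (\<Phi> p))"

definition uniform_on :: "(nat \<Rightarrow> nat) \<Rightarrow> nat \<Rightarrow> 'p set \<Rightarrow> ('p \<Rightarrow> nat set) \<Rightarrow> ('p \<Rightarrow> (nat \<Rightarrow> nat) \<Rightarrow> bool) \<Rightarrow> bool" where
  "uniform_on e n I M \<Phi> \<longleftrightarrow> (\<forall>p\<in>I. \<forall>w w'. incr (M p) n w \<longrightarrow> incr (M p) n w' \<longrightarrow>
    \<Phi> p (\<lambda>i. e (w i)) = \<Phi> p (\<lambda>i. e (w' i)))"

text \<open>Predicates with different sets of at most \<open>k\<close> variables are encoded in one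
  colouring of \<open>k\<close>-sets: the colour of \<open>A\<close> tells which of them hold at the
  initial elements of \<open>A\<close>. To evaluate a predicate at a tuple, the tuple is padded with
  later vertices to a \<open>k\<close>-set. This takes \<open>n + k\<close> vertices, and
  \<open>p = 2\<close> provides \<open>n ^ 2\<close>.\<close>

lemma ramsey_predicates:
  assumes "0 < k"
  shows "\<exists>n0. \<forall>n\<ge>n0. \<forall>N\<ge>itexp k n. \<forall>(I :: 'p set) M \<Phi>. small_predicates k c I M \<Phi> \<longrightarrow>
    (\<exists>e. strict_mono e \<and> (\<forall>t<n. e t < N) \<and> uniform_on e n I M \<Phi>)"
proof -
  obtain n1 where n1: "\<forall>n\<ge>n1. \<forall>X (col :: nat set \<Rightarrow> 'p set) C. finite X \<and> itexp k n \<le> card X \<and>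
      finite C \<and> card C \<le> 2 ^ c \<and> (\<forall>A. col A \<in> C) \<longrightarrow>
    (\<exists>H\<subseteq>X. card H = n ^ 2 \<and> monochromatic k H col)"
    by (rule exE[OF ramsey_itexp[OF assms, where c="2 ^ c" and p=2]])
  show ?thesis
  proof (rule exI[of _ "n1 + k + 2"], intro allI impI)
    fix n N and I :: "'p set" and M :: "'p \<Rightarrow> nat set" and \<Phi> :: "'p \<Rightarrow> (nat \<Rightarrow> nat) \<Rightarrow> bool"
    assume n: "n1 + k + 2 \<le> n" and N: "itexp k n \<le> N" and "small_predicates k c I M \<Phi>"
    then have I: "finite I" "card I \<le> c"
      and MP: "\<forall>p\<in>I. finite (M p) \<and> card (M p) \<le> k \<and> depends (M p) (\<Phi> p)"
      by (simp_all add: small_predicates_def)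
    \<comment> \<open>\<open>w\<close> places the variables of \<open>p\<close> onto the first
      elements of \<open>A\<close>; by \<open>initial_embedding_unique\<close> it is determined on
      \<open>M p\<close>.\<close>
    define ini where "ini p A w \<longleftrightarrow> (\<exists>l. incr (M p) l w) \<and> w ` M p \<subseteq> A \<and> (\<forall>a\<in>A - w ` M p. \<forall>i\<in>M p. w i < a)" for p A w
    define col where "col A = {p\<in>I. \<exists>w. ini p A w \<and> \<Phi> p w}" for A
    have "card (Pow I) \<le> 2 ^ c" using I by (simp add: card_Pow)
    then have "\<exists>H\<subseteq>{..<N}. card H = n ^ 2 \<and>
        monochromatic k H col"
      using n N I by (intro n1[rule_format, of n "{..<N}" "Pow I" col]) (auto simp: col_def)
    then obtain H where H: "H \<subseteq> {..<N}" "card H = n ^ 2"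
      "\<And>A B. \<lbrakk>A \<subseteq> H; B \<subseteq> H; card A = k; card B = k\<rbrakk> \<Longrightarrow> col A = col B"
      by auto
    have nk: "n + k \<le> n ^ 2"
    proof -
      have "n + k \<le> 2 * n" using n by simp
      also have "\<dots> \<le> n * n" using n by (intro mult_right_mono) auto
      finally show ?thesis by (simp add: power2_eq_square)
    qed
    have "finite H" using H(1) finite_subset by blast
    then obtain e where e: "strict_mono_on {..<n ^ 2} e" "\<And>i. i < n ^ 2 \<Longrightarrow> e i \<in> H"
      using finite_enumerate[of H] H(2) by auto
    have emono: "e i < e l" if "i < l" "l < n ^ 2" for i l
      using strict_mono_onD[OF e(1), of i l] that by auto
    have color: "\<Phi> p (\<lambda>i. e (w i)) \<longleftrightarrow> p \<in> col A"
      if p: "p \<in> I" and w: "incr (M p) n w" and A: "A = e ` (w ` M p \<union> {n..<n + (k - card (M p))})" for p w A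
    proof -
      have winc: "\<And>i. i \<in> M p \<Longrightarrow> w i < n" "\<And>i l. i \<in> M p \<Longrightarrow> l \<in> M p \<Longrightarrow> i < l \<Longrightarrow> w i < w l"
        using w by (auto simp: incr_def)
      have "incr (M p) (e n) (\<lambda>i. e (w i))"
        unfolding incr_def
      proof (intro conjI ballI impI)
        fix i assume "i \<in> M p"
        then show "e (w i) < e n" using winc(1) nk assms by (intro emono) auto
      next
        fix i l assume "i \<in> M p" "l \<in> M p" "i < l"
        moreover have "w l < n ^ 2" using winc(1)[OF \<open>l \<in> M p\<close>] nk by linarith
        ultimately show "e (w i) < e (w l)" using winc(2) by (intro emono) auto
      qed
      moreover have "\<forall>a\<in>A - (\<lambda>i. e (w i)) ` M p. \<forall>i\<in>M p. e (w i) < a"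
      proof (intro ballI)
        fix a i assume a: "a \<in> A - (\<lambda>i. e (w i)) ` M p" and i: "i \<in> M p"
        then obtain t where t: "t \<in> {n..<n + (k - card (M p))}" "a = e t" unfolding A by auto
        then show "e (w i) < a" using winc(1)[OF i] nk by (auto intro!: emono)
      qed
      ultimately have ini1: "ini p A (\<lambda>i. e (w i))" unfolding ini_def A by auto
      have "\<Phi> p u = \<Phi> p (\<lambda>i. e (w i))" if "ini p A u" for u
      proof (rule dependsD[of "M p" "\<Phi> p" u "\<lambda>i. e (w i)"])
        show "depends (M p) (\<Phi> p)" using MP p by blast
        fix i assume i: "i \<in> M p"
        obtain l where u: "incr (M p) l u" "u ` M p \<subseteq> A" "\<forall>a\<in>A - u ` M p. \<forall>i\<in>M p. u i < a"
          using \<open>ini p A u\<close> unfolding ini_def by (elim conjE exE)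
        obtain l' where v: "incr (M p) l' (\<lambda>i. e (w i))" "(\<lambda>i. e (w i)) ` M p \<subseteq> A"
          "\<forall>a\<in>A - (\<lambda>i. e (w i)) ` M p. \<forall>i\<in>M p. e (w i) < a"
          using ini1 unfolding ini_def by (elim conjE exE)
        show "u i = e (w i)"
          by (rule initial_embedding_unique[OF u(1) v(1) u(2) v(2) u(3)[rule_format] v(3)[rule_format] i])
      qed
      then show ?thesis using p ini1 unfolding col_def by blast
    qed
    have cardA: "card A = k \<and> A \<subseteq> H"
      if p: "p \<in> I" and w: "incr (M p) n w" and A: "A = e ` (w ` M p \<union> {n..<n + (k - card (M p))})" for p w A
    proof -
      have fM: "finite (M p)" "card (M p) \<le> k" using MP p by auto
      let ?B = "w ` M p \<union> {n..<n + (k - card (M p))}"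
      have wn: "w ` M p \<subseteq> {..<n}" using w by (auto simp: incr_def)
      have "inj_on w (M p)" using w unfolding incr_def inj_on_def by (metis linorder_neqE_nat order_less_irrefl)
      then have "card (w ` M p) = card (M p)" by (rule card_image)
      moreover have "card ?B = card (w ` M p) + card {n..<n + (k - card (M p))}"
        using fM wn by (intro card_Un_disjoint) auto
      ultimately have cB: "card ?B = k" using fM by simp
      have B: "?B \<subseteq> {..<n ^ 2}" using wn nk by auto
      have "inj_on e ?B" using strict_mono_on_imp_inj_on[OF e(1)] B inj_on_subset by blast
      then show ?thesis using cB e(2) B unfolding A by (auto simp: card_image)
    qed
    have eN: "e t < N" if "t < n" for t
    proof -
      have "e t \<in> H" by (rule e(2)) (use that nk in linarith)
      then show ?thesis using H(1) by blast
    qed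
    \<comment> \<open>The continuation by \<open>N + t\<close> makes the map strictly increasing on
      all of \<open>nat\<close>.\<close>
    define e' where "e' t = (if t < n then e t else N + t)" for t
    have "e' s < e' t" if "s < t" for s t
      using emono[of s t] eN[of s] that nk by (auto simp: e'_def)
    then have sm: "strict_mono e'" by (rule strict_monoI)
    have eq: "\<Phi> p (\<lambda>i. e' (w i)) = \<Phi> p (\<lambda>i. e (w i))" if "p \<in> I" "incr (M p) n w" for p w
      by (rule dependsD[of "M p" "\<Phi> p"]) (use MP that in \<open>auto simp: e'_def incr_def\<close>)
    have "uniform_on e' n I M \<Phi>"
      unfolding uniform_on_def
    proof (intro ballI allI impI)
      fix p w w' assume p: "p \<in> I" and w: "incr (M p) n w" "incr (M p) n w'"
      note c = cardA[OF p w(1) refl] cardA[OF p w(2) refl]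
      show "\<Phi> p (\<lambda>i. e' (w i)) = \<Phi> p (\<lambda>i. e' (w' i))"
        unfolding eq[OF p w(1)] eq[OF p w(2)] color[OF p w(1) refl] color[OF p w(2) refl]
        using H(3)[OF conjunct2[OF c(1)] conjunct2[OF c(2)] conjunct1[OF c(1)] conjunct1[OF c(2)]] by simp
    qed
    then show "\<exists>e. strict_mono e \<and> (\<forall>t<n. e t < N) \<and> uniform_on e n I M \<Phi>"
      using sm eN by (intro exI[of _ e']) (simp add: e'_def)
  qed
qed

section \<open>Reduction to lacunary sums\<close>

lemma incr_comp:
  assumes "strict_mono e" "\<And>t. t < n \<Longrightarrow> e t < N" "incr J n y"
  shows "incr J N (\<lambda>i. e (y i))"
  using assms unfolding incr_def by (auto simp: strict_mono_less)

lemma mix_comp: "mix J (\<lambda>x. g (\<lambda>i. e (x i))) a b = mix J g (\<lambda>i. e (a i)) (\<lambda>i. e (b i))"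
  unfolding mix_def by (intro sum.cong refl arg_cong2[where f="(*)"] arg_cong[where f=g]) auto

text \<open>The points \<open>a k\<close>, \<open>b k\<close>, \<open>c\<close> of an interleaved configuration are read off a single
  increasing tuple: \<open>a k\<close> has label \<open>3 * k\<close>, \<open>b k\<close> has label \<open>3 * k + 1\<close>, and the third point of
  the coordinate \<open>i\<close> has label \<open>3 * i + 2\<close>.\<close>

definition labels :: "nat set \<Rightarrow> nat set" where
  "labels J = (\<lambda>k. 3 * k) ` J \<union> (\<lambda>k. 3 * k + 1) ` J"

definition join_labels :: "(nat \<Rightarrow> nat) \<Rightarrow> (nat \<Rightarrow> nat) \<Rightarrow> nat \<Rightarrow> nat \<Rightarrow> nat" where
  "join_labels a b c t = (if t mod 3 = 0 then a (t div 3) else if t mod 3 = 1 then b (t div 3) else c)"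

lemma join_labels_simps [simp]:
  "join_labels a b c (3 * k) = a k" "join_labels a b c (Suc (3 * k)) = b k"
  "join_labels a b c (Suc (Suc (3 * k))) = c"
proof -
  have "(3 * k) mod 3 = 0" "Suc (3 * k) mod 3 = 1" "Suc (Suc (3 * k)) mod 3 = 2"
    "(3 * k) div 3 = k" "Suc (3 * k) div 3 = k" by presburger+
  then show "join_labels a b c (3 * k) = a k" "join_labels a b c (Suc (3 * k)) = b k"
    "join_labels a b c (Suc (Suc (3 * k))) = c" by (simp_all add: join_labels_def)
qed

lemma incr_join_labels:
  assumes "interleaved J n a b"
  shows "incr (labels J) n (join_labels a b c)"
proof -
  have lt: "a i < b i" "b i < n" "a i < n" if "i \<in> J" for i
    using assms that unfolding interleaved_def by force+
  have bl: "b i < a k" if "i \<in> J" "k \<in> J" "i < k" for i k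
    using assms that unfolding interleaved_def by blast
  have lt': "b i < a k" "a i < a k" "b i < b k" "a i < b k" if "i \<in> J" "k \<in> J" "i < k" for i k
    using bl[OF that] lt(1)[OF that(1)] lt(1)[OF that(2)] by linarith+
  have "join_labels a b c s < join_labels a b c t" if st: "s \<in> labels J" "t \<in> labels J" "s < t" for s t
  proof -
    obtain i where i: "i \<in> J" "s = 3 * i \<or> s = Suc (3 * i)" using st(1) by (auto simp: labels_def)
    obtain k where k: "k \<in> J" "t = 3 * k \<or> t = Suc (3 * k)" using st(2) by (auto simp: labels_def)
    have "i < k \<or> i = k \<and> s = 3 * i \<and> t = Suc (3 * k)" using i(2) k(2) st(3) by presburger
    then show ?thesis using i k lt lt' by auto
  qed
  moreover have "join_labels a b c s < n" if "s \<in> labels J" for s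
    using that lt by (auto simp: labels_def)
  ultimately show ?thesis by (simp add: incr_def)
qed

lemma incr_join_labels3:
  assumes "interleaved J n a (b(i:=c))" "i \<in> J" "a i < b i" "b i < c"
  shows "incr (insert (3 * i + 2) (labels J)) n (join_labels a b c)"
proof -
  have ab: "interleaved J n a b"
    unfolding interleaved_def
  proof (intro ballI conjI impI)
    fix k assume k: "k \<in> J"
    have "a k < (b(i:=c)) k" "(b(i:=c)) k < n" using assms(1) k unfolding interleaved_def by blast+
    then show "a k < b k" "b k < n" using assms(3,4) by (cases "k = i"; simp)+
    fix l assume "l \<in> J" "k < l"
    then have "(b(i:=c)) k < a l" using assms(1) k unfolding interleaved_def by blast
    then show "b k < a l" using assms(4) by (cases "k = i") auto
  qed
  have inc: "incr (labels J) n (join_labels a b c)" by (rule incr_join_labels[OF ab])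
  have c: "c < n" "\<And>k. k \<in> J \<Longrightarrow> i < k \<Longrightarrow> c < a k"
    using assms(1,2) unfolding interleaved_def by (metis fun_upd_same)+
  have up: "c < join_labels a b c t" if t: "t \<in> labels J" "3 * i + 2 < t" for t
  proof -
    obtain k where k: "k \<in> J" "t = 3 * k \<or> t = Suc (3 * k)" using t(1) by (auto simp: labels_def)
    then have "i < k" using t(2) by presburger
    then have "c < a k" "a k < b k" using c(2) k(1) ab by (auto simp: interleaved_def)
    then show ?thesis using k(2) by auto
  qed
  have down: "join_labels a b c t < c" if t: "t \<in> labels J" "t < 3 * i + 2" for t
  proof -
    obtain k where k: "k \<in> J" "t = 3 * k \<or> t = Suc (3 * k)" using t(1) by (auto simp: labels_def)
    then have "k \<le> i" using t(2) by presburger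
    have "a k < b k" using ab k(1) by (auto simp: interleaved_def)
    moreover have "b k < c"
    proof (cases "k = i")
      case False
      then have "b k < a i" using \<open>k \<le> i\<close> ab k(1) assms(2) by (auto simp: interleaved_def)
      then show ?thesis using assms(3,4) by linarith
    qed (use assms(4) in simp)
    ultimately show ?thesis using k(2) by auto
  qed
  have j3: "join_labels a b c (3 * i + 2) = c" by simp
  show ?thesis
    unfolding incr_def
  proof (intro conjI ballI impI)
    fix s assume "s \<in> insert (3 * i + 2) (labels J)"
    then show "join_labels a b c s < n" using inc c(1) j3 by (auto simp: incr_def)
  next
    fix s t assume "s \<in> insert (3 * i + 2) (labels J)" "t \<in> insert (3 * i + 2) (labels J)" "s < t"
    then consider "s = 3 * i + 2" "t \<in> labels J" | "s \<in> labels J" "t = 3 * i + 2" | "s \<in> labels J" "t \<in> labels J"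
      by blast
    then show "join_labels a b c s < join_labels a b c t"
      by cases (use up down inc \<open>s < t\<close> in \<open>auto simp: incr_def\<close>)
  qed
qed

lemma card_labels: "finite J \<Longrightarrow> card (labels J) \<le> 2 * card J"
  unfolding labels_def
  by (rule order_trans[OF card_Un_le]) (simp add: card_image_le add_mono mult_2)

text \<open>The index \<open>q\<close> numbers the predicates of one term: 0 and 1 together
  determine the sign, and \<open>i + 2\<close> compares two adjacent boxes in coordinate
  \<open>i\<close>.\<close>

definition mix_predicate :: "nat set \<Rightarrow> ((nat \<Rightarrow> nat) \<Rightarrow> real) \<Rightarrow> nat \<Rightarrow> (nat \<Rightarrow> nat) \<Rightarrow> bool" where
  "mix_predicate J g q w = (let a = (\<lambda>k. w (3 * k)); b = (\<lambda>k. w (3 * k + 1)) in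
    if q = 0 then 0 < mix J g a b
    else if q = 1 then mix J g a b < 0
    else \<bar>mix J g a b\<bar> \<le> \<bar>mix J g (a(q - 2 := b (q - 2))) (b(q - 2 := w (3 * (q - 2) + 2)))\<bar>)"

definition mix_labels :: "nat set \<Rightarrow> nat \<Rightarrow> nat set" where
  "mix_labels J q = (if q < 2 then labels J else insert (3 * (q - 2) + 2) (labels J))"

lemma depends_mix_predicate:
  assumes "depends J g" "q < 2 \<or> q - 2 \<in> J"
  shows "depends (mix_labels J q) (mix_predicate J g q)"
  unfolding depends_def
proof (intro allI impI)
  fix w w' :: "nat \<Rightarrow> nat" assume eq: "\<forall>t\<in>mix_labels J q. w t = w' t"
  then have eq1: "w (3 * k) = w' (3 * k)" "w (3 * k + 1) = w' (3 * k + 1)" if "k \<in> J" for k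
    using that by (auto simp: mix_labels_def labels_def split: if_splits)
  have 1: "mix J g (\<lambda>k. w (3 * k)) (\<lambda>k. w (3 * k + 1)) = mix J g (\<lambda>k. w' (3 * k)) (\<lambda>k. w' (3 * k + 1))"
    by (rule mix_cong[OF assms(1)]) (rule eq1, assumption)+
  show "mix_predicate J g q w = mix_predicate J g q w'"
  proof (cases "q < 2")
    case True
    then show ?thesis using 1 by (auto simp: mix_predicate_def)
  next
    case False
    then have q: "q - 2 \<in> J" "w (3 * (q - 2) + 2) = w' (3 * (q - 2) + 2)"
      using assms(2) eq by (auto simp: mix_labels_def)
    have "mix J g ((\<lambda>k. w (3 * k))(q - 2 := w (3 * (q - 2) + 1))) ((\<lambda>k. w (3 * k + 1))(q - 2 := w (3 * (q - 2) + 2)))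
      = mix J g ((\<lambda>k. w' (3 * k))(q - 2 := w' (3 * (q - 2) + 1))) ((\<lambda>k. w' (3 * k + 1))(q - 2 := w' (3 * (q - 2) + 2)))"
      by (rule mix_cong[OF assms(1)]) (use eq1 q in auto)
    then show ?thesis using 1 False by (simp add: mix_predicate_def Let_def)
  qed
qed

text \<open>One comparison for each coordinate is enough: where growth fails, the linear order of
  the reals gives decay.\<close>

lemma oriented_of_predicates:
  assumes hom: "\<And>q w w'. \<lbrakk>q < 2 \<or> q - 2 \<in> J; incr (mix_labels J q) n w; incr (mix_labels J q) n w'\<rbrakk> \<Longrightarrow>
      mix_predicate J g q (\<lambda>i. e (w i)) = mix_predicate J g q (\<lambda>i. e (w' i))"
  shows "\<exists>up sg. oriented J n (\<lambda>x. g (\<lambda>i. e (x i))) up sg"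
proof -
  let ?g = "\<lambda>x. g (\<lambda>i. e (x i))"
  have q0: "mix_predicate J g 0 (\<lambda>t. e (join_labels a b c t)) \<longleftrightarrow> 0 < mix J ?g a b" for a b c
    by (simp add: mix_predicate_def mix_comp)
  have q1: "mix_predicate J g 1 (\<lambda>t. e (join_labels a b c t)) \<longleftrightarrow> mix J ?g a b < 0" for a b c
    by (simp add: mix_predicate_def mix_comp)
  have q2: "mix_predicate J g (i + 2) (\<lambda>t. e (join_labels a b c t)) \<longleftrightarrow>
      mix_grows J ?g i a b c" for a b c i
    by (simp add: mix_predicate_def mix_comp fun_upd_def if_distrib[of e] cong: if_cong)
  have sgn_eq: "sgn (mix J ?g a b) = sgn (mix J ?g a' b')" if "interleaved J n a b" "interleaved J n a' b'" for a b a' b'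
    using hom[of 0 "join_labels a b 0" "join_labels a' b' 0"] hom[of 1 "join_labels a b 0" "join_labels a' b' 0"]
      incr_join_labels[OF that(1), of 0] incr_join_labels[OF that(2), of 0]
    unfolding q0 q1 by (auto simp: mix_labels_def sgn_real_def)
  obtain sg where sg: "\<And>a b. interleaved J n a b \<Longrightarrow> sgn (mix J ?g a b) = sg"
  proof (cases "\<exists>a b. interleaved J n a b")
    case True
    then obtain a b where "interleaved J n a b" by blast
    then show ?thesis using that sgn_eq by blast
  qed blast
  \<comment> \<open>Growth in a single configuration fixes the direction, and uniformity carries it
    to all configurations.\<close>
  define up where "up i \<longleftrightarrow> (\<exists>a b c. interleaved J n a (b(i:=c)) \<and> a i < b i \<and> b i < c \<and>
    mix_grows J ?g i a b c)" for i
  have "if up i then mix_grows J ?g i a b c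
      else mix_decays J ?g i a b c"
    if i: "i \<in> J" and abc: "interleaved J n a (b(i:=c))" "a i < b i" "b i < c" for i a b c
  proof (cases "up i")
    case True
    then obtain a' b' c' where abc': "interleaved J n a' (b'(i:=c'))" "a' i < b' i" "b' i < c'"
      "\<bar>mix J ?g a' b'\<bar> \<le> \<bar>mix J ?g (a'(i := b' i)) (b'(i := c'))\<bar>" unfolding up_def by blast
    have "mix_predicate J g (i + 2) (\<lambda>t. e (join_labels a b c t)) = mix_predicate J g (i + 2) (\<lambda>t. e (join_labels a' b' c' t))"
      using incr_join_labels3[OF abc(1) i abc(2,3)] incr_join_labels3[OF abc'(1) i abc'(2,3)] i
      by (intro hom) (auto simp: mix_labels_def)
    then show ?thesis using True abc'(4) unfolding q2 by simp
  next
    case False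
    then have "\<not> mix_grows J ?g i a b c" unfolding up_def using abc by blast
    then show ?thesis using False by simp
  qed
  then show ?thesis unfolding oriented_def using sg by (intro exI[of _ up] exI[of _ sg]) blast
qed

section \<open>Descending rounds over the index sets\<close>

definition small_sets :: "nat \<Rightarrow> nat \<Rightarrow> nat set set" where
  "small_sets r D = {J. J \<subseteq> {..<r} \<and> card J \<le> D}"

lemma small_sets:
  "finite (small_sets r D)" "J \<in> small_sets r D \<Longrightarrow> finite J"
  "J \<in> small_sets r D \<Longrightarrow> B \<subseteq> J \<Longrightarrow> B \<in> small_sets r D" "{} \<in> small_sets r D"
  "\<Union> (small_sets r D) \<subseteq> {..<r}"
proof -
  show "finite (small_sets r D)" by (rule finite_subset[of _ "Pow {..<r}"]) (auto simp: small_sets_def)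
  show "J \<in> small_sets r D \<Longrightarrow> finite J" by (auto simp: small_sets_def intro: finite_subset)
  then show "J \<in> small_sets r D \<Longrightarrow> B \<subseteq> J \<Longrightarrow> B \<in> small_sets r D"
    using card_mono[of J B] by (auto simp: small_sets_def)
qed (auto simp: small_sets_def)

abbreviation dependent_family :: "nat \<Rightarrow> nat \<Rightarrow> nat \<Rightarrow> (nat \<Rightarrow> nat set \<Rightarrow> (nat \<Rightarrow> nat) \<Rightarrow> real) \<Rightarrow> bool" where
  "dependent_family m r D G \<equiv> \<forall>l<m. \<forall>J\<in>small_sets r D. depends J (G l J)"

abbreviation lacunary_from where
  "lacunary_from K m r D n j G \<equiv> \<forall>l<m. \<forall>J\<in>small_sets r D. j \<le> card J \<longrightarrow> lacunary K J n (G l J)"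

abbreviation lacunary_above where
  "lacunary_above K m r D n j G \<equiv> \<forall>l<m. \<forall>J\<in>small_sets r D. j < card J \<longrightarrow> lacunary K J n (G l J)"

text \<open>Along \<open>e\<close> only the sums over \<open>F\<close> are preserved, not the single
  terms, because remainders move from one term to another.\<close>

definition refines :: "nat \<Rightarrow> nat set set \<Rightarrow> nat \<Rightarrow> nat \<Rightarrow> (nat \<Rightarrow> nat) \<Rightarrow>
    (nat \<Rightarrow> nat set \<Rightarrow> (nat \<Rightarrow> nat) \<Rightarrow> real) \<Rightarrow> (nat \<Rightarrow> nat set \<Rightarrow> (nat \<Rightarrow> nat) \<Rightarrow> real) \<Rightarrow> bool" where
  "refines m F N n e G G' \<longleftrightarrow> strict_mono e \<and> (\<forall>t<n. e t < N) \<and>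
    (\<forall>l<m. \<forall>J\<in>F. depends J (G' l J)) \<and>
    (\<forall>l<m. \<forall>y. incr (\<Union>F) n y \<longrightarrow> (\<Sum>J\<in>F. G l J (\<lambda>i. e (y i))) = (\<Sum>J\<in>F. G' l J y))"

lemma refines_trans:
  assumes "refines m F N n e G G'" "refines m F n k e' G' G''"
  shows "refines m F N k (\<lambda>t. e (e' t)) G G''"
  unfolding refines_def
proof (intro conjI allI impI ballI)
  have e: "strict_mono e" "\<And>t. t < n \<Longrightarrow> e t < N" "strict_mono e'" "\<And>t. t < k \<Longrightarrow> e' t < n"
    using assms by (auto simp: refines_def)
  show "strict_mono (\<lambda>t. e (e' t))" using e by (simp add: strict_mono_def)
  show "e (e' t) < N" if "t < k" for t using e that by blast
  show "depends J (G'' l J)" if "l < m" "J \<in> F" for l J using assms(2) that by (simp add: refines_def)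
  fix l y assume l: "l < m" and y: "incr (\<Union>F) k y"
  have "incr (\<Union>F) n (\<lambda>i. e' (y i))" using incr_comp[OF e(3,4) y] .
  then have "(\<Sum>J\<in>F. G l J (\<lambda>i. e (e' (y i)))) = (\<Sum>J\<in>F. G' l J (\<lambda>i. e' (y i)))"
    using assms(1) l by (simp add: refines_def)
  also have "\<dots> = (\<Sum>J\<in>F. G'' l J y)" using assms(2) l y by (simp add: refines_def)
  finally show "(\<Sum>J\<in>F. G l J (\<lambda>i. e (e' (y i)))) = (\<Sum>J\<in>F. G'' l J y)" .
qed

lemma ex_thinning_factor:
  fixes K :: real
  obtains L :: nat where "K * 2 ^ j \<le> 2 ^ (L - 1)" "3 \<le> L"
proof -
  obtain t where "K * 2 ^ j < 2 ^ t" using real_arch_pow[of 2 "K * 2 ^ j"] by auto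
  also have "(2::real) ^ t \<le> 2 ^ (t + 3 - 1)" by (intro power_increasing) auto
  finally show ?thesis using that[of "t + 3"] by simp
qed

text \<open>The vertices are chosen once for all \<open>m\<close> polynomials, as \<open>e0\<close>
  and \<open>L\<close> do not depend on \<open>l\<close>; only the new terms are constructed for
  each \<open>l\<close> separately.\<close>

lemma refines_lacunary_round:
  assumes j: "j \<le> D"
    and e0: "strict_mono e0" "\<And>t. t < n' \<Longrightarrow> e0 t < N"
    and dep: "\<And>l J. l < m \<Longrightarrow> J \<in> small_sets r D \<Longrightarrow> depends J (G l J)"
    and lac: "\<And>l J. l < m \<Longrightarrow> J \<in> small_sets r D \<Longrightarrow> j < card J \<Longrightarrow> lacunary K J N (G l J)"
    and ori: "\<And>l J. l < m \<Longrightarrow> J \<in> small_sets r D \<Longrightarrow> card J = j \<Longrightarrow>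
      \<exists>up sg. oriented J n' (\<lambda>x. G l J (\<lambda>i. e0 (x i))) up sg"
    and L: "K * 2 ^ j \<le> 2 ^ (L - 1)" "3 \<le> L" "L * n < n' - 1"
  shows "\<exists>G'. refines m (small_sets r D) N n (\<lambda>t. e0 (L * Suc t)) G G' \<and> lacunary_from K m r D n j G'"
proof -
  let ?F = "small_sets r D"
  have "\<exists>G'. (\<forall>J\<in>?F. depends J (G' J)) \<and> (\<forall>J\<in>?F. j \<le> card J \<longrightarrow> lacunary K J n (G' J)) \<and>
    (\<forall>y. incr (\<Union>?F) n y \<longrightarrow> (\<Sum>J\<in>?F. G l J (\<lambda>i. e0 (L * Suc (y i)))) = (\<Sum>J\<in>?F. G' J y))" if l: "l < m" for l
  proof (rule lacunary_round[of ?F "\<lambda>J x. G l J (\<lambda>i. e0 (x i))" j K n' L n, OF small_sets(1,2,3) _ _ _ L])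
    fix J assume J: "J \<in> ?F"
    show "depends J (\<lambda>x. G l J (\<lambda>i. e0 (x i)))" using dep[OF l J] by (simp add: depends_def)
    show "lacunary K J n' (\<lambda>x. G l J (\<lambda>i. e0 (x i)))" if "j < card J"
      by (rule lacunary_thin[OF lac[OF l J that] _ e0(1)]) (rule incr_comp[OF e0])
    show "\<exists>up sg. oriented J n' (\<lambda>x. G l J (\<lambda>i. e0 (x i))) up sg" if "card J = j" by (rule ori[OF l J that])
  qed blast+
  then have "\<forall>l\<in>{..<m}. \<exists>G'. (\<forall>J\<in>?F. depends J (G' J)) \<and> (\<forall>J\<in>?F. j \<le> card J \<longrightarrow> lacunary K J n (G' J)) \<and>
    (\<forall>y. incr (\<Union>?F) n y \<longrightarrow> (\<Sum>J\<in>?F. G l J (\<lambda>i. e0 (L * Suc (y i)))) = (\<Sum>J\<in>?F. G' J y))" by simp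
  from bchoice[OF this] obtain G' where G': "\<forall>l\<in>{..<m}. (\<forall>J\<in>?F. depends J (G' l J)) \<and> (\<forall>J\<in>?F. j \<le> card J \<longrightarrow> lacunary K J n (G' l J)) \<and>
    (\<forall>y. incr (\<Union>?F) n y \<longrightarrow> (\<Sum>J\<in>?F. G l J (\<lambda>i. e0 (L * Suc (y i)))) = (\<Sum>J\<in>?F. G' l J y))" ..
  have "e0 (L * Suc t) < N" if "t < n" for t
  proof -
    have "L * Suc t \<le> L * n" using that by (intro mult_le_mono2) simp
    then show ?thesis using e0(2) L(3) by simp
  qed
  moreover have "strict_mono (\<lambda>t. e0 (L * Suc t))" using e0(1) L(2) by (auto simp: strict_mono_def)
  ultimately have "refines m ?F N n (\<lambda>t. e0 (L * Suc t)) G G'"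
    unfolding refines_def using G' by simp
  then show ?thesis using G' by (intro exI[of _ G']) simp
qed

text \<open>Of the \<open>2 * D + 2\<close> exponentials, \<open>2 * j + 1\<close> make the sign and
  growth predicates uniform. One more provides \<open>2 ^ n\<close> vertices, so that
  \<open>n\<close> survive the thinning by the constant \<open>L\<close>.\<close>

lemma round_exists:
  assumes j: "j \<le> D"
  shows "\<exists>n0. \<forall>n\<ge>n0. \<forall>N\<ge>itexp (2 * D + 2) n. \<forall>G.
    dependent_family m r D G \<and> lacunary_above K m r D N j G \<longrightarrow>
    (\<exists>e G'. refines m (small_sets r D) N n e G G' \<and> lacunary_from K m r D n j G')"
proof -
  let ?F = "small_sets r D"
  obtain L where L: "K * 2 ^ j \<le> 2 ^ (L - 1)" "3 \<le> L" by (rule ex_thinning_factor)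
  define I where "I = {(l, J, q). l < m \<and> J \<in> ?F \<and> card J = j \<and> (q < 2 \<or> q - 2 \<in> J)}"
  \<comment> \<open>Bounding \<open>q\<close> by \<open>r + 2\<close> bounds the number of
    predicates by a constant that does not depend on \<open>n\<close>.\<close>
  have sub: "I \<subseteq> {..<m} \<times> ?F \<times> {..<r + 2}" by (auto simp: I_def small_sets_def)
  have fin: "finite ({..<m} \<times> ?F \<times> {..<r + 2})" using small_sets(1) by simp
  obtain n1 where n1: "\<forall>n\<ge>n1. \<forall>N\<ge>itexp (2 * j + 1) n. \<forall>(I :: (nat \<times> nat set \<times> nat) set) M \<Phi>.
      small_predicates (2 * j + 1) (card ({..<m} \<times> ?F \<times> {..<r + 2})) I M \<Phi> \<longrightarrow>
    (\<exists>e. strict_mono e \<and> (\<forall>t<n. e t < N) \<and> uniform_on e n I M \<Phi>)"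
    by (rule exE[OF ramsey_predicates[OF zero_less_Suc[of "2 * j", unfolded Suc_eq_plus1],
        where c="card ({..<m} \<times> ?F \<times> {..<r + 2})"]])
  obtain n2 where n2: "\<And>n. n2 \<le> n \<Longrightarrow> (L + 2) * n ^ 1 \<le> 2 ^ n" using cmult_power_le_exp[of "L + 2" 1] by blast
  show ?thesis
  proof (rule exI[of _ "n1 + n2 + 1"], intro allI impI, elim conjE)
    fix n N and G :: "nat \<Rightarrow> nat set \<Rightarrow> (nat \<Rightarrow> nat) \<Rightarrow> real"
    assume n: "n1 + n2 + 1 \<le> n" and N: "itexp (2 * D + 2) n \<le> N"
      and dep: "dependent_family m r D G"
      and lac: "lacunary_above K m r D N j G"
    define n' :: nat where "n' = 2 ^ n"
    have Ln: "L * n < n' - 1"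
    proof -
      have "L * n + 2 * n \<le> n'" using n2[of n] n by (simp add: n'_def algebra_simps)
      then show ?thesis using n by simp
    qed
    have "itexp (2 * j + 1) n' = itexp (2 * j + 2) n"
      using itexp_add[of "2 * j + 1" 1 n] by (simp add: n'_def)
    also have "\<dots> \<le> itexp (2 * D + 2) n"
      using itexp_le_add[of "2 * j + 2" n "2 * (D - j)"] j by (simp add: algebra_simps)
    also have "\<dots> \<le> N" by (rule N)
    finally have N': "itexp (2 * j + 1) n' \<le> N" .
    define M where "M = (\<lambda>(l :: nat, J, q). mix_labels J q)"
    define \<Phi> where "\<Phi> = (\<lambda>(l, J, q). mix_predicate J (G l J) q)"
    have "n1 \<le> n'" using n less_exp[of n] unfolding n'_def by linarith
    moreover have "small_predicates (2 * j + 1) (card ({..<m} \<times> ?F \<times> {..<r + 2})) I M \<Phi>"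
      unfolding small_predicates_def
    proof (rule conjI[OF _ conjI[OF _ ballI]])
      show "finite I" by (rule finite_subset[OF sub fin])
      show "card I \<le> card ({..<m} \<times> ?F \<times> {..<r + 2})" by (rule card_mono[OF fin sub])
      fix p assume "p \<in> I"
      then obtain l J q where p: "p = (l, J, q)" "l < m" "J \<in> ?F" "card J = j" "q < 2 \<or> q - 2 \<in> J"
        by (auto simp: I_def)
      have finJ: "finite J" using small_sets(2) p(3) by blast
      then have "finite (labels J)" by (simp add: labels_def)
      moreover have "card (labels J) \<le> 2 * j" using card_labels[OF finJ] p(4) by simp
      moreover have "depends (mix_labels J q) (mix_predicate J (G l J) q)"
        by (rule depends_mix_predicate) (use dep p in auto)
      ultimately show "finite (M p) \<and> card (M p) \<le> 2 * j + 1 \<and> depends (M p) (\<Phi> p)"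
        unfolding M_def \<Phi>_def p(1)
        using card_insert_le_m1[of "2 * j + 1" "labels J" "3 * (q - 2) + 2"] by (simp add: mix_labels_def)
    qed
    ultimately obtain e0 where e0: "strict_mono e0" "\<forall>t<n'. e0 t < N" and hom: "uniform_on e0 n' I M \<Phi>"
      using n1[rule_format, OF _ N'] by blast
    have "\<exists>G'. refines m ?F N n (\<lambda>t. e0 (L * Suc t)) G G' \<and> lacunary_from K m r D n j G'"
    proof (rule refines_lacunary_round[OF j e0(1) _ _ _ _ L Ln])
      fix l J assume l: "l < m" and J: "J \<in> ?F"
      show "depends J (G l J)" using dep l J by blast
      show "lacunary K J N (G l J)" if "j < card J" using lac l J that by blast
      show "\<exists>up sg. oriented J n' (\<lambda>x. G l J (\<lambda>i. e0 (x i))) up sg" if cJ: "card J = j"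
      proof (rule oriented_of_predicates)
        fix q w w' assume q: "q < 2 \<or> q - 2 \<in> J" and w: "incr (mix_labels J q) n' w" "incr (mix_labels J q) n' w'"
        have "(l, J, q) \<in> I" using l J cJ q by (simp add: I_def)
        from hom[unfolded uniform_on_def, rule_format, OF this, of w w'] w
        show "mix_predicate J (G l J) q (\<lambda>i. e0 (w i)) = mix_predicate J (G l J) q (\<lambda>i. e0 (w' i))"
          by (simp add: M_def \<Phi>_def)
      qed
    qed (use e0(2) in blast)
    then show "\<exists>e G'. refines m ?F N n e G G' \<and> lacunary_from K m r D n j G'"
      by (rule exI[of _ "\<lambda>t. e0 (L * Suc t)"])
  qed
qed

text \<open>Round by round, the terms with \<open>D\<close>, \<open>D - 1\<close>, ... variables
  become lacunary. The start is free, since no index set has more than \<open>D\<close>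
  elements.\<close>

lemma rounds_exist:
  assumes "t \<le> D"
  shows "\<exists>n0. \<forall>n\<ge>n0. \<forall>N\<ge>itexp (t * (2 * D + 2)) n. \<forall>G.
    dependent_family m r D G \<longrightarrow>
    (\<exists>e G'. refines m (small_sets r D) N n e G G' \<and> lacunary_above K m r D n (D - t) G')"
  using assms
proof (induction t)
  case 0
  have "refines m (small_sets r D) N n (\<lambda>t. t) G G"
    if "n \<le> N" "dependent_family m r D G" for n N G
    using that by (auto simp: refines_def strict_mono_def)
  moreover have "\<not> D < card J" if "J \<in> small_sets r D" for J using that by (simp add: small_sets_def)
  ultimately show ?case by (intro exI[of _ 0]) (metis diff_zero itexp.simps(1) mult_0)
next
  case (Suc t)
  let ?F = "small_sets r D"
  from Suc obtain n1 where n1: "\<forall>n\<ge>n1. \<forall>N\<ge>itexp (t * (2 * D + 2)) n. \<forall>G.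
    dependent_family m r D G \<longrightarrow>
    (\<exists>e G'. refines m ?F N n e G G' \<and> lacunary_above K m r D n (D - t) G')" by auto
  obtain n2 where n2: "\<forall>n\<ge>n2. \<forall>N\<ge>itexp (2 * D + 2) n. \<forall>G.
    dependent_family m r D G \<and> lacunary_above K m r D N (D - t) G \<longrightarrow>
    (\<exists>e G'. refines m ?F N n e G G' \<and> lacunary_from K m r D n (D - t) G')"
    by (rule exE[OF round_exists[of "D - t" D m r K]]) simp
  show ?case
  proof (rule exI[of _ "n1 + n2"], intro allI impI)
    fix n N and G :: "nat \<Rightarrow> nat set \<Rightarrow> (nat \<Rightarrow> nat) \<Rightarrow> real"
    assume n: "n1 + n2 \<le> n" and N: "itexp (Suc t * (2 * D + 2)) n \<le> N"
      and dep: "dependent_family m r D G"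
    define n' where "n' = itexp (2 * D + 2) n"
    have "itexp (t * (2 * D + 2)) n' = itexp (Suc t * (2 * D + 2)) n"
      unfolding n'_def itexp_add[symmetric] by (simp add: algebra_simps)
    then have N': "itexp (t * (2 * D + 2)) n' \<le> N" using N by simp
    have "n1 \<le> n'" using n le_itexp[of n "2 * D + 2"] by (simp add: n'_def)
    from n1[rule_format, OF this N'] dep obtain e G' where e: "refines m ?F N n' e G G'"
      "lacunary_above K m r D n' (D - t) G'" by blast
    have dep': "dependent_family m r D G'" using e(1) by (simp add: refines_def)
    have "n2 \<le> n" using n by simp
    from n2[rule_format, OF this, of n' G'] dep' e(2) obtain e' G'' where e': "refines m ?F n' n e' G' G''"
      "lacunary_from K m r D n (D - t) G''" unfolding n'_def by blast
    have "lacunary_above K m r D n (D - Suc t) G''"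
      using e'(2) by (simp add: diff_Suc split: nat.splits)
    then show "\<exists>e G'. refines m ?F N n e G G' \<and>
      lacunary_above K m r D n (D - Suc t) G'"
      using refines_trans[OF e(1) e'(1)] by blast
  qed
qed

section \<open>Uniform signs of all polynomials\<close>

definition uniform_signs :: "nat \<Rightarrow> nat \<Rightarrow> nat \<Rightarrow> nat \<Rightarrow> nat \<Rightarrow> (nat \<Rightarrow> nat set \<Rightarrow> (nat \<Rightarrow> nat) \<Rightarrow> real) \<Rightarrow> bool" where
  "uniform_signs m r D N n G \<longleftrightarrow> (\<exists>e. strict_mono e \<and> (\<forall>t<n. e t < N) \<and>
    (\<forall>l<m. \<exists>sg. \<forall>y. incr {..<r} n y \<longrightarrow> sgn (\<Sum>J\<in>small_sets r D. G l J (\<lambda>i. e (y i))) = sg))"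

text \<open>The last step shared by the general and the linear case, which differ in how they reach
  lacunary terms and uniform comparisons. Three vertices are spent for each one kept, for the blocks
  of \<open>sgn_sum_lacunary\<close>.\<close>

lemma signs_of_refinement:
  assumes ref: "refines m (small_sets r D) N n' e0 G G'"
    and lac: "\<And>l J. l < m \<Longrightarrow> J \<in> small_sets r D \<Longrightarrow> J \<noteq> {} \<Longrightarrow> lacunary K J n' (G' l J)"
    and e1: "strict_mono e1" "\<And>t. t < n'' \<Longrightarrow> e1 t < n'"
    and hom: "\<And>l J J' x x'. \<lbrakk>l < m; J \<in> small_sets r D; J' \<in> small_sets r D; incr (J \<union> J') n'' x; incr (J \<union> J') n'' x';
        \<bar>G' l J (\<lambda>i. e1 (x i))\<bar> \<le> \<bar>G' l J' (\<lambda>i. e1 (x i))\<bar>\<rbrakk>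
      \<Longrightarrow> \<bar>G' l J (\<lambda>i. e1 (x' i))\<bar> \<le> \<bar>G' l J' (\<lambda>i. e1 (x' i))\<bar>"
    and K: "real (card (small_sets r D)) \<le> K" and n: "3 * n \<le> n''"
  shows "uniform_signs m r D N n G"
proof -
  let ?F = "small_sets r D"
  define e where "e t = e0 (e1 (3 * t + 1))" for t
  have e0: "strict_mono e0" "\<And>t. t < n' \<Longrightarrow> e0 t < N" and dep: "\<And>l J. l < m \<Longrightarrow> J \<in> ?F \<Longrightarrow> depends J (G' l J)"
    and eq: "\<And>l y. l < m \<Longrightarrow> incr (\<Union>?F) n' y \<Longrightarrow> (\<Sum>J\<in>?F. G l J (\<lambda>i. e0 (y i))) = (\<Sum>J\<in>?F. G' l J y)"
    using ref by (auto simp: refines_def)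
  have "strict_mono e" using e0(1) e1(1) by (simp add: e_def strict_mono_def)
  moreover have "e t < N" if "t < n" for t unfolding e_def using that n by (intro e0(2) e1(2)) simp
  moreover have "\<exists>sg. \<forall>y. incr {..<r} n y \<longrightarrow> sgn (\<Sum>J\<in>?F. G l J (\<lambda>i. e (y i))) = sg" if l: "l < m" for l
  proof -
    have "\<exists>sg. \<forall>y. incr (\<Union>?F) n y \<longrightarrow> sgn (\<Sum>J\<in>?F. G' l J (\<lambda>i. e1 (3 * y i + 1))) = sg"
    proof (rule sgn_sum_lacunary[of ?F "\<lambda>J x. G' l J (\<lambda>i. e1 (x i))", OF small_sets(1) _ _ _ _ K n])
      show "?F \<noteq> {}" using small_sets(4) by blast
      fix J assume J: "J \<in> ?F"
      show "depends J (\<lambda>x. G' l J (\<lambda>i. e1 (x i)))" using dep[OF l J] by (simp add: depends_def)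
      show "lacunary K J n'' (\<lambda>x. G' l J (\<lambda>i. e1 (x i)))" if "J \<noteq> {}"
        by (rule lacunary_thin[OF lac[OF l J that] _ e1(1)]) (rule incr_comp[OF e1])
    qed (rule hom[OF l])
    then obtain sg where sg: "\<And>y. incr (\<Union>?F) n y \<Longrightarrow> sgn (\<Sum>J\<in>?F. G' l J (\<lambda>i. e1 (3 * y i + 1))) = sg" by blast
    have "sgn (\<Sum>J\<in>?F. G l J (\<lambda>i. e (y i))) = sg" if y: "incr {..<r} n y" for y
    proof -
      have y': "incr (\<Union>?F) n y" by (rule incr_subset[OF y small_sets(5)])
      have "incr (\<Union>?F) n' (\<lambda>i. e1 (3 * y i + 1))"
      proof (rule incr_comp[OF e1])
        show "incr (\<Union>?F) n'' (\<lambda>i. 3 * y i + 1)"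
          by (rule incr_comp[OF _ _ y']) (use n in \<open>auto simp: strict_mono_def\<close>)
      qed
      then have "(\<Sum>J\<in>?F. G l J (\<lambda>i. e (y i))) = (\<Sum>J\<in>?F. G' l J (\<lambda>i. e1 (3 * y i + 1)))"
        using eq[OF l] by (simp add: e_def)
      then show ?thesis using sg[OF y'] by simp
    qed
    then show ?thesis by blast
  qed
  ultimately show ?thesis unfolding uniform_signs_def by blast
qed

text \<open>Two index sets together contain at most \<open>2 * D\<close> positions, so uniform
  comparisons cost \<open>2 * D\<close> exponentials; one more makes room for the blocks of
  three.\<close>

lemma signs_homogeneous:
  assumes "0 < D"
  shows "\<exists>n0. \<forall>n\<ge>n0. \<forall>N\<ge>itexp (D * (2 * D + 2) + (2 * D + 1)) n. \<forall>G.
    dependent_family m r D G \<longrightarrow> uniform_signs m r D N n G"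
proof -
  let ?F = "small_sets r D"
  define K where "K = real (card ?F)"
  have fin: "finite ({..<m} \<times> ?F \<times> ?F)" using small_sets(1) by simp
  have pos: "0 < 2 * D" using assms by simp
  obtain n1 where n1: "\<forall>n\<ge>n1. \<forall>N\<ge>itexp (D * (2 * D + 2)) n. \<forall>G.
    dependent_family m r D G \<longrightarrow>
    (\<exists>e G'. refines m ?F N n e G G' \<and>
      lacunary_above K m r D n (D - D) G')"
    by (rule exE[OF rounds_exist[OF order_refl, of D m r K]])
  obtain n2 where n2: "\<forall>n\<ge>n2. \<forall>N\<ge>itexp (2 * D) n. \<forall>(I :: (nat \<times> nat set \<times> nat set) set) M \<Phi>.
      small_predicates (2 * D) (card ({..<m} \<times> ?F \<times> ?F)) I M \<Phi> \<longrightarrow>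
    (\<exists>e. strict_mono e \<and> (\<forall>t<n. e t < N) \<and> uniform_on e n I M \<Phi>)"
    by (rule exE[OF ramsey_predicates[OF pos, where c="card ({..<m} \<times> ?F \<times> ?F)"]])
  obtain n3 where n3: "\<And>n. n3 \<le> n \<Longrightarrow> 3 * n ^ 1 \<le> 2 ^ n" using cmult_power_le_exp[of 3 1] by blast
  show ?thesis
  proof (rule exI[of _ "n1 + n2 + n3"], intro allI impI)
    fix n N and G :: "nat \<Rightarrow> nat set \<Rightarrow> (nat \<Rightarrow> nat) \<Rightarrow> real"
    assume n: "n1 + n2 + n3 \<le> n" and N: "itexp (D * (2 * D + 2) + (2 * D + 1)) n \<le> N"
      and dep: "dependent_family m r D G"
    define n'' :: nat where "n'' = 2 ^ n"
    define n' where "n' = itexp (2 * D) n''"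
    have "itexp (2 * D + 1) n = n'"
      using itexp_add[of "2 * D" 1 n] by (simp add: n'_def n''_def)
    then have N': "itexp (D * (2 * D + 2)) n' \<le> N" using N by (simp only: itexp_add)
    have nn: "n < n''" unfolding n''_def by (rule less_exp)
    have "n1 \<le> n'" using n nn le_itexp[of n'' "2 * D"] unfolding n'_def by linarith
    from n1[rule_format, OF this N'] dep obtain e0 G' where e0: "refines m ?F N n' e0 G G'"
      "lacunary_above K m r D n' (D - D) G'" by blast
    have dep': "\<And>l J. l < m \<Longrightarrow> J \<in> ?F \<Longrightarrow> depends J (G' l J)" using e0(1) by (simp add: refines_def)
    define M where "M = (\<lambda>(l :: nat, J, J' :: nat set). J \<union> J')"
    define \<Phi> where "\<Phi> = (\<lambda>(l, J, J') x. \<bar>G' l J x\<bar> \<le> \<bar>G' l J' x\<bar>)"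
    have "n2 \<le> n''" using n nn by linarith
    moreover have "itexp (2 * D) n'' \<le> n'" by (simp add: n'_def)
    moreover have "small_predicates (2 * D) (card ({..<m} \<times> ?F \<times> ?F)) ({..<m} \<times> ?F \<times> ?F) M \<Phi>"
      unfolding small_predicates_def
    proof (rule conjI[OF fin conjI[OF order_refl ballI]])
      fix p assume "p \<in> {..<m} \<times> ?F \<times> ?F"
      then obtain l J J' where p: "p = (l, J, J')" "l < m" "J \<in> ?F" "J' \<in> ?F" by auto
      have "depends (J \<union> J') (\<lambda>x. \<bar>G' l J x\<bar> \<le> \<bar>G' l J' x\<bar>)"
        using dep'[OF p(2,3)] dep'[OF p(2,4)] unfolding depends_def by (metis UnCI)
      moreover have "card (J \<union> J') \<le> 2 * D"
        using p(3,4) card_Un_le[of J J'] by (auto simp: small_sets_def)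
      ultimately show "finite (M p) \<and> card (M p) \<le> 2 * D \<and> depends (M p) (\<Phi> p)"
        using small_sets(2)[OF p(3)] small_sets(2)[OF p(4)] by (simp add: M_def \<Phi>_def p(1))
    qed
    ultimately obtain e1 where e1: "strict_mono e1" "\<forall>t<n''. e1 t < n'"
      and hom: "uniform_on e1 n'' ({..<m} \<times> ?F \<times> ?F) M \<Phi>"
      using n2[rule_format] by blast
    show "uniform_signs m r D N n G"
    proof (rule signs_of_refinement[OF e0(1) _ e1(1)])
      fix l J assume lJ: "l < m" "J \<in> ?F" "J \<noteq> {}"
      then have "0 < card J" using small_sets(2) by (simp add: card_gt_0_iff)
      then show "lacunary K J n' (G' l J)" using e0(2) lJ by simp
    next
      fix l J J' x x' assume l: "l < m" "J \<in> ?F" "J' \<in> ?F" and x: "incr (J \<union> J') n'' x" "incr (J \<union> J') n'' x'"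
        and le: "\<bar>G' l J (\<lambda>i. e1 (x i))\<bar> \<le> \<bar>G' l J' (\<lambda>i. e1 (x i))\<bar>"
      have "(l, J, J') \<in> {..<m} \<times> ?F \<times> ?F" using l by simp
      from hom[unfolded uniform_on_def, rule_format, OF this, of x x'] x le
      show "\<bar>G' l J (\<lambda>i. e1 (x' i))\<bar> \<le> \<bar>G' l J' (\<lambda>i. e1 (x' i))\<bar>" by (simp add: M_def \<Phi>_def)
    qed (use e1(2) n3[of n] n in \<open>auto simp: K_def n''_def\<close>)
  qed
qed

section \<open>The linear case\<close>

definition transitive_pairs :: "nat set \<Rightarrow> (nat \<Rightarrow> nat \<Rightarrow> bool) \<Rightarrow> bool" where
  "transitive_pairs X Q \<longleftrightarrow> (\<forall>a\<in>X. \<forall>b\<in>X. \<forall>c\<in>X. a < b \<longrightarrow> b < c \<longrightarrow> Q a b \<longrightarrow> Q b c \<longrightarrow> Q a c)"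

definition homogeneous_pairs :: "nat set \<Rightarrow> (nat \<Rightarrow> nat \<Rightarrow> bool) \<Rightarrow> bool" where
  "homogeneous_pairs Y Q \<longleftrightarrow> (\<forall>a\<in>Y. \<forall>b\<in>Y. \<forall>c\<in>Y. \<forall>d\<in>Y. a < b \<longrightarrow> c < d \<longrightarrow> Q a b = Q c d)"

lemma transitive_pairs_subset: "transitive_pairs X Q \<Longrightarrow> Y \<subseteq> X \<Longrightarrow> transitive_pairs Y Q"
  unfolding transitive_pairs_def by blast

lemma homogeneous_pairs_subset: "homogeneous_pairs X Q \<Longrightarrow> Y \<subseteq> X \<Longrightarrow> homogeneous_pairs Y Q"
  unfolding homogeneous_pairs_def by blast

text \<open>Label every vertex by the size of a longest \<open>Q\<close>-chain ending there: two vertices with the same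
  label are not related.\<close>

lemma transitive_pairs_homogeneous:
  assumes X: "finite X" "p * p \<le> card X" and Q: "transitive_pairs X Q"
  obtains Y where "Y \<subseteq> X" "card Y = p" "homogeneous_pairs Y Q"
proof -
  define chain where "chain C \<longleftrightarrow> C \<subseteq> X \<and> (\<forall>a\<in>C. \<forall>b\<in>C. a < b \<longrightarrow> Q a b)" for C
  show ?thesis
  proof (cases "\<exists>C. chain C \<and> p \<le> card C")
    case True
    then obtain C Y where C: "chain C" "Y \<subseteq> C" "card Y = p" by (metis obtain_subset_with_card_n)
    then have "Y \<subseteq> X" by (auto simp: chain_def)
    moreover have "homogeneous_pairs Y Q" using C(1,2) unfolding homogeneous_pairs_def chain_def by blast
    ultimately show ?thesis using that C(3) by blast
  next
    case False
    define S where "S b = card ` {C. chain C \<and> b \<in> C \<and> C \<subseteq> {..b}}" for b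
    define label where "label b = Max (S b)" for b
    have finS: "finite (S b)" for b
    proof -
      have "{C. chain C \<and> b \<in> C \<and> C \<subseteq> {..b}} \<subseteq> Pow X" unfolding chain_def by blast
      then have "finite {C. chain C \<and> b \<in> C \<and> C \<subseteq> {..b}}" by (rule finite_subset) (simp add: X(1))
      then show ?thesis unfolding S_def by (rule finite_imageI)
    qed
    have neS: "S b \<noteq> {}" if "b \<in> X" for b
    proof -
      have "chain {b}" using that by (simp add: chain_def)
      then show ?thesis unfolding S_def by auto
    qed
    have less: "label a < label b" if ab: "a \<in> X" "b \<in> X" "a < b" "Q a b" for a b
    proof -
      have "label a \<in> S a" unfolding label_def by (rule Max_in[OF finS neS[OF ab(1)]])
      then obtain C where C: "label a = card C" "chain C" "a \<in> C" "C \<subseteq> {..a}" by (auto simp: S_def)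
      have "finite C" using C(2) X(1) finite_subset by (auto simp: chain_def)
      have Qb: "Q c b" if "c \<in> C" for c
      proof (cases "c = a")
        case False
        then have "c < a" using C(4) that by force
        then have "Q c a" using C(2,3) that by (simp add: chain_def)
        moreover have "c \<in> X" using C(2) that by (auto simp: chain_def)
        ultimately show ?thesis using Q ab \<open>c < a\<close> unfolding transitive_pairs_def by blast
      qed (use ab in simp)
      have "b \<notin> C" using C(4) ab(3) by auto
      have "chain (insert b C)"
        unfolding chain_def
      proof (intro conjI ballI impI)
        show "insert b C \<subseteq> X" using C(2) ab(2) by (auto simp: chain_def)
        fix c d assume cd: "c \<in> insert b C" "d \<in> insert b C" "c < d"
        have "c \<noteq> b" using cd C(4) ab(3) by force
        then show "Q c d" using cd Qb C(2) by (auto simp: chain_def)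
      qed
      moreover have "insert b C \<subseteq> {..b}" using C(4) ab(3) by auto
      ultimately have "card (insert b C) \<in> S b" by (auto simp: S_def)
      then have "card (insert b C) \<le> label b" unfolding label_def by (rule Max_ge[OF finS])
      then show ?thesis using C(1) \<open>b \<notin> C\<close> \<open>finite C\<close> by simp
    qed
    have "label b < p" if "b \<in> X" for b
    proof -
      have "label b \<in> S b" unfolding label_def by (rule Max_in[OF finS neS[OF that]])
      then show ?thesis using False by (auto simp: S_def not_le)
    qed
    then have "label ` X \<subseteq> {..<p}" by blast
    then have "card (label ` X) \<le> p" using card_mono[of "{..<p}"] by fastforce
    then obtain R where R: "R \<subseteq> X" "card X \<le> p * card R" "\<And>y y'. y \<in> R \<Longrightarrow> y' \<in> R \<Longrightarrow> label y = label y'"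
      using pigeonhole_fiber[OF X(1)] by blast
    have "p * p \<le> p * card R" using X(2) R(2) by linarith
    then have "p \<le> card R" by (cases "p = 0") auto
    then obtain Y where Y: "Y \<subseteq> R" "card Y = p" by (metis obtain_subset_with_card_n)
    have "\<not> Q a b" if "a \<in> Y" "b \<in> Y" "a < b" for a b
    proof
      assume "Q a b"
      then have "label a < label b" using less that Y(1) R(1) by blast
      moreover have "label a = label b" using R(3) that Y(1) by blast
      ultimately show False by simp
    qed
    then have "homogeneous_pairs Y Q" unfolding homogeneous_pairs_def by blast
    then show ?thesis using that Y R(1) by blast
  qed
qed

text \<open>Each relation costs a square root of the number of vertices, hence the exponent
  \<open>2 ^ card I\<close>. A relation and its negation are homogeneous on the same sets, so
  transitivity of either one suffices.\<close>

lemma transitive_pairs_family: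
  assumes "finite I" "finite X" "p ^ 2 ^ card I \<le> card X"
    "\<And>i. i \<in> I \<Longrightarrow> transitive_pairs X (Q i) \<or> transitive_pairs X (\<lambda>a b. \<not> Q i a b)"
  shows "\<exists>Y\<subseteq>X. card Y = p \<and> (\<forall>i\<in>I. homogeneous_pairs Y (Q i))"
  using assms
proof (induction I arbitrary: X rule: finite_induct)
  case empty
  then obtain Y where "Y \<subseteq> X" "card Y = p" using obtain_subset_with_card_n[of p X] by auto
  then show ?case by auto
next
  case (insert i I)
  let ?k = "p ^ 2 ^ card I"
  have "?k * ?k \<le> card X" using insert.prems(2) insert.hyps by (simp add: power_add mult_2)
  have "\<exists>Z\<subseteq>X. card Z = ?k \<and> homogeneous_pairs Z (Q i)"
  proof (cases "transitive_pairs X (Q i)")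
    case True
    then show ?thesis
      using transitive_pairs_homogeneous[OF insert.prems(1) \<open>?k * ?k \<le> card X\<close>] by metis
  next
    case False
    then have "transitive_pairs X (\<lambda>a b. \<not> Q i a b)" using insert.prems(3) by blast
    then obtain Z where Z: "Z \<subseteq> X" "card Z = ?k" "homogeneous_pairs Z (\<lambda>a b. \<not> Q i a b)"
      using transitive_pairs_homogeneous[OF insert.prems(1) \<open>?k * ?k \<le> card X\<close>] by metis
    then have "homogeneous_pairs Z (Q i)" unfolding homogeneous_pairs_def by blast
    then show ?thesis using Z by blast
  qed
  then obtain Z where Z: "Z \<subseteq> X" "card Z = ?k" "homogeneous_pairs Z (Q i)" by blast
  have "finite Z" using Z(1) insert.prems(1) finite_subset by blast
  moreover have "transitive_pairs Z (Q j) \<or> transitive_pairs Z (\<lambda>a b. \<not> Q j a b)" if "j \<in> I" for j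
    using insert.prems(3)[of j] transitive_pairs_subset[OF _ Z(1)] that by blast
  ultimately obtain Y where Y: "Y \<subseteq> Z" "card Y = p" "\<forall>i\<in>I. homogeneous_pairs Y (Q i)"
    using insert.IH[of Z] Z(2) by auto
  then show ?case using Z homogeneous_pairs_subset[OF Z(3) Y(1)] by (intro exI[of _ Y]) auto
qed

section \<open>Adjacent differences and homogeneous triples\<close>

abbreviation nearer :: "('a \<Rightarrow> real) \<Rightarrow> 'a \<Rightarrow> 'a \<Rightarrow> 'a \<Rightarrow> bool" where
  "nearer v a b c \<equiv> \<bar>v b - v a\<bar> \<le> \<bar>v c - v b\<bar>"

abbreviation farther :: "('a \<Rightarrow> real) \<Rightarrow> 'a \<Rightarrow> 'a \<Rightarrow> 'a \<Rightarrow> bool" where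
  "farther v a b c \<equiv> \<bar>v c - v b\<bar> \<le> \<bar>v b - v a\<bar>"

abbreviation all_triples :: "'a::linorder set \<Rightarrow> ('a \<Rightarrow> 'a \<Rightarrow> 'a \<Rightarrow> bool) \<Rightarrow> bool" where
  "all_triples Y Q \<equiv> \<forall>a\<in>Y. \<forall>b\<in>Y. \<forall>c\<in>Y. a < b \<longrightarrow> b < c \<longrightarrow> Q a b c"

definition monotone_family :: "nat set \<Rightarrow> 'p set \<Rightarrow> ('p \<Rightarrow> nat \<Rightarrow> real) \<Rightarrow> bool" where
  "monotone_family Y I u \<longleftrightarrow> (\<forall>p\<in>I. \<exists>sg. \<forall>a\<in>Y. \<forall>b\<in>Y. a < b \<longrightarrow> sgn (u p b - u p a) = sg)"

lemma monotone_family_subset: "monotone_family X I u \<Longrightarrow> Y \<subseteq> X \<Longrightarrow> monotone_family Y I u"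
  unfolding monotone_family_def by (meson subsetD)

lemma monotone_family_dist:
  assumes "monotone_family Y I u" "p \<in> I" "a \<in> Y" "b \<in> Y" "c \<in> Y" "a \<le> b" "b \<le> c"
  shows "\<bar>u p b - u p a\<bar> \<le> \<bar>u p c - u p a\<bar>" "\<bar>u p c - u p b\<bar> \<le> \<bar>u p c - u p a\<bar>"
proof -
  obtain sg where sg: "\<And>a b. a \<in> Y \<Longrightarrow> b \<in> Y \<Longrightarrow> a < b \<Longrightarrow> sgn (u p b - u p a) = sg"
    using assms(1,2) unfolding monotone_family_def by blast
  have "\<bar>u p b - u p a\<bar> \<le> \<bar>u p c - u p a\<bar> \<and> \<bar>u p c - u p b\<bar> \<le> \<bar>u p c - u p a\<bar>"
  proof (cases "a < b \<and> b < c")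
    case True
    then have "sgn (u p b - u p a) = sgn (u p c - u p b)" using sg assms by metis
    then show ?thesis by (auto simp: sgn_real_def split: if_splits)
  next
    case False
    then have "a = b \<or> b = c" using assms by linarith
    then show ?thesis by auto
  qed
  then show "\<bar>u p b - u p a\<bar> \<le> \<bar>u p c - u p a\<bar>" "\<bar>u p c - u p b\<bar> \<le> \<bar>u p c - u p a\<bar>" by auto
qed

text \<open>Strict increase and strict decrease are two transitive relations for each function,
  which explains \<open>2 * card I\<close>. If both fail throughout, the sign is 0.\<close>

lemma monotone_family_exists:
  assumes "finite I" "finite X" "k ^ 2 ^ (2 * card I) \<le> card X"
  obtains Y where "Y \<subseteq> X" "card Y = k" "monotone_family Y I u"
proof -
  define Q where "Q = (\<lambda>(p, up) a b. if up then u p a < u p b else u p b < u p a)"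
  have "\<exists>Y\<subseteq>X. card Y = k \<and> (\<forall>i\<in>I \<times> UNIV. homogeneous_pairs Y (Q i))"
    using assms by (intro transitive_pairs_family) (auto simp: Q_def transitive_pairs_def card_cartesian_product mult.commute)
  then obtain Y where Y: "Y \<subseteq> X" "card Y = k" "\<And>p up. p \<in> I \<Longrightarrow> homogeneous_pairs Y (Q (p, up))" by blast
  have "\<exists>sg. \<forall>a\<in>Y. \<forall>b\<in>Y. a < b \<longrightarrow> sgn (u p b - u p a) = sg" if p: "p \<in> I" for p
  proof (cases "\<exists>a\<in>Y. \<exists>b\<in>Y. a < b")
    case True
    then obtain a b where ab: "a \<in> Y" "b \<in> Y" "a < b" by blast
    have "sgn (u p d - u p c) = sgn (u p b - u p a)" if "c \<in> Y" "d \<in> Y" "c < d" for c d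
    proof -
      have "Q (p, up) a b = Q (p, up) c d" for up
        using Y(3)[OF p, of up] ab that unfolding homogeneous_pairs_def by blast
      from this[of True] this[of False] show ?thesis by (auto simp: Q_def sgn_real_def)
    qed
    then show ?thesis by blast
  qed blast
  then have "monotone_family Y I u" by (simp add: monotone_family_def)
  then show ?thesis using that Y(1,2) by blast
qed

text \<open>For monotone \<open>u p\<close> the comparison is monotone in the last vertex, so that a chosen prefix
  splits the remaining vertices into few types only.\<close>

lemma triples_end_homogeneous:
  assumes I: "finite I" and X: "finite X" "(2 * (card I * M + 1)) ^ M \<le> card X" and mon: "monotone_family X I u"
  obtains W where "W \<subseteq> X" "card W = M"
    "\<And>p a b c c'. \<lbrakk>p \<in> I; a \<in> W; b \<in> W; c \<in> W; c' \<in> W; a < b; b < c; b < c'\<rbrakk> \<Longrightarrow>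
      nearer (u p) a b c \<longleftrightarrow> nearer (u p) a b c'"
proof -
  define P where "P B w y = {(v, p). v \<in> B \<and> p \<in> I \<and> nearer (u p) v w y}" for B and w y :: nat
  let ?Q = "card I * M + 1"
  have "0 < ?Q" by simp
  obtain W where W: "W \<subseteq> X" "card W = M" and
    hom: "\<And>w B y y'. \<lbrakk>w \<in> W; B \<subseteq> W \<inter> {..<w}; y \<in> W; y' \<in> W; w < y; w < y'\<rbrakk> \<Longrightarrow> P B w y = P B w y'"
  proof (rule end_homogeneous_subset[OF X \<open>0 < ?Q\<close>, of P])
    fix W w R assume WX: "W \<subseteq> X" and wX: "w \<in> X" and RX: "R \<subseteq> X" and cW: "card W < M"
      and less: "\<And>y. y \<in> R \<Longrightarrow> w < y"
    have finW: "finite W" using WX X(1) finite_subset by blast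
    have finR: "finite R" using RX X(1) finite_subset by blast
    have finP: "finite (P W w y)" "card (P W w y) \<le> card I * M" for y
    proof -
      have sub: "P W w y \<subseteq> W \<times> I" by (auto simp: P_def)
      show "finite (P W w y)" by (rule finite_subset[OF sub]) (use finW I in simp)
      have "card (P W w y) \<le> card (W \<times> I)" by (rule card_mono[OF _ sub]) (use finW I in simp)
      also have "\<dots> \<le> card I * M" using cW by (simp add: card_cartesian_product mult.commute)
      finally show "card (P W w y) \<le> card I * M" .
    qed
    have "(\<lambda>y. card (P W w y)) ` R \<subseteq> {..card I * M}" using finP(2) by blast
    then have "card ((\<lambda>y. card (P W w y)) ` R) \<le> ?Q" using card_mono[of "{..card I * M}"] by fastforce
    then obtain R' where R': "R' \<subseteq> R" "card R \<le> ?Q * card R'"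
      "\<And>y y'. y \<in> R' \<Longrightarrow> y' \<in> R' \<Longrightarrow> card (P W w y) = card (P W w y')"
      using pigeonhole_fiber[OF finR, of "\<lambda>y. card (P W w y)" ?Q] by blast
    \<comment> \<open>The types of the vertices in the reservoir form a chain under inclusion, so a
      type is determined by its cardinality. This leaves at most \<open>card I * M + 1\<close>
      types, where an arbitrary family could have exponentially many.\<close>
    have mono: "P W w y \<subseteq> P W w y'" if "y \<in> R'" "y' \<in> R'" "y \<le> y'" for y y'
    proof -
      have yy: "y \<in> X" "y' \<in> X" "w < y" using that R'(1) RX less by auto
      have le: "\<bar>u p y - u p w\<bar> \<le> \<bar>u p y' - u p w\<bar>" if "p \<in> I" for p
        using monotone_family_dist(1)[OF mon that wX yy(1,2)] yy(3) \<open>y \<le> y'\<close> by simp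
      show ?thesis unfolding P_def using le by (auto intro: order_trans)
    qed
    have eqW: "P W w y = P W w y'" if "y \<in> R'" "y' \<in> R'" for y y'
      using that mono R'(3)[OF that] finP(1) by (metis card_subset_eq linorder_linear)
    have "P B w y = P B w y'" if "B \<subseteq> W" "y \<in> R'" "y' \<in> R'" for B y y'
    proof -
      have "P B w z = P W w z \<inter> B \<times> UNIV" for z using that(1) by (auto simp: P_def)
      from this[of y] this[of y'] eqW[OF that(2,3)] show ?thesis by (simp only:)
    qed
    then show "\<exists>R'\<subseteq>R. card R \<le> ?Q * card R' \<and> (\<forall>B\<subseteq>W. \<forall>y\<in>R'. \<forall>y'\<in>R'. P B w y = P B w y')"
      using R'(1,2) by blast
  qed (rule that)
  show ?thesis
  proof (rule that[OF W])
    fix p a b c c' assume p: "p \<in> I" and abc: "a \<in> W" "b \<in> W" "c \<in> W" "c' \<in> W" "a < b" "b < c" "b < c'"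
    have "P {a} b c = P {a} b c'" by (rule hom) (use abc in auto)
    then have "(a, p) \<in> P {a} b c \<longleftrightarrow> (a, p) \<in> P {a} b c'" by simp
    then show "nearer (u p) a b c \<longleftrightarrow> nearer (u p) a b c'"
      using p by (simp add: P_def)
  qed
qed

definition homogeneous_triples :: "nat set \<Rightarrow> 'p set \<Rightarrow> ('p \<Rightarrow> nat \<Rightarrow> real) \<Rightarrow> bool" where
  "homogeneous_triples Y I u \<longleftrightarrow> (\<forall>p\<in>I.
    all_triples Y (nearer (u p)) \<or> all_triples Y (farther (u p)))"

text \<open>In an end-homogeneous set the last vertex of a triple can be replaced by the maximum
  \<open>z\<close>, which leaves relations on pairs. Their negations are transitive, because for a
  monotone function the distance to \<open>c\<close> grows when the first point moves from
  \<open>b\<close> down to \<open>a\<close>. The summand 1 in the bound for \<open>M\<close> pays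
  for \<open>z\<close>.\<close>

lemma homogeneous_triples_exists:
  assumes I: "finite I" and X: "finite X" and M: "n ^ 2 ^ card I + 1 \<le> M"
    and cX: "((2 * (card I * M + 1)) ^ M) ^ 2 ^ (2 * card I) \<le> card X"
  obtains Y where "Y \<subseteq> X" "card Y = n" "monotone_family Y I u" "homogeneous_triples Y I u"
proof -
  obtain X1 where X1: "X1 \<subseteq> X" "card X1 = (2 * (card I * M + 1)) ^ M" "monotone_family X1 I u"
    using monotone_family_exists[OF I X cX] by metis
  have fin1: "finite X1" using X1(1) X finite_subset by blast
  obtain W where W: "W \<subseteq> X1" "card W = M" and end_hom:
    "\<And>p a b c c'. \<lbrakk>p \<in> I; a \<in> W; b \<in> W; c \<in> W; c' \<in> W; a < b; b < c; b < c'\<rbrakk> \<Longrightarrow>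
      nearer (u p) a b c \<longleftrightarrow> nearer (u p) a b c'"
    using triples_end_homogeneous[OF I fin1 _ X1(3), of M] X1(2) by (metis order_refl)
  have finW: "finite W" using W(1) fin1 finite_subset by blast
  have mon: "monotone_family W I u" by (rule monotone_family_subset[OF X1(3) W(1)])
  define z where "z = Max W"
  have "W \<noteq> {}" using W(2) M by auto
  have z: "z \<in> W" unfolding z_def by (rule Max_in[OF finW \<open>W \<noteq> {}\<close>])
  have zmax: "y < z" if "y \<in> W - {z}" for y
    using that Max_ge[OF finW, of y] by (force simp: z_def)
  define R where "R p a b \<longleftrightarrow> nearer (u p) a b z" for p a b
  have "\<exists>Y\<subseteq>W - {z}. card Y = n \<and> (\<forall>p\<in>I. homogeneous_pairs Y (R p))"
  proof (rule transitive_pairs_family[OF I])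
    show "finite (W - {z})" using finW by simp
    show "n ^ 2 ^ card I \<le> card (W - {z})" using z finW W(2) M by simp
    fix p assume p: "p \<in> I"
    have "transitive_pairs (W - {z}) (\<lambda>a b. \<not> R p a b)"
      unfolding transitive_pairs_def
    proof (intro ballI impI)
      fix a b c assume abc: "a \<in> W - {z}" "b \<in> W - {z}" "c \<in> W - {z}" "a < b" "b < c" "\<not> R p b c"
      have "\<bar>u p c - u p b\<bar> \<le> \<bar>u p c - u p a\<bar>"
        using monotone_family_dist(2)[OF mon p, of a b c] abc by simp
      then show "\<not> R p a c" using abc(6) unfolding R_def by linarith
    qed
    then show "transitive_pairs (W - {z}) (R p) \<or> transitive_pairs (W - {z}) (\<lambda>a b. \<not> R p a b)" ..
  qed
  then obtain Y where Y: "Y \<subseteq> W - {z}" "card Y = n" "\<And>p. p \<in> I \<Longrightarrow> homogeneous_pairs Y (R p)" by blast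
  have triple: "nearer (u p) a b c \<longleftrightarrow> R p a b"
    if "p \<in> I" "a \<in> Y" "b \<in> Y" "c \<in> Y" "a < b" "b < c" for p a b c
    unfolding R_def by (rule end_hom) (use that Y(1) z zmax in auto)
  have "all_triples Y (nearer (u p)) \<or> all_triples Y (farther (u p))" if p: "p \<in> I" for p
  proof (cases "\<exists>a\<in>Y. \<exists>b\<in>Y. a < b \<and> R p a b")
    case True
    then have "R p a b" if "a \<in> Y" "b \<in> Y" "a < b" for a b
      using Y(3)[OF p] that unfolding homogeneous_pairs_def by blast
    then show ?thesis using triple[OF p] by blast
  next
    case False
    then have "farther (u p) a b c" if "a \<in> Y" "b \<in> Y" "c \<in> Y" "a < b" "b < c" for a b c
      using triple[OF p that] that by auto
    then show ?thesis by blast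
  qed
  then have "homogeneous_triples Y I u" by (simp add: homogeneous_triples_def)
  moreover have "Y \<subseteq> W" using Y(1) by blast
  ultimately show ?thesis
    using that Y(2) monotone_family_subset[OF mon] W(1) X1(1) by (metis subset_trans)
qed

lemma ex_strict_mono_enumeration:
  assumes "Y \<subseteq> {..<N}" "card Y = n"
  obtains e :: "nat \<Rightarrow> nat" where "strict_mono e" "\<And>t. t < n \<Longrightarrow> e t \<in> Y"
proof -
  have "finite Y" using assms(1) finite_subset by blast
  then obtain r where r: "strict_mono_on {..<n} r" "\<And>t. t < n \<Longrightarrow> r t \<in> Y"
    using finite_enumerate assms(2) by metis
  define e where "e t = (if t < n then r t else N + t)" for t
  have "e s < e t" if "s < t" for s t
    using strict_mono_onD[OF r(1), of s t] r(2)[of s] assms(1) that by (auto simp: e_def)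
  then have "strict_mono e" by (rule strict_monoI)
  moreover have "e t \<in> Y" if "t < n" for t using that r(2) by (simp add: e_def)
  ultimately show ?thesis using that by blast
qed

text \<open>The losses of the linear case, from the inside: \<open>3 * n + 1\<close> vertices for
  blocks of three and a dummy, the power \<open>b\<close> for pairwise comparisons, the factor
  \<open>L\<close> for thinning, the power \<open>a\<close> and one vertex for triples, the power
  \<open>M\<close> for end-homogeneity, the outer power for monotonicity. As \<open>M\<close> is
  polynomial in \<open>n\<close>, all this is 2 to a polynomial in \<open>n\<close>, which
  \<open>2 ^ (n - 1)\<close> outgrows.\<close>

lemma power_tower_bound:
  fixes a b c L :: nat
  obtains n0 where "\<And>n M. \<lbrakk>n0 \<le> n; M = (L * (3 * n + 1) ^ b + 2) ^ a + 1\<rbrakk> \<Longrightarrow>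
    ((2 * (c * M + 1)) ^ M) ^ 2 ^ (2 * c) \<le> 2 ^ 2 ^ (n - 1)"
proof -
  define C1 where "C1 = (L * 4 ^ b + 2) ^ a + 1"
  define C2 where "C2 = 2 * (c + 1) * 2 ^ (2 * c) * C1 ^ 2"
  obtain n1 where n1: "\<And>n. n1 \<le> n \<Longrightarrow> 2 * C2 * n ^ (2 * (b * a)) \<le> 2 ^ n"
    using cmult_power_le_exp[of "2 * C2" "2 * (b * a)"] by blast
  show ?thesis
  proof (rule that[of "n1 + 1"])
    fix n M assume n: "n1 + 1 \<le> n" and M: "M = (L * (3 * n + 1) ^ b + 2) ^ a + 1"
    have p1: "1 \<le> n ^ k" for k using n by simp
    have "(3 * n + 1) ^ b \<le> (4 * n) ^ b" using n by (intro power_mono) auto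
    then have "L * (3 * n + 1) ^ b + 2 \<le> L * (4 * n) ^ b + 2 * n ^ b"
      using p1[of b] by (intro add_mono mult_le_mono2) auto
    also have "\<dots> = (L * 4 ^ b + 2) * n ^ b" by (simp add: power_mult_distrib algebra_simps)
    finally have "(L * (3 * n + 1) ^ b + 2) ^ a \<le> ((L * 4 ^ b + 2) * n ^ b) ^ a" by (rule power_mono) simp
    also have "\<dots> = (L * 4 ^ b + 2) ^ a * n ^ (b * a)" by (simp only: power_mult_distrib power_mult)
    finally have "M \<le> (L * 4 ^ b + 2) ^ a * n ^ (b * a) + 1 * n ^ (b * a)"
      unfolding M using p1[of "b * a"] by linarith
    then have MC: "M \<le> C1 * n ^ (b * a)" unfolding C1_def by (simp only: add_mult_distrib)
    have M1: "1 \<le> M" unfolding M by simp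
    have "2 * (c * M + 1) * M * 2 ^ (2 * c) \<le> 2 * (c * M + M) * M * 2 ^ (2 * c)"
      using M1 by (intro mult_right_mono mult_left_mono add_left_mono) auto
    also have "\<dots> = 2 * (c + 1) * 2 ^ (2 * c) * M ^ 2" by (simp add: power2_eq_square algebra_simps)
    also have "\<dots> \<le> 2 * (c + 1) * 2 ^ (2 * c) * (C1 * n ^ (b * a)) ^ 2"
      using MC by (intro mult_left_mono power_mono) auto
    also have "\<dots> = C2 * n ^ (2 * (b * a))"
      by (simp only: C2_def power_mult_distrib power_mult[symmetric] mult.assoc mult.commute[of 2 "b * a"])
    also have "\<dots> \<le> 2 ^ (n - 1)"
    proof -
      have "(2::nat) ^ n = 2 * 2 ^ (n - 1)" using n by (cases n) auto
      then show ?thesis using n1[of n] n by (simp add: mult.assoc)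
    qed
    finally have le: "2 * (c * M + 1) * M * 2 ^ (2 * c) \<le> 2 ^ (n - 1)" .
    have "((2 * (c * M + 1)) ^ M) ^ 2 ^ (2 * c) \<le> ((2 ^ (2 * (c * M + 1))) ^ M) ^ 2 ^ (2 * c)"
      by (intro power_mono[OF power_mono[OF less_imp_le[OF less_exp]]]) simp_all
    also have "\<dots> = 2 ^ (2 * (c * M + 1) * M * 2 ^ (2 * c))" by (simp only: power_mult)
    also have "\<dots> \<le> 2 ^ 2 ^ (n - 1)" using le by (rule power_increasing) simp
    finally show "((2 * (c * M + 1)) ^ M) ^ 2 ^ (2 * c) \<le> 2 ^ 2 ^ (n - 1)" .
  qed
qed

section \<open>Terms of at most one variable\<close>

lemma oriented_singleton:
  assumes g: "\<And>x. g x = v (x i)"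
    and sgn: "\<And>s t. s < t \<Longrightarrow> t < n \<Longrightarrow> sgn (v t - v s) = sg"
    and triples: "all_triples {..<n} (nearer v) \<or> all_triples {..<n} (farther v)"
  shows "\<exists>up sg. oriented {i} n g up sg"
proof -
  have mix: "mix {i} g a b = v (b i) - v (a i)" for a b
  proof -
    have "Pow {i} = {{}, {i}}" by auto
    then show ?thesis by (simp add: mix_def g)
  qed
  have "oriented {i} n g (\<lambda>_. all_triples {..<n} (nearer v)) sg"
    unfolding oriented_def mix using sgn triples by (auto simp: interleaved_def)
  then show ?thesis by blast
qed

lemma small_sets_1: "J \<in> small_sets r 1 \<Longrightarrow> J = {} \<or> (\<exists>i<r. J = {i})"
proof -
  assume J: "J \<in> small_sets r 1"
  then have "finite J" by (rule small_sets(2))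
  have "card J = 0 \<or> card J = 1" using J by (auto simp: small_sets_def)
  then show ?thesis
  proof
    assume "card J = 0"
    then show ?thesis using \<open>finite J\<close> by simp
  next
    assume "card J = 1"
    then show ?thesis using J by (auto simp: card_1_singleton_iff small_sets_def)
  qed
qed

lemma lacunary_singleton_mono:
  assumes "lacunary K {i} n h" "1 \<le> K"
  shows "(\<forall>s t. s < t \<longrightarrow> t < n \<longrightarrow> \<bar>h (\<lambda>_. s)\<bar> \<le> \<bar>h (\<lambda>_. t)\<bar>) \<or>
    (\<forall>s t. s < t \<longrightarrow> t < n \<longrightarrow> \<bar>h (\<lambda>_. t)\<bar> \<le> \<bar>h (\<lambda>_. s)\<bar>)"
proof -
  have inc: "incr {i} n (\<lambda>_. s)" if "s < n" for s using that by (simp add: incr_def)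
  have le: "v \<le> w" if "K * v \<le> w" "0 \<le> v" for v w :: real
    using that mult_right_mono[OF assms(2) that(2)] by linarith
  have "grows K {i} n i h \<or> decays K {i} n i h" using assms(1) by (simp add: lacunary_def)
  then show ?thesis
  proof (rule disj_forward)
    assume g: "grows K {i} n i h"
    have "K * \<bar>h (\<lambda>_. s)\<bar> \<le> \<bar>h (\<lambda>_. t)\<bar>" if "s < t" "t < n" for s t
      by (rule g[unfolded grows_def, rule_format]) (use inc[of s] inc[of t] that in simp_all)
    then show "\<forall>s t. s < t \<longrightarrow> t < n \<longrightarrow> \<bar>h (\<lambda>_. s)\<bar> \<le> \<bar>h (\<lambda>_. t)\<bar>" using le by simp
  next
    assume d: "decays K {i} n i h"
    have "K * \<bar>h (\<lambda>_. t)\<bar> \<le> \<bar>h (\<lambda>_. s)\<bar>" if "s < t" "t < n" for s t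
      by (rule d[unfolded decays_def, rule_format]) (use inc[of s] inc[of t] that in simp_all)
    then show "\<forall>s t. s < t \<longrightarrow> t < n \<longrightarrow> \<bar>h (\<lambda>_. t)\<bar> \<le> \<bar>h (\<lambda>_. s)\<bar>" using le by simp
  qed
qed

text \<open>For monotone \<open>h\<close> the comparison is monotone in \<open>t\<close>: either
  once true or once false, it stays so. Hence the relation or its negation is transitive, whatever
  \<open>f\<close> is.\<close>

lemma monotone_comparisons_transitive:
  fixes f h :: "nat \<Rightarrow> real"
  assumes "(\<forall>s t. s < t \<longrightarrow> t < n \<longrightarrow> h s \<le> h t) \<or> (\<forall>s t. s < t \<longrightarrow> t < n \<longrightarrow> h t \<le> h s)"
  shows "transitive_pairs {..<n} (\<lambda>s t. f s \<le> h t) \<or> transitive_pairs {..<n} (\<lambda>s t. \<not> f s \<le> h t)"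
    and "transitive_pairs {..<n} (\<lambda>s t. h t \<le> f s) \<or> transitive_pairs {..<n} (\<lambda>s t. \<not> h t \<le> f s)"
proof -
  consider (a) "\<And>s t. s < t \<Longrightarrow> t < n \<Longrightarrow> h s \<le> h t" | (b) "\<And>s t. s < t \<Longrightarrow> t < n \<Longrightarrow> h t \<le> h s"
    using assms by blast
  then have "(transitive_pairs {..<n} (\<lambda>s t. f s \<le> h t) \<or> transitive_pairs {..<n} (\<lambda>s t. \<not> f s \<le> h t)) \<and>
    (transitive_pairs {..<n} (\<lambda>s t. h t \<le> f s) \<or> transitive_pairs {..<n} (\<lambda>s t. \<not> h t \<le> f s))"
  proof cases
    case a
    have "transitive_pairs {..<n} (\<lambda>s t. f s \<le> h t)" "transitive_pairs {..<n} (\<lambda>s t. \<not> h t \<le> f s)"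
    proof -
      have "f s \<le> h w" if "f s \<le> h t" "t < w" "w < n" for s t w using that a[of t w] by linarith
      moreover have "\<not> h w \<le> f s" if "\<not> h t \<le> f s" "t < w" "w < n" for s t w using that a[of t w] by linarith
      ultimately show "transitive_pairs {..<n} (\<lambda>s t. f s \<le> h t)" "transitive_pairs {..<n} (\<lambda>s t. \<not> h t \<le> f s)"
        unfolding transitive_pairs_def lessThan_iff by blast+
    qed
    then show ?thesis by blast
  next
    case b
    have "transitive_pairs {..<n} (\<lambda>s t. \<not> f s \<le> h t)" "transitive_pairs {..<n} (\<lambda>s t. h t \<le> f s)"
    proof -
      have "\<not> f s \<le> h w" if "\<not> f s \<le> h t" "t < w" "w < n" for s t w using that b[of t w] by linarith
      moreover have "h w \<le> f s" if "h t \<le> f s" "t < w" "w < n" for s t w using that b[of t w] by linarith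
      ultimately show "transitive_pairs {..<n} (\<lambda>s t. \<not> f s \<le> h t)" "transitive_pairs {..<n} (\<lambda>s t. h t \<le> f s)"
        unfolding transitive_pairs_def lessThan_iff by blast+
    qed
    then show ?thesis by blast
  qed
  then show "transitive_pairs {..<n} (\<lambda>s t. f s \<le> h t) \<or> transitive_pairs {..<n} (\<lambda>s t. \<not> f s \<le> h t)"
    "transitive_pairs {..<n} (\<lambda>s t. h t \<le> f s) \<or> transitive_pairs {..<n} (\<lambda>s t. \<not> h t \<le> f s)" by blast+
qed

text \<open>This replaces the Ramsey step for \<open>2 * D\<close>-tuples: lacunary terms of one
  variable are monotone in absolute value, so their comparisons lose only a power. A constant term
  is compared through a dummy vertex \<open>e 0\<close> below all others, which accounts for
  \<open>Suc n\<close>.\<close>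

lemma linear_comparisons:
  fixes G :: "nat \<Rightarrow> nat set \<Rightarrow> (nat \<Rightarrow> nat) \<Rightarrow> real"
  assumes dep: "\<And>l J. l < m \<Longrightarrow> J \<in> small_sets r 1 \<Longrightarrow> depends J (G l J)"
    and lac: "\<And>l J. l < m \<Longrightarrow> J \<in> small_sets r 1 \<Longrightarrow> J \<noteq> {} \<Longrightarrow> lacunary K J n' (G l J)"
    and K: "1 \<le> K"
    and n': "Suc n ^ 2 ^ card ({..<m} \<times> small_sets r 1 \<times> small_sets r 1 \<times> (UNIV :: bool set)) \<le> n'"
  obtains e where "strict_mono e" "\<And>t. t < n \<Longrightarrow> e t < n'"
    "\<And>l J J' x x'. \<lbrakk>l < m; J \<in> small_sets r 1; J' \<in> small_sets r 1; incr (J \<union> J') n x; incr (J \<union> J') n x';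
      \<bar>G l J (\<lambda>i. e (x i))\<bar> \<le> \<bar>G l J' (\<lambda>i. e (x i))\<bar>\<rbrakk>
    \<Longrightarrow> \<bar>G l J (\<lambda>i. e (x' i))\<bar> \<le> \<bar>G l J' (\<lambda>i. e (x' i))\<bar>"
proof -
  let ?F = "small_sets r 1"
  let ?I = "{..<m} \<times> ?F \<times> ?F \<times> (UNIV :: bool set)"
  define \<phi> where "\<phi> l J t = \<bar>G l J (\<lambda>_. t)\<bar>" for l J and t :: nat
  have depeq: "G l C y = G l C y'" if "l < m" "C \<in> ?F" "\<forall>i\<in>C. y i = y' i" for l C y y'
    using dep[OF that(1,2)] that(3) unfolding depends_def by blast
  have mono: "(\<forall>s t. s < t \<longrightarrow> t < n' \<longrightarrow> \<phi> l J s \<le> \<phi> l J t) \<or> (\<forall>s t. s < t \<longrightarrow> t < n' \<longrightarrow> \<phi> l J t \<le> \<phi> l J s)"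
    if lJ: "l < m" "J \<in> ?F" for l J
  proof (cases "J = {}")
    case True
    then have "\<phi> l J s = \<phi> l J t" for s t
      unfolding \<phi>_def using depeq[OF lJ, of "\<lambda>_. s" "\<lambda>_. t"] by simp
    then show ?thesis by (metis order_refl)
  next
    case False
    then obtain i where "J = {i}" using small_sets_1[OF lJ(2)] by blast
    then show ?thesis using lacunary_singleton_mono[of K i n' "G l J"] lac[OF lJ False] K
      unfolding \<phi>_def by simp
  qed
  \<comment> \<open>The flag \<open>up\<close> tells whether the vertex read by \<open>J\<close>
    precedes the one read by \<open>J'\<close>, since pairs are always taken with
    \<open>s < t\<close>.\<close>
  define Q where "Q = (\<lambda>(l, J, J', up) s t. if up then \<phi> l J s \<le> \<phi> l J' t else \<phi> l J t \<le> \<phi> l J' s)"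
  have "\<exists>Y\<subseteq>{..<n'}. card Y = Suc n \<and> (\<forall>p\<in>?I. homogeneous_pairs Y (Q p))"
  proof (rule transitive_pairs_family)
    show "finite ?I" by (intro finite_cartesian_product small_sets(1)) simp_all
    fix p assume "p \<in> ?I"
    then obtain l J J' up where p: "p = (l, J, J', up)" "l < m" "J \<in> ?F" "J' \<in> ?F" by auto
    show "transitive_pairs {..<n'} (Q p) \<or> transitive_pairs {..<n'} (\<lambda>a b. \<not> Q p a b)"
    proof (cases up)
      case True
      then show ?thesis using monotone_comparisons_transitive(1)[OF mono[OF p(2,4)], of "\<phi> l J"] by (simp add: Q_def p(1))
    next
      case False
      then show ?thesis using monotone_comparisons_transitive(2)[OF mono[OF p(2,3)], of "\<phi> l J'"] by (simp add: Q_def p(1))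
    qed
  qed (use n' in auto)
  then obtain Y where Y: "Y \<subseteq> {..<n'}" "card Y = Suc n" "\<forall>p\<in>?I. homogeneous_pairs Y (Q p)" by blast
  obtain e where e: "strict_mono e" "\<And>t. t < Suc n \<Longrightarrow> e t \<in> Y"
    using ex_strict_mono_enumeration[OF Y(1,2)] by blast
  have hom: "Q p (e s) (e t) = Q p (e s') (e t')" if "p \<in> ?I" "s < t" "t < Suc n" "s' < t'" "t' < Suc n" for p s t s' t'
  proof -
    have "e s < e t" "e s' < e t'" using e(1) that by (simp_all add: strict_mono_less)
    then show ?thesis using Y(3)[rule_format, OF that(1)] e(2) that unfolding homogeneous_pairs_def by simp
  qed
  define e1 where "e1 t = e (Suc t)" for t
  have "strict_mono e1" using e(1) by (simp add: e1_def strict_mono_def)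
  moreover have "e1 t < n'" if "t < n" for t using e(2)[of "Suc t"] Y(1) that by (auto simp: e1_def)
  moreover have "\<bar>G l J (\<lambda>i. e1 (x' i))\<bar> \<le> \<bar>G l J' (\<lambda>i. e1 (x' i))\<bar>"
    if l: "l < m" and J: "J \<in> ?F" "J' \<in> ?F" and x: "incr (J \<union> J') n x" "incr (J \<union> J') n x'"
      and le: "\<bar>G l J (\<lambda>i. e1 (x i))\<bar> \<le> \<bar>G l J' (\<lambda>i. e1 (x i))\<bar>" for l J J' x x'
  proof -
    have v0: "\<bar>G l C y\<bar> = \<phi> l C t" if "C = {}" "C \<in> ?F" for C y t
      unfolding \<phi>_def using depeq[OF l that(2), of y "\<lambda>_. t"] that(1) by simp
    have v1: "\<bar>G l C (\<lambda>i. e1 (y i))\<bar> = \<phi> l C (e (Suc (y k)))" if "C = {k}" "C \<in> ?F" for C y k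
      unfolding \<phi>_def using depeq[OF l that(2), of "\<lambda>i. e1 (y i)" "\<lambda>_. e (Suc (y k))"] that(1)
      by (simp add: e1_def)
    have bound: "y i < n" if "incr (J \<union> J') n y" "i \<in> J \<union> J'" for y i using that by (simp add: incr_def)
    have I: "(l, J, J', up) \<in> ?I" for up using l J by simp
    consider (none) "J = {}" "J' = {}" | (right) k where "J = {}" "J' = {k}" | (left) i where "J = {i}" "J' = {}"
      | (same) i where "J = {i}" "J' = {i}" | (less) i k where "J = {i}" "J' = {k}" "i < k"
      | (greater) i k where "J = {i}" "J' = {k}" "k < i"
      using small_sets_1[OF J(1)] small_sets_1[OF J(2)] by (metis linorder_neqE_nat)
    then show ?thesis
    proof cases
      case none
      then show ?thesis using le v0[OF _ J(1), of _ 0] v0[OF _ J(2), of _ 0] by simp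
    next
      case (right k)
      have "Q (l, J, J', True) (e 0) (e (Suc (x k))) = Q (l, J, J', True) (e 0) (e (Suc (x' k)))"
        using bound[OF x(1)] bound[OF x(2)] right by (intro hom I) auto
      then show ?thesis using le v0[OF right(1) J(1), of _ "e 0"] v1[OF right(2) J(2)] by (simp add: Q_def)
    next
      case (left i)
      have "Q (l, J, J', False) (e 0) (e (Suc (x i))) = Q (l, J, J', False) (e 0) (e (Suc (x' i)))"
        using bound[OF x(1)] bound[OF x(2)] left by (intro hom I) auto
      then show ?thesis using le v1[OF left(1) J(1)] v0[OF left(2) J(2), of _ "e 0"] by (simp add: Q_def)
    next
      case (same i)
      then show ?thesis by simp
    next
      case (less i k)
      have "x i < x k" "x' i < x' k" using x less unfolding incr_def by blast+
      then have "Q (l, J, J', True) (e (Suc (x i))) (e (Suc (x k))) = Q (l, J, J', True) (e (Suc (x' i))) (e (Suc (x' k)))"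
        using bound[OF x(1)] bound[OF x(2)] less by (intro hom I) auto
      then show ?thesis using le v1[OF less(1) J(1)] v1[OF less(2) J(2)] by (simp add: Q_def)
    next
      case (greater i k)
      have "x k < x i" "x' k < x' i" using x greater unfolding incr_def by blast+
      then have "Q (l, J, J', False) (e (Suc (x k))) (e (Suc (x i))) = Q (l, J, J', False) (e (Suc (x' k))) (e (Suc (x' i)))"
        using bound[OF x(1)] bound[OF x(2)] greater by (intro hom I) auto
      then show ?thesis using le v1[OF greater(1) J(1)] v1[OF greater(2) J(2)] by (simp add: Q_def)
    qed
  qed
  ultimately show ?thesis using that by blast
qed

text \<open>One of the two exponentials is consumed by the end-homogeneous set, whose cost is 2 to a
  polynomial in \<open>n\<close>; the other one dominates that polynomial.\<close>

lemma signs_homogeneous_linear: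
  "\<exists>n0. \<forall>n\<ge>n0. \<forall>N::nat. 2 ^ 2 ^ (n - 1) \<le> N \<longrightarrow> (\<forall>G.
    dependent_family m r 1 G \<longrightarrow> uniform_signs m r 1 N n G)"
proof -
  let ?F = "small_sets r 1"
  let ?I = "{..<m} \<times> {..<r}"
  define K where "K = real (card ?F)"
  have "0 < card ?F" using small_sets(1,4) by (metis card_gt_0_iff empty_iff)
  then have K1: "1 \<le> K" by (simp add: K_def)
  obtain L where L: "K * 2 ^ 1 \<le> 2 ^ (L - 1)" "3 \<le> L" using ex_thinning_factor[of K 1] by blast
  define b :: nat where "b = 2 ^ card ({..<m} \<times> ?F \<times> ?F \<times> (UNIV :: bool set))"
  define a :: nat where "a = 2 ^ card ?I"
  obtain n0 where n0: "\<And>n M. \<lbrakk>n0 \<le> n; M = (L * (3 * n + 1) ^ b + 2) ^ a + 1\<rbrakk> \<Longrightarrow>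
    ((2 * (card ?I * M + 1)) ^ M) ^ 2 ^ (2 * card ?I) \<le> 2 ^ 2 ^ (n - 1)"
    using power_tower_bound[of L b a "card ?I"] by blast
  show ?thesis
  proof (rule exI[of _ n0], intro allI impI)
    fix n N :: nat and G :: "nat \<Rightarrow> nat set \<Rightarrow> (nat \<Rightarrow> nat) \<Rightarrow> real"
    assume n: "n0 \<le> n" and N: "2 ^ 2 ^ (n - 1) \<le> N" and dep: "dependent_family m r 1 G"
    \<comment> \<open>The sizes are fixed in the reverse order of their use: \<open>n1\<close>
      vertices enter the comparisons, \<open>n2\<close> the thinning, and \<open>M\<close> the
      selection of triples.\<close>
    define n1 where "n1 = (3 * n + 1) ^ b"
    define n2 where "n2 = L * n1 + 2"
    define M where "M = n2 ^ a + 1"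
    define u where "u = (\<lambda>(l, i) t. G l {i} (\<lambda>_. t))"
    have "M = (L * (3 * n + 1) ^ b + 2) ^ a + 1" by (simp add: M_def n2_def n1_def)
    then have big: "((2 * (card ?I * M + 1)) ^ M) ^ 2 ^ (2 * card ?I) \<le> card {..<N}"
      unfolding card_lessThan by (rule order_trans[OF n0[OF n] N])
    have "finite ?I" "n2 ^ 2 ^ card ?I + 1 \<le> M" by (simp_all add: M_def a_def)
    then obtain Y where Y: "Y \<subseteq> {..<N}" "card Y = n2" "monotone_family Y ?I u" "homogeneous_triples Y ?I u"
      using homogeneous_triples_exists[OF _ finite_lessThan _ big] by blast
    obtain e0 where e0: "strict_mono e0" "\<And>t. t < n2 \<Longrightarrow> e0 t \<in> Y"
      using ex_strict_mono_enumeration[OF Y(1,2)] by blast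
    have e0N: "e0 t < N" if "t < n2" for t using e0(2)[OF that] Y(1) by blast
    have e0less: "e0 s < e0 t" if "s < t" for s t using e0(1) that by (simp add: strict_mono_less)
    have "\<exists>G'. refines m ?F N n1 (\<lambda>t. e0 (L * Suc t)) G G' \<and>
      lacunary_from K m r 1 n1 1 G'"
    proof (rule refines_lacunary_round[OF order_refl e0(1) e0N _ _ _ L])
      fix l J assume l: "l < m" and J: "J \<in> ?F"
      show "depends J (G l J)" using dep l J by blast
      show "lacunary K J N (G l J)" if "1 < card J" using that J by (simp add: small_sets_def)
      assume "card J = 1"
      then obtain i where i: "J = {i}" "i < r" using small_sets_1[OF J] by auto
      have p: "(l, i) \<in> ?I" using l i by simp
      obtain sg where sg: "\<forall>a\<in>Y. \<forall>b\<in>Y. a < b \<longrightarrow> sgn (u (l, i) b - u (l, i) a) = sg"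
        using Y(3) p unfolding monotone_family_def by blast
      have tr: "all_triples Y (nearer (u (l, i))) \<or> all_triples Y (farther (u (l, i)))"
        using Y(4) p unfolding homogeneous_triples_def by blast
      show "\<exists>up sg. oriented J n2 (\<lambda>x. G l J (\<lambda>i. e0 (x i))) up sg"
        unfolding i(1)
      proof (rule oriented_singleton[where v="\<lambda>t. u (l, i) (e0 t)"])
        show "G l {i} (\<lambda>i. e0 (x i)) = u (l, i) (e0 (x i))" for x
          using dependsD[OF dep[rule_format, OF l J], of "\<lambda>k. e0 (x k)" "\<lambda>_. e0 (x i)"] i(1)
          by (simp add: u_def)
        show "sgn (u (l, i) (e0 t) - u (l, i) (e0 s)) = sg" if "s < t" "t < n2" for s t
          using sg e0(2) e0less that by simp
        show "all_triples {..<n2} (nearer (\<lambda>t. u (l, i) (e0 t))) \<or> all_triples {..<n2} (farther (\<lambda>t. u (l, i) (e0 t)))"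
          using tr
        proof (rule disj_forward)
          assume h: "all_triples Y (nearer (u (l, i)))"
          show "all_triples {..<n2} (nearer (\<lambda>t. u (l, i) (e0 t)))"
            by (intro ballI impI h[rule_format] e0(2) e0less) auto
        next
          assume h: "all_triples Y (farther (u (l, i)))"
          show "all_triples {..<n2} (farther (\<lambda>t. u (l, i) (e0 t)))"
            by (intro ballI impI h[rule_format] e0(2) e0less) auto
        qed
      qed
    qed (simp_all add: n2_def)
    then obtain G' where ref: "refines m ?F N n1 (\<lambda>t. e0 (L * Suc t)) G G'"
      and lac: "lacunary_from K m r 1 n1 1 G'" by blast
    have dep': "depends J (G' l J)" if "l < m" "J \<in> ?F" for l J using ref that by (simp add: refines_def)
    have lac': "lacunary K J n1 (G' l J)" if "l < m" "J \<in> ?F" "J \<noteq> {}" for l J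
      using lac that small_sets(2)[OF that(2)] by (simp add: Suc_le_eq card_gt_0_iff)
    have n1: "Suc (3 * n) ^ 2 ^ card ({..<m} \<times> ?F \<times> ?F \<times> (UNIV :: bool set)) \<le> n1"
      unfolding n1_def b_def by simp
    obtain e1 where e1: "strict_mono e1" "\<And>t. t < 3 * n \<Longrightarrow> e1 t < n1"
      "\<And>l J J' x x'. \<lbrakk>l < m; J \<in> ?F; J' \<in> ?F; incr (J \<union> J') (3 * n) x; incr (J \<union> J') (3 * n) x';
        \<bar>G' l J (\<lambda>i. e1 (x i))\<bar> \<le> \<bar>G' l J' (\<lambda>i. e1 (x i))\<bar>\<rbrakk>
      \<Longrightarrow> \<bar>G' l J (\<lambda>i. e1 (x' i))\<bar> \<le> \<bar>G' l J' (\<lambda>i. e1 (x' i))\<bar>"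
    proof (rule linear_comparisons[of m r G' K n1 "3 * n"])
      show "depends J (G' l J)" if "l < m" "J \<in> ?F" for l J by (rule dep'[OF that])
      show "lacunary K J n1 (G' l J)" if "l < m" "J \<in> ?F" "J \<noteq> {}" for l J by (rule lac'[OF that])
    qed (rule K1, rule n1, rule that)
    show "uniform_signs m r 1 N n G"
      by (rule signs_of_refinement[of m r 1 N n1 _ G G' K e1 "3 * n"])
        (fact ref, fact lac', fact e1(1), fact e1(2), fact e1(3), simp_all add: K_def)
  qed
qed

section \<open>The main theorem\<close>

lemma tw_Suc: "tw (Suc k) x = itexp k x"
  by (induction k) auto

text \<open>The argument \<open>n - 1\<close> comes from the minimality of \<open>n\<close> in the
  theorem, which says that \<open>N\<close> exceeds the tower at \<open>n - 1\<close>. For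
  \<open>D > 1\<close> one exponential leads back to \<open>n\<close>, as
  \<open>n \<le> 2 ^ (n - 1)\<close>; the linear case has the shift built in.\<close>

lemma signs_homogeneous_tower:
  assumes D: "0 < D"
  shows "\<exists>n0. \<forall>n\<ge>n0. \<forall>N. itexp (3 * D ^ 3 - 1) (n - 1) < N \<longrightarrow>
    (\<forall>G. dependent_family m r D G \<longrightarrow> uniform_signs m r D N n G)"
proof (cases "D = 1")
  case True
  have two: "itexp (3 * D ^ 3 - 1) k = 2 ^ 2 ^ k" for k
    using True by (simp add: numeral_2_eq_2)
  obtain n0 where n0: "\<forall>n\<ge>n0. \<forall>N::nat. 2 ^ 2 ^ (n - 1) \<le> N \<longrightarrow> (\<forall>G.
    dependent_family m r 1 G \<longrightarrow> uniform_signs m r 1 N n G)"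
    by (rule exE[OF signs_homogeneous_linear])
  show ?thesis
    unfolding two
    by (rule exI[of _ n0], intro allI impI, unfold True, rule n0[rule_format]) (assumption, erule less_imp_le, blast)
next
  case False
  let ?h = "D * (2 * D + 2) + (2 * D + 1)"
  obtain n0 where n0: "\<forall>n\<ge>n0. \<forall>N\<ge>itexp ?h n. \<forall>G.
    dependent_family m r D G \<longrightarrow> uniform_signs m r D N n G"
    by (rule exE[OF signs_homogeneous[OF D]])
  have h: "?h + 1 \<le> 3 * D ^ 3 - 1"
  proof -
    have D2: "2 \<le> D" using D False by simp
    have "2 * (D * D) \<le> D * (D * D)" using D2 by (rule mult_right_mono) simp
    moreover have "2 * D \<le> D * D" using D2 by (rule mult_right_mono) simp
    moreover have "?h = 2 * (D * D) + 4 * D + 1" by (simp add: algebra_simps)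
    ultimately have "?h + 2 \<le> 3 * (D * (D * D))" using D2 by linarith
    then show ?thesis by (simp add: power3_eq_cube mult.assoc)
  qed
  have le: "itexp ?h n \<le> itexp (3 * D ^ 3 - 1) (n - 1)" if "1 \<le> n" for n
  proof -
    have "n \<le> 2 ^ (n - 1)" using less_exp[of "n - 1"] that by linarith
    then have "itexp ?h n \<le> itexp (?h + 1) (n - 1)" unfolding itexp_add by (intro itexp_mono) simp
    also have "\<dots> \<le> itexp (?h + 1 + (3 * D ^ 3 - 1 - (?h + 1))) (n - 1)" by (rule itexp_le_add)
    also have "\<dots> = itexp (3 * D ^ 3 - 1) (n - 1)" by (simp only: le_add_diff_inverse[OF h])
    finally show ?thesis .
  qed
  show ?thesis
  proof (rule exI[of _ "n0 + 1"], intro allI impI)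
    fix n N and G :: "nat \<Rightarrow> nat set \<Rightarrow> (nat \<Rightarrow> nat) \<Rightarrow> real"
    assume n: "n0 + 1 \<le> n" and N: "itexp (3 * D ^ 3 - 1) (n - 1) < N"
      and G: "dependent_family m r D G"
    have "n0 \<le> n" "1 \<le> n" using n by auto
    moreover have "itexp ?h n \<le> N" using le[OF \<open>1 \<le> n\<close>] N by linarith
    ultimately show "uniform_signs m r D N n G"
      using n0[rule_format, of n N G] G by blast
  qed
qed

section \<open>Polynomials as sums over small index sets\<close>

lemma finite_monomial_exps: "finite (monomial_exps k D)"
proof (rule finite_subset)
  show "finite {\<alpha>. \<forall>i. (i \<in> {..<k} \<longrightarrow> \<alpha> i \<in> {..D}) \<and> (i \<notin> {..<k} \<longrightarrow> \<alpha> i = (0::nat))}"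
    by (rule finite_set_of_finite_funs) simp_all
  have "\<alpha> i \<le> D" if "(\<Sum>i<k. \<alpha> i) \<le> D" "i < k" for \<alpha> :: "nat \<Rightarrow> nat" and i
    using member_le_sum[of i "{..<k}" \<alpha>] that by simp
  then show "monomial_exps k D \<subseteq> {\<alpha>. \<forall>i. (i \<in> {..<k} \<longrightarrow> \<alpha> i \<in> {..D}) \<and> (i \<notin> {..<k} \<longrightarrow> \<alpha> i = 0)}"
    by (auto simp: monomial_exps_def)
qed

text \<open>A monomial of degree at most \<open>D\<close> involves the coordinates of at most \<open>D\<close> of the vertices.\<close>

lemma poly_sum_small_sets:
  fixes v :: "nat \<Rightarrow> nat \<Rightarrow> real"
  assumes p: "is_poly (r * d) D p" and d: "0 < d"
  shows "\<exists>G. (\<forall>J\<in>small_sets r D. depends J (G J)) \<and>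
    (\<forall>x. p (flat d r (map (\<lambda>i. v (x i)) [0..<r])) = (\<Sum>J\<in>small_sets r D. G J x))"
proof -
  let ?M = "monomial_exps (r * d) D"
  obtain c where c: "\<And>y. p y = (\<Sum>\<alpha>\<in>?M. c \<alpha> * (\<Prod>k<r * d. y k ^ \<alpha> k))"
    using p unfolding is_poly_def by blast
  define mono where "mono \<alpha> x = c \<alpha> * (\<Prod>k<r * d. v (x (k div d)) (k mod d) ^ \<alpha> k)" for \<alpha> :: "nat \<Rightarrow> nat" and x
  \<comment> \<open>Coordinate \<open>k\<close> of the flattened tuple belongs to the vertex at
    position \<open>k div d\<close>.\<close>
  define supp where "supp \<alpha> = (\<lambda>k. k div d) ` {k\<in>{..<r * d}. \<alpha> k \<noteq> 0}" for \<alpha> :: "nat \<Rightarrow> nat"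
  have div: "k div d < r" if "k < r * d" for k using that by (simp add: less_mult_imp_div_less)
  have supp: "supp \<alpha> \<in> small_sets r D" if "\<alpha> \<in> ?M" for \<alpha>
  proof -
    have "card (supp \<alpha>) \<le> card {k\<in>{..<r * d}. \<alpha> k \<noteq> 0}" unfolding supp_def by (rule card_image_le) simp
    also have "\<dots> = (\<Sum>k\<in>{k\<in>{..<r * d}. \<alpha> k \<noteq> 0}. 1)" by simp
    also have "\<dots> \<le> (\<Sum>k\<in>{k\<in>{..<r * d}. \<alpha> k \<noteq> 0}. \<alpha> k)" by (rule sum_mono) auto
    also have "\<dots> \<le> (\<Sum>k<r * d. \<alpha> k)" by (rule sum_mono2) auto
    also have "\<dots> \<le> D" using that by (simp add: monomial_exps_def)
    finally show ?thesis using div by (auto simp: small_sets_def supp_def)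
  qed
  \<comment> \<open>Monomials are grouped by the exact set of positions that they involve, so each
    is counted once.\<close>
  define G where "G J x = (\<Sum>\<alpha>\<in>{\<alpha>\<in>?M. supp \<alpha> = J}. mono \<alpha> x)" for J x
  have "depends J (G J)" for J
    unfolding depends_def
  proof (intro allI impI)
    fix x y :: "nat \<Rightarrow> nat" assume eq: "\<forall>i\<in>J. x i = y i"
    have "mono \<alpha> x = mono \<alpha> y" if "supp \<alpha> = J" for \<alpha>
    proof -
      have "v (x (k div d)) (k mod d) ^ \<alpha> k = v (y (k div d)) (k mod d) ^ \<alpha> k" if "k < r * d" for k
      proof (cases "\<alpha> k = 0")
        case False
        then have "k div d \<in> J" using that \<open>supp \<alpha> = J\<close> by (auto simp: supp_def)
        then show ?thesis using eq by simp
      qed simp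
      then show ?thesis unfolding mono_def by (intro arg_cong2[where f="(*)"] prod.cong refl) simp
    qed
    then show "G J x = G J y" unfolding G_def by (intro sum.cong refl) simp
  qed
  moreover have "p (flat d r (map (\<lambda>i. v (x i)) [0..<r])) = (\<Sum>J\<in>small_sets r D. G J x)" for x
  proof -
    have "flat d r (map (\<lambda>i. v (x i)) [0..<r]) k = v (x (k div d)) (k mod d)" if "k < r * d" for k
      using that div[OF that] by (simp add: flat_def)
    then have "p (flat d r (map (\<lambda>i. v (x i)) [0..<r])) = (\<Sum>\<alpha>\<in>?M. mono \<alpha> x)"
      unfolding c mono_def by (intro sum.cong refl arg_cong2[where f="(*)"] prod.cong) simp
    also have "\<dots> = (\<Sum>J\<in>small_sets r D. G J x)"
      unfolding G_def using supp by (intro sum.group[symmetric] finite_monomial_exps small_sets(1)) auto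
    finally show ?thesis .
  qed
  ultimately show ?thesis by blast
qed

lemma ex_increasing_enumeration:
  fixes \<sigma> :: "'a \<Rightarrow> nat"
  assumes "finite V" "inj_on \<sigma> V"
  obtains v where "\<And>i. i < card V \<Longrightarrow> v i \<in> V" "\<And>i k. i < k \<Longrightarrow> k < card V \<Longrightarrow> \<sigma> (v i) < \<sigma> (v k)"
proof -
  have "finite (\<sigma> ` V)" "card (\<sigma> ` V) = card V" using assms by (auto simp: card_image)
  then obtain r where r: "strict_mono_on {..<card V} r" "\<And>i. i < card V \<Longrightarrow> r i \<in> \<sigma> ` V"
    using finite_enumerate by metis
  define v where "v i = inv_into V \<sigma> (r i)" for i
  have v: "v i \<in> V" "\<sigma> (v i) = r i" if "i < card V" for i
    using r(2)[OF that] by (auto simp: v_def inv_into_into f_inv_into_f)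
  have "\<sigma> (v i) < \<sigma> (v k)" if "i < k" "k < card V" for i k
    using v(2) strict_mono_onD[OF r(1), of i k] that by simp
  then show ?thesis using that v(1) by blast
qed

theorem theorem1p1:
  fixes r d D m :: nat
  assumes "0 < r" "0 < d" "0 < D" "0 < m"
  shows "\<exists>N0::nat. \<forall>(V :: (nat \<Rightarrow> real) set) (\<sigma> :: (nat \<Rightarrow> real) \<Rightarrow> nat)
            (fs :: ((nat \<Rightarrow> real) \<Rightarrow> real) list) (\<Gamma> :: bool list \<Rightarrow> bool).
     finite V \<and> (\<forall>v\<in>V. in_Rd d v) \<and> inj_on \<sigma> V \<and>
     length fs = m \<and> (\<forall>f\<in>set fs. is_poly (r * d) D f) \<and> N0 \<le> card V \<longrightarrow>
     (\<exists>S\<subseteq>V. card S = (LEAST n. 0 < n \<and> card V \<le> tw (3 * D ^ 3) n) \<and>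
        ((\<forall>xs\<in>incr_tuples r \<sigma> S. sa_edge d r fs \<Gamma> xs) \<or>
         (\<forall>xs\<in>incr_tuples r \<sigma> S. \<not> sa_edge d r fs \<Gamma> xs)))"
proof -
  let ?h = "3 * D ^ 3 - 1"
  have tw: "tw (3 * D ^ 3) x = itexp ?h x" for x
  proof -
    have "3 * D ^ 3 = Suc ?h" using assms(3) by simp
    then show ?thesis by (metis tw_Suc)
  qed
  obtain n0 where n0: "\<forall>n\<ge>n0. \<forall>N. itexp ?h (n - 1) < N \<longrightarrow>
    (\<forall>G. dependent_family m r D G \<longrightarrow> uniform_signs m r D N n G)"
    by (rule exE[OF signs_homogeneous_tower[OF assms(3)]])
  show ?thesis
  \<comment> \<open>This \<open>N0\<close> forces \<open>n0 + 1 < n\<close>. Then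
    \<open>n - 1\<close> is still positive, so the minimality of \<open>n\<close> can be applied to
    it.\<close>
  proof (rule exI[of _ "itexp ?h (n0 + 1) + 1"], intro allI impI, elim conjE)
    fix V :: "(nat \<Rightarrow> real) set" and \<sigma> :: "(nat \<Rightarrow> real) \<Rightarrow> nat"
      and fs :: "((nat \<Rightarrow> real) \<Rightarrow> real) list" and \<Gamma> :: "bool list \<Rightarrow> bool"
    assume V: "finite V" "inj_on \<sigma> V" "itexp ?h (n0 + 1) + 1 \<le> card V"
      and fs: "length fs = m" "\<forall>f\<in>set fs. is_poly (r * d) D f"
    define N where "N = card V"
    define n where "n = (LEAST n. 0 < n \<and> N \<le> tw (3 * D ^ 3) n)"
    \<comment> \<open>\<open>N\<close> itself is a candidate, so the least \<open>n\<close>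
      exists.\<close>
    have "0 < N \<and> N \<le> tw (3 * D ^ 3) N" using V(3) by (simp add: tw le_itexp N_def)
    then have n: "0 < n" "N \<le> itexp ?h n" unfolding n_def tw[symmetric]
      using LeastI[of "\<lambda>n. 0 < n \<and> N \<le> tw (3 * D ^ 3) n" N] by auto
    have "n0 + 1 < n"
    proof (rule ccontr)
      assume "\<not> n0 + 1 < n"
      then have "itexp ?h n \<le> itexp ?h (n0 + 1)" by (intro itexp_mono) simp
      then show False using n(2) V(3) by (simp add: N_def)
    qed
    then have "n0 \<le> n" "0 < n - 1" by auto
    have "itexp ?h (n - 1) < N"
    proof (rule ccontr)
      assume "\<not> itexp ?h (n - 1) < N"
      then have "0 < n - 1 \<and> N \<le> tw (3 * D ^ 3) (n - 1)" using \<open>0 < n - 1\<close> by (simp add: tw)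
      then have "n \<le> n - 1" unfolding n_def by (rule Least_le)
      then show False using n(1) by simp
    qed
    obtain v where v: "\<And>i. i < N \<Longrightarrow> v i \<in> V" "\<And>i k. i < k \<Longrightarrow> k < N \<Longrightarrow> \<sigma> (v i) < \<sigma> (v k)"
      using ex_increasing_enumeration[OF V(1,2)] unfolding N_def by metis
    have "\<forall>l\<in>{..<m}. \<exists>G. (\<forall>J\<in>small_sets r D. depends J (G J)) \<and>
      (\<forall>x. (fs ! l) (flat d r (map (\<lambda>i. v (x i)) [0..<r])) = (\<Sum>J\<in>small_sets r D. G J x))"
      using fs assms(2) by (intro ballI poly_sum_small_sets) auto
    from bchoice[OF this] obtain G where G: "\<forall>l\<in>{..<m}. (\<forall>J\<in>small_sets r D. depends J (G l J)) \<and>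
      (\<forall>x. (fs ! l) (flat d r (map (\<lambda>i. v (x i)) [0..<r])) = (\<Sum>J\<in>small_sets r D. G l J x))" ..
    have "dependent_family m r D G" using G by simp
    from n0[rule_format, OF \<open>n0 \<le> n\<close> \<open>itexp ?h (n - 1) < N\<close>, of G] this
    have "uniform_signs m r D N n G" by blast
    then obtain e where e: "strict_mono e" "\<forall>t<n. e t < N"
      "\<forall>l<m. \<exists>sg. \<forall>y. incr {..<r} n y \<longrightarrow> sgn (\<Sum>J\<in>small_sets r D. G l J (\<lambda>i. e (y i))) = sg"
      unfolding uniform_signs_def by blast
    then obtain sg where sg: "\<And>l y. l < m \<Longrightarrow> incr {..<r} n y \<Longrightarrow> sgn (\<Sum>J\<in>small_sets r D. G l J (\<lambda>i. e (y i))) = sg l"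
      by metis
    define w where "w t = v (e t)" for t
    have wV: "w t \<in> V" if "t < n" for t using that v(1) e(2) by (simp add: w_def)
    have wless: "\<sigma> (w s) < \<sigma> (w t)" if "s < t" "t < n" for s t
      using that v(2) e(1,2) by (simp add: w_def strict_mono_less)
    have "inj_on w {..<n}"
    proof (rule inj_onI)
      fix s t assume "s \<in> {..<n}" "t \<in> {..<n}" "w s = w t"
      then show "s = t" using wless[of s t] wless[of t s] by (cases s t rule: linorder_cases) auto
    qed
    define S where "S = w ` {..<n}"
    have "S \<subseteq> V" using wV by (auto simp: S_def)
    moreover have "card S = n" using \<open>inj_on w {..<n}\<close> by (simp add: S_def card_image)
    \<comment> \<open>An edge reads the polynomials only through their signs. On increasing tuples
      from \<open>S\<close> these are the constants \<open>sg l\<close>, so all tuples give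
      \<open>\<Gamma>\<close> the same argument.\<close>
    moreover have "sa_edge d r fs \<Gamma> xs = \<Gamma> (map (\<lambda>l. sg l \<le> 0) [0..<m])" if xs: "xs \<in> incr_tuples r \<sigma> S" for xs
    proof -
      have len: "length xs = r" and sub: "set xs \<subseteq> S" and sorted: "sorted_wrt (\<lambda>u v. \<sigma> u < \<sigma> v) xs"
        using xs by (auto simp: incr_tuples_def)
      have "\<forall>i\<in>{..<r}. \<exists>t. t < n \<and> xs ! i = w t"
      proof
        fix i assume "i \<in> {..<r}"
        then have "xs ! i \<in> w ` {..<n}" using sub len by (auto simp: S_def)
        then show "\<exists>t. t < n \<and> xs ! i = w t" by auto
      qed
      from bchoice[OF this] obtain y where y: "\<forall>i\<in>{..<r}. y i < n \<and> xs ! i = w (y i)" ..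
      have "y i < y k" if "i < k" "k < r" for i k
      proof (rule ccontr)
        assume "\<not> y i < y k"
        then have "\<sigma> (w (y k)) \<le> \<sigma> (w (y i))" using wless[of "y k" "y i"] y that by (cases "y k = y i") auto
        moreover have "\<sigma> (xs ! i) < \<sigma> (xs ! k)" using sorted that len by (simp add: sorted_wrt_iff_nth_less)
        ultimately show False using y that by simp
      qed
      then have inc: "incr {..<r} n y" using y by (simp add: incr_def)
      have xs_eq: "xs = map (\<lambda>i. v (e (y i))) [0..<r]"
        using len y by (intro nth_equalityI) (auto simp: w_def)
      have "(fs ! l) (flat d r xs) \<le> 0 \<longleftrightarrow> sg l \<le> 0" if "l < m" for l
      proof -
        have "(fs ! l) (flat d r xs) = (\<Sum>J\<in>small_sets r D. G l J (\<lambda>i. e (y i)))"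
          using G that unfolding xs_eq by simp
        then have "sgn ((fs ! l) (flat d r xs)) = sg l" using sg[OF that inc] by simp
        then show ?thesis by (metis sgn_le_0_iff)
      qed
      then have "map (\<lambda>f. f (flat d r xs) \<le> 0) fs = map (\<lambda>l. sg l \<le> 0) [0..<m]"
        using fs(1) by (intro nth_equalityI) auto
      then show ?thesis by (simp add: sa_edge_def)
    qed
    ultimately show "\<exists>S\<subseteq>V. card S = (LEAST n. 0 < n \<and> card V \<le> tw (3 * D ^ 3) n) \<and>
        ((\<forall>xs\<in>incr_tuples r \<sigma> S. sa_edge d r fs \<Gamma> xs) \<or>
         (\<forall>xs\<in>incr_tuples r \<sigma> S. \<not> sa_edge d r fs \<Gamma> xs))"
      unfolding n_def N_def by (intro exI[of _ S]) auto
  qed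
qed

end
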